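(* Let $\psi$ be an approximating function with $\sum_{h=1}^\infty\psi(h)^2=\infty$. Let $I_0\subset\mathbb{R}$ be an interval, let $f\in C^{(3)}(I_0)$, and suppose that $f''(x)\neq 0$ for almost all $x\in I_0$. Then for almost all $x\in I_0$ the point $(x,f(x))$ is simultaneously $\psi$-approximable.
   Context: An approximating function is a decreasing function $\psi:\mathbb{R}^+\to\mathbb{R}^+$ (real, positive). For $x\in\mathbb{R}$, $\|x\|=\min\{|x-m|:m\in\mathbb{Z}\}$. A point $(y_1,y_2)\in\mathbb{R}^2$ is simultaneously $\psi$-approximable if there are infinitely many $q\in\mathbb{N}$ with $\max(\|qy_1\|,\|qy_2\|)<\psi(q)$. $C^{(3)}(I_0)$ is the set of 3-times continuously differentiable real functions on $I_0$. "Almost all" refers to one-dimensional Lebesgue measure. *)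

theory Defs
  imports "HOL-Analysis.Analysis"
begin

(* Only the values on the positive reals matter; "decreasing" is meant in the weak sense. *)
definition approximating_function :: "(real \<Rightarrow> real) \<Rightarrow> bool" where
  "approximating_function \<psi> \<longleftrightarrow> antimono_on {0<..} \<psi> \<and> (\<forall>x>0. \<psi> x > 0)"

definition dist_int :: "real \<Rightarrow> real" where
  "dist_int x = (INF m::int. \<bar>x - of_int m\<bar>)"

(* The infimum is attained, so dist_int is the minimum. *)
lemma dist_int_eq_round: "dist_int x = \<bar>x - of_int (round x)\<bar>"
  unfolding dist_int_def
proof (rule cInf_eq_minimum)
  show "\<bar>x - of_int (round x)\<bar> \<in> range (\<lambda>m::int. \<bar>x - of_int m\<bar>)"
    by blast
next
  fix y assume "y \<in> range (\<lambda>m::int. \<bar>x - of_int m\<bar>)"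
  then show "\<bar>x - of_int (round x)\<bar> \<le> y"
    using round_diff_minimal by blast
qed

definition simultaneously_approximable :: "(real \<Rightarrow> real) \<Rightarrow> real \<times> real \<Rightarrow> bool" where
  "simultaneously_approximable \<psi> y \<longleftrightarrow>
     infinite {q::nat. q > 0 \<and>
       max (dist_int (real q * fst y)) (dist_int (real q * snd y)) < \<psi> (real q)}"

(* Derivatives are taken within S, hence are one-sided at endpoints belonging to S. *)
definition deriv_within :: "real set \<Rightarrow> (real \<Rightarrow> real) \<Rightarrow> real \<Rightarrow> real" where
  "deriv_within S f x = vector_derivative f (at x within S)"

definition C_k_on :: "nat \<Rightarrow> (real \<Rightarrow> real) \<Rightarrow> real set \<Rightarrow> bool" where
  "C_k_on k f S \<longleftrightarrow>
     (\<forall>j<k. (deriv_within S ^^ j) f differentiable_on S) \<and>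
     continuous_on S ((deriv_within S ^^ k) f)"

end

theory Submission
  imports Defs "HOL-Real_Asymp.Real_Asymp"
begin

text \<open>Ubiquity. Put \<open>L\<^sub>1 = p - q x\<close> and \<open>L\<^sub>2 = s - q f(x) - f'(x) (p - q x)\<close>. By pigeonhole, every \<open>x\<close>
  admits integers \<open>0 < q \<le> m n\<close>, \<open>p\<close>, \<open>s\<close> with \<open>\<bar>L\<^sub>1\<bar> < 1/m\<close> and \<open>\<bar>L\<^sub>2\<bar> < 1/n\<close>; by Taylor expansion
  \<open>(p/q, s/q)\<close> is then within about \<open>1/(q n)\<close> of the curve. The point is to bound the set of \<open>x\<close> for which
  \<open>q\<close> may be much smaller than \<open>m n\<close>, that is, for which the lattice of the triples \<open>(q, L\<^sub>1, L\<^sub>2)\<close>,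
  scaled to covolume 1, has a vector shorter than a small \<open>\<epsilon>\<close>. This is quantitative nondivergence in dimension 3, and it
  is obtained by a descent between the lattice and its dual: where two independent lattice vectors are shorter
  than \<open>1/4\<close> and \<open>\<epsilon>\<close>, their cross product is a dual vector shorter than \<open>\<epsilon>/2\<close>; where this does not happen, short
  vectors are unique up to sign and multiples, and each is short only on a small part, of relative size \<open>O(\<surd>\<epsilon>)\<close>,
  of an interval on which it is at most \<open>1/4\<close>. Summing \<open>O(\<surd>(\<epsilon> 2\<^sup>-\<^sup>j))\<close> over the descent gives a bound \<open>O(\<surd>\<epsilon>)\<close>.

  Hence at each dyadic scale \<open>2\<^sup>k\<close> there are well-spaced rational points near the curve in the expected
  number. The neighbourhoods of these points, on which \<open>(x, f x)\<close> is approximable with denominator of size \<open>2\<^sup>k\<close>,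
  have total measure comparable to \<open>2\<^sup>k \<psi>(2\<^sup>k)\<^sup>2\<close> and are quasi-independent, so by the Chung-Erdos inequality their
  limit superior fills a fixed proportion of every subinterval, hence almost everything. Scales with
  \<open>2\<^sup>k \<psi>(2\<^sup>k)\<^sup>2 < 1/(k+1)\<^sup>2\<close> contribute a convergent sum and are discarded; this ensures that the Taylor
  error is harmless.\<close>

section \<open>A covering argument on the line\<close>

lemma measure_le_of_dist_le:
  fixes S :: "real set"
  assumes "S \<in> sets lebesgue" "0 \<le> d" and d: "\<And>x y. x \<in> S \<Longrightarrow> y \<in> S \<Longrightarrow> x \<le> y \<Longrightarrow> y - x \<le> d"
  shows "measure lebesgue S \<le> d"
proof (cases "S = {}")
  case False
  then obtain s where "s \<in> S" by blast
  have bb: "bdd_below S"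
    using d[OF _ \<open>s \<in> S\<close>] by (intro bdd_belowI[of _ "s - d"]) (smt (verit) \<open>0 \<le> d\<close>)
  have "S \<subseteq> {Inf S..Inf S + d}"
  proof
    fix x assume x: "x \<in> S"
    have "x - d \<le> Inf S"
      using False d[OF _ x] \<open>0 \<le> d\<close> by (intro cInf_greatest) (smt (verit))+
    then show "x \<in> {Inf S..Inf S + d}"
      using cInf_lower[OF x bb] by auto
  qed
  then have "measure lebesgue S \<le> measure lebesgue {Inf S..Inf S + d}"
    using assms(1) by (intro measure_mono_fmeasurable) auto
  then show ?thesis
    using \<open>0 \<le> d\<close> by simp
qed (use assms in auto)

text \<open>A subfamily of least cardinality with the same union works: among the intervals through
  a point, the one reaching furthest left and the one reaching furthest right already cover the
  others, so a third could be dropped.\<close>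

lemma finite_interval_subcover_multiplicity_two:
  fixes F :: "(real \<times> real) set"
  assumes "finite F"
  obtains G where "G \<subseteq> F" "(\<Union>(l,r)\<in>G. {l<..<r}) = (\<Union>(l,r)\<in>F. {l<..<r})"
    "\<And>y. card {i \<in> G. fst i < y \<and> y < snd i} \<le> 2"
proof -
  let ?U = "\<lambda>G. (\<Union>(l,r)\<in>G. {l<..<r::real})"
  obtain G where G: "G \<subseteq> F" "?U G = ?U F"
    and min: "\<And>G'. G' \<subseteq> F \<Longrightarrow> ?U G' = ?U F \<Longrightarrow> card G \<le> card G'"
    using ex_has_least_nat[of "\<lambda>G. G \<subseteq> F \<and> ?U G = ?U F" F card] by auto
  have fin: "finite G" using G assms finite_subset by blast
  have "card {i \<in> G. fst i < y \<and> y < snd i} \<le> 2" for y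
  proof (rule ccontr)
    let ?T = "{i \<in> G. fst i < y \<and> y < snd i}"
    assume "\<not> card ?T \<le> 2"
    have "?T \<noteq> {}" using \<open>\<not> card ?T \<le> 2\<close> by (metis card.empty zero_le)
    moreover have "finite ?T" using fin by simp
    ultimately have fT: "finite ?T" "?T \<noteq> {}" by blast+
    obtain p where p: "p \<in> ?T" "\<And>i. i \<in> ?T \<Longrightarrow> fst p \<le> fst i"
      using arg_min_if_finite[OF fT, of fst] by (meson linorder_not_less)
    obtain q where q: "q \<in> ?T" "\<And>i. i \<in> ?T \<Longrightarrow> snd i \<le> snd q"
      using arg_min_if_finite[OF fT, of "\<lambda>i. - snd i"] by (meson linorder_not_less neg_less_iff_less)
    have "\<not> ?T \<subseteq> {p, q}"
      using \<open>\<not> card ?T \<le> 2\<close> card_mono[of "{p,q}" ?T] card_insert_le_m1[of 2 "{q}" p] by auto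
    then obtain z where z: "z \<in> ?T" "z \<noteq> p" "z \<noteq> q" by blast
    have "{fst z<..<snd z} \<subseteq> {fst p<..<snd p} \<union> {fst q<..<snd q}"
      using p(2)[OF z(1)] q(2)[OF z(1)] p(1) q(1) z(1) by auto
    moreover have "p \<in> G - {z}" "q \<in> G - {z}" using p(1) q(1) z by auto
    ultimately have "{fst z<..<snd z} \<subseteq> (\<Union>i\<in>G - {z}. {fst i<..<snd i})" by blast
    then have "?U G \<subseteq> ?U (G - {z})"
      unfolding case_prod_beta by blast
    moreover have "?U (G - {z}) \<subseteq> ?U G" by (rule UN_mono) auto
    ultimately have "?U (G - {z}) = ?U F" using G(2) by (metis (no_types) subset_antisym)
    moreover have "card (G - {z}) < card G"
      using card_Diff1_less[OF fin] z(1) by blast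
    moreover have "G - {z} \<subseteq> F" using G(1) by blast
    ultimately show False using min[of "G - {z}"] by linarith
  qed
  then show ?thesis using that G by blast
qed

text \<open>The local bounds are added over finitely many of the given intervals, chosen so that no
  point lies in more than two of them. Their total length is then at most
  \<open>2 * (b - a)\<close>, which is where the factor 2 comes from.\<close>

lemma measure_le_of_local_interval_bound:
  fixes S :: "real set"
  assumes S: "S \<in> sets lebesgue" and ab: "a \<le> b" and "0 \<le> \<eta>"
    and loc: "\<And>x. x \<in> S \<Longrightarrow> \<exists>l r. l < x \<and> x < r \<and> {l<..<r} \<subseteq> {a..b} \<and>
                measure lebesgue (S \<inter> {l<..<r}) \<le> \<eta> * (r - l)"
  shows "measure lebesgue S \<le> 2 * \<eta> * (b - a)"
proof -
  have Sab: "S \<subseteq> {a..b}"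
  proof
    fix x assume "x \<in> S"
    then obtain l r where "l < x" "x < r" "{l<..<r} \<subseteq> {a..b}"
      using loc by blast
    then show "x \<in> {a..b}" by auto
  qed
  have Slm: "S \<in> lmeasurable"
    by (rule bounded_set_imp_lmeasurable[OF bounded_subset[OF bounded_closed_interval Sab] S])
  \<comment> \<open>Finite subcovers need compactness, so compact subsets come first; inner
    regularity then carries the bound to \<open>S\<close>.\<close>
  have K: "measure lebesgue K \<le> 2 * \<eta> * (b - a)" if Kc: "compact K" and KS: "K \<subseteq> S" for K
  proof -
    have "\<forall>x\<in>S. \<exists>i. fst i < x \<and> x < snd i \<and> {fst i<..<snd i} \<subseteq> {a..b} \<and>
                measure lebesgue (S \<inter> {fst i<..<snd i}) \<le> \<eta> * (snd i - fst i)"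
      using loc by fastforce
    then obtain u where u: "\<And>x. x \<in> S \<Longrightarrow> fst (u x) < x \<and> x < snd (u x) \<and> {fst (u x)<..<snd (u x)} \<subseteq> {a..b} \<and>
                measure lebesgue (S \<inter> {fst (u x)<..<snd (u x)}) \<le> \<eta> * (snd (u x) - fst (u x))"
      by metis
    have cov: "K \<subseteq> (\<Union>x\<in>K. {fst (u x)<..<snd (u x)})" using u KS by force
    obtain K' where K': "K' \<subseteq> K" "finite K'" "K \<subseteq> (\<Union>x\<in>K'. {fst (u x)<..<snd (u x)})"
      by (rule compactE_image[OF Kc _ cov]) auto
    obtain G where G: "G \<subseteq> u ` K'" "(\<Union>(l,r)\<in>G. {l<..<r}) = (\<Union>(l,r)\<in>u ` K'. {l<..<r})"
      "\<And>y. card {i \<in> G. fst i < y \<and> y < snd i} \<le> 2"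
      using finite_interval_subcover_multiplicity_two[of "u ` K'"] K'(2) by blast
    have finG: "finite G" using G(1) K'(2) finite_surj by blast
    have Gp: "fst i < snd i" "{fst i<..<snd i} \<subseteq> {a..b}"
       "measure lebesgue (S \<inter> {fst i<..<snd i}) \<le> \<eta> * (snd i - fst i)" if iG: "i \<in> G" for i
    proof -
      obtain x where "x \<in> S" "i = u x" using iG G(1) K' KS by blast
      then show "fst i < snd i" "{fst i<..<snd i} \<subseteq> {a..b}"
       "measure lebesgue (S \<inter> {fst i<..<snd i}) \<le> \<eta> * (snd i - fst i)"
        using u[of x] by auto
    qed
    have KG: "K \<subseteq> (\<Union>i\<in>G. S \<inter> {fst i<..<snd i})"
      using K'(3) G(2) KS by (simp add: case_prod_beta)
    have lm: "S \<inter> {fst i<..<snd i} \<in> lmeasurable" for i :: "real \<times> real"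
      by (rule fmeasurable_Int_fmeasurable[OF Slm]) simp
    have int1: "integrable lebesgue (indicat_real {l<..<r})" for l r :: real
      by (simp flip: lmeasurable_iff_integrable)
    have mult: "(\<Sum>i\<in>G. indicat_real {fst i<..<snd i} x) \<le> 2 * indicat_real {a..b} x" for x
    proof -
      have "(\<Sum>i\<in>G. indicat_real {fst i<..<snd i} x) = real (card {i \<in> G. fst i < x \<and> x < snd i})"
        unfolding real_of_card sum.inter_filter[OF finG] by (intro sum.cong) (auto simp: indicator_def)
      also have "\<dots> \<le> 2 * indicat_real {a..b} x"
      proof (cases "x \<in> {a..b}")
        case False
        have "\<not> (fst i < x \<and> x < snd i)" if "i \<in> G" for i
          using Gp(2)[OF that] False by auto
        then have "{i \<in> G. fst i < x \<and> x < snd i} = {}" by blast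
        then have "card {i \<in> G. fst i < x \<and> x < snd i} = 0" by (simp only: card.empty)
        then show ?thesis by simp
      next
        case True
        then have "indicat_real {a..b} x = 1" by simp
        then show ?thesis using G(3)[of x] by linarith
      qed
      finally show ?thesis .
    qed
    have "(\<Sum>i\<in>G. snd i - fst i) = (\<Sum>i\<in>G. LINT x|lebesgue. indicat_real {fst i<..<snd i} x)"
      by (intro sum.cong refl) (simp add: Gp(1) less_imp_le)
    moreover have "\<dots> = (LINT x|lebesgue. (\<Sum>i\<in>G. indicat_real {fst i<..<snd i} x))"
      by (rule Bochner_Integration.integral_sum[symmetric]) (rule int1)
    moreover have "\<dots> \<le> (LINT x|lebesgue. 2 * indicat_real {a..b} x)"
    proof (rule integral_mono[OF _ _ mult])
      show "integrable lebesgue (\<lambda>x. \<Sum>i\<in>G. indicat_real {fst i<..<snd i} x)"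
        by (intro Bochner_Integration.integrable_sum int1)
      have "integrable lebesgue (indicat_real {a..b})"
        by (simp flip: lmeasurable_iff_integrable)
      then show "integrable lebesgue (\<lambda>x. 2 * indicat_real {a..b} x)" by simp
    qed
    moreover have "(LINT x|lebesgue. 2 * indicat_real {a..b} x) = 2 * (b - a)" using ab by simp
    ultimately have sum_le: "(\<Sum>i\<in>G. snd i - fst i) \<le> 2 * (b - a)" by linarith
    have "measure lebesgue K \<le> measure lebesgue (\<Union>i\<in>G. S \<inter> {fst i<..<snd i})"
      by (rule measure_mono_fmeasurable[OF KG fmeasurableD[OF lmeasurable_compact[OF Kc]]
            fmeasurable.finite_UN[OF finG lm]])
    moreover have "\<dots> \<le> (\<Sum>i\<in>G. measure lebesgue (S \<inter> {fst i<..<snd i}))"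
      by (rule measure_UNION_le[OF finG fmeasurableD[OF lm]])
    moreover have "\<dots> \<le> (\<Sum>i\<in>G. \<eta> * (snd i - fst i))"
      using Gp(3) by (rule sum_mono)
    moreover have "\<dots> = \<eta> * (\<Sum>i\<in>G. snd i - fst i)"
      by (rule sum_distrib_left[symmetric])
    moreover have "\<dots> \<le> \<eta> * (2 * (b - a))"
      using \<open>0 \<le> \<eta>\<close> sum_le by (rule mult_left_mono[rotated])
    ultimately have "measure lebesgue K \<le> \<eta> * (2 * (b - a))" by linarith
    then show ?thesis by (simp add: algebra_simps)
  qed
  show ?thesis
  proof (rule field_le_epsilon)
    fix e :: real assume "0 < e"
    obtain T where T: "closed T" "T \<subseteq> S" "S - T \<in> lmeasurable" "emeasure lebesgue (S - T) < ennreal e"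
      using sets_lebesgue_inner_closed[OF S \<open>0 < e\<close>] by blast
    have "bounded T"
      by (rule bounded_subset[OF bounded_closed_interval order_trans[OF T(2) Sab]])
    then have "compact T" using T(1) by (simp add: compact_eq_bounded_closed)
    have "measure lebesgue (S - T) < e"
      using T \<open>0 < e\<close> by (simp add: emeasure_eq_measure2 ennreal_less_iff)
    moreover have "measure lebesgue (S - T) = measure lebesgue S - measure lebesgue T"
      by (rule measurable_measure_Diff[OF Slm fmeasurableD[OF lmeasurable_compact[OF \<open>compact T\<close>]] T(2)])
    ultimately show "measure lebesgue S \<le> 2 * \<eta> * (b - a) + e"
      using K[OF \<open>compact T\<close> T(2)] by linarith
  qed
qed

section \<open>Short vectors of the lattice and of its dual\<close>

definition icross :: "int \<times> int \<times> int \<Rightarrow> int \<times> int \<times> int \<Rightarrow> int \<times> int \<times> int" where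
  "icross = (\<lambda>(a,b,c) (a',b',c'). (b * c' - c * b', c * a' - a * c', a * b' - b * a'))"

text \<open>The factor is real because vectors are not assumed primitive: of two proportional
  integer vectors, neither need be an integer multiple of the other.\<close>

definition rmult :: "real \<Rightarrow> int \<times> int \<times> int \<Rightarrow> int \<times> int \<times> int \<Rightarrow> bool" where
  "rmult r v w \<longleftrightarrow> of_int (fst w) = r * of_int (fst v) \<and>
     of_int (fst (snd w)) = r * of_int (fst (snd v)) \<and>
     of_int (snd (snd w)) = r * of_int (snd (snd v))"

lemma rmult_of_icross_eq_0:
  assumes "icross v w = 0" "v \<noteq> 0"
  shows "\<exists>r. rmult r v w"
proof -
  obtain a b c a' b' c' where vw: "v = (a,b,c)" "w = (a',b',c')" by (metis prod.collapse)
  have eq: "b * c' = c * b'" "c * a' = a * c'" "a * b' = b * a'"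
    using assms(1) by (auto simp: vw icross_def zero_prod_def)
  have R: "real_of_int b * c' = c * b'" "real_of_int c * a' = a * c'" "real_of_int a * b' = b * a'"
    using eq by (metis of_int_mult)+
  consider "a \<noteq> 0" | "b \<noteq> 0" | "c \<noteq> 0" using assms(2) by (auto simp: vw zero_prod_def)
  then show ?thesis
  proof cases
    case 1
    then show ?thesis using R by (intro exI[of _ "a' / a"]) (simp add: rmult_def vw field_simps)
  next
    case 2
    then show ?thesis using R by (intro exI[of _ "b' / b"]) (simp add: rmult_def vw field_simps)
  next
    case 3
    then show ?thesis using R by (intro exI[of _ "c' / c"]) (simp add: rmult_def vw field_simps)
  qed
qed

text \<open>\<open>vsmall \<dots> (q,p,s) e x\<close>: the lattice vector \<open>(q/X, Y L\<^sub>1, Z L\<^sub>2)\<close> at \<open>x\<close> is shorter than \<open>e\<close> in the maximum norm.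
  \<open>psmall\<close> is the same for the dual lattice, where an integer vector \<open>(a,b,c)\<close> becomes
  \<open>(X F(x), F'(x)/Y, c/Z)\<close> with \<open>F = a + b x + c f\<close>. Here \<open>g\<close> plays the role of \<open>f'\<close>, and \<open>X = Y Z\<close> normalises the covolume.\<close>

definition vsmall :: "(real \<Rightarrow> real) \<Rightarrow> (real \<Rightarrow> real) \<Rightarrow> real \<Rightarrow> real \<Rightarrow> real \<Rightarrow> int \<times> int \<times> int \<Rightarrow> real \<Rightarrow> real \<Rightarrow> bool" where
  "vsmall f g X Y Z = (\<lambda>(q,p,s) e x. \<bar>real_of_int q\<bar> < e * X \<and> Y * \<bar>p - q * x\<bar> < e \<and>
      Z * \<bar>s - q * f x - g x * (p - q * x)\<bar> < e)"

definition psmall :: "(real \<Rightarrow> real) \<Rightarrow> (real \<Rightarrow> real) \<Rightarrow> real \<Rightarrow> real \<Rightarrow> real \<Rightarrow> int \<times> int \<times> int \<Rightarrow> real \<Rightarrow> real \<Rightarrow> bool" where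
  "psmall f g X Y Z = (\<lambda>(a,b,c) e x. X * \<bar>a + b * x + c * f x\<bar> < e \<and> \<bar>b + c * g x\<bar> < e * Y \<and>
      \<bar>real_of_int c\<bar> < e * Z)"

text \<open>Meant for the coordinates of a cross product, which are 2 by 2 determinants; the
  scalings give both products the same bound.\<close>

lemma abs_diff_mult_less:
  fixes a b c d :: real
  assumes "\<bar>a\<bar> < \<alpha>" "\<bar>b\<bar> < \<beta>" "\<bar>c\<bar> < \<gamma>" "\<bar>d\<bar> < \<delta>" "\<alpha> * \<beta> = h / 2" "\<gamma> * \<delta> = h / 2"
  shows "\<bar>a * b - c * d\<bar> < h"
proof -
  have "\<bar>a * b\<bar> < h / 2" "\<bar>c * d\<bar> < h / 2"
    using abs_mult_less[OF assms(1,2)] abs_mult_less[OF assms(3,4)] assms(5,6) by (simp_all add: abs_mult)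
  then show ?thesis by linarith
qed

text \<open>The map from \<open>(q, p, s)\<close> to \<open>(q, A, B)\<close> is unitriangular, so
  the cross product of two images is the inverse transpose applied to the integer cross product,
  with coordinates \<open>F\<close>, \<open>F'\<close> and \<open>c\<close>. Each coordinate is a
  difference of two products, each of scaled size below \<open>e/4\<close>.\<close>

lemma psmall_icross:
  assumes pos: "0 < Y" "0 < Z" and X: "X = Y * Z"
    and "vsmall f g X Y Z v (1/4) x" "vsmall f g X Y Z w e x"
  shows "psmall f g X Y Z (icross v w) (e/2) x"
proof -
  obtain q p s q' p' s' where vw: "v = (q,p,s)" "w = (q',p',s')" by (metis prod.collapse)
  define A B where "A = p - q * x" and "B = s - q * f x - g x * (p - q * x)"
  define A' B' where "A' = p' - q' * x" and "B' = s' - q' * f x - g x * (p' - q' * x)"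
  have *: "\<bar>real_of_int q\<bar> < X / 4" "\<bar>A\<bar> < 1 / (4 * Y)" "\<bar>B\<bar> < 1 / (4 * Z)"
    "\<bar>real_of_int q'\<bar> < e * X" "\<bar>A'\<bar> < e / Y" "\<bar>B'\<bar> < e / Z"
    using assms by (auto simp: vsmall_def vw A_def B_def A'_def B'_def field_simps)
  have 1: "\<bar>A * B' - B * A'\<bar> < e / (2 * X)"
    by (rule abs_diff_mult_less[OF *(2) *(6) *(3) *(5)]) (use pos X in auto)
  have 2: "\<bar>B * q' - q * B'\<bar> < e / 2 * Y"
    by (rule abs_diff_mult_less[OF *(3) *(4) *(1) *(6)]) (use pos X in auto)
  have 3: "\<bar>q * A' - A * q'\<bar> < e / 2 * Z"
    by (rule abs_diff_mult_less[OF *(1) *(5) *(2) *(4)]) (use pos X in auto)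
  have eq: "real_of_int (p * s' - s * p') + real_of_int (s * q' - q * s') * x + real_of_int (q * p' - p * q') * f x
      = A * B' - B * A'"
    "real_of_int (s * q' - q * s') + real_of_int (q * p' - p * q') * g x = B * q' - q * B'"
    "real_of_int (q * p' - p * q') = q * A' - A * q'"
    unfolding A_def B_def A'_def B'_def by (simp_all add: algebra_simps)
  show ?thesis
    unfolding psmall_def vw icross_def prod.case eq(1,2) unfolding eq(3)
    using 1 2 3 pos X by (auto simp: field_simps)
qed

text \<open>The same computation with the roles exchanged: the cross product of two images under the
  inverse transpose is the image under the original map.\<close>

lemma vsmall_icross:
  assumes pos: "0 < Y" "0 < Z" and X: "X = Y * Z"
    and "psmall f g X Y Z v (1/4) x" "psmall f g X Y Z w e x"
  shows "vsmall f g X Y Z (icross v w) (e/2) x"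
proof -
  obtain a b c a' b' c' where vw: "v = (a,b,c)" "w = (a',b',c')" by (metis prod.collapse)
  define F G where "F = a + b * x + c * f x" and "G = b + c * g x"
  define F' G' where "F' = a' + b' * x + c' * f x" and "G' = b' + c' * g x"
  have *: "\<bar>F\<bar> < 1 / (4 * X)" "\<bar>G\<bar> < Y / 4" "\<bar>real_of_int c\<bar> < Z / 4"
    "\<bar>F'\<bar> < e / X" "\<bar>G'\<bar> < e * Y" "\<bar>real_of_int c'\<bar> < e * Z"
    using assms by (auto simp: psmall_def vw F_def G_def F'_def G'_def field_simps)
  have 1: "\<bar>G * c' - c * G'\<bar> < e / 2 * X"
    by (rule abs_diff_mult_less[OF *(2) *(6) *(3) *(5)]) (use pos X in auto)
  have 2: "\<bar>c * F' - F * c'\<bar> < e / (2 * Y)"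
    by (rule abs_diff_mult_less[OF *(3) *(4) *(1) *(6)]) (use pos X in auto)
  have 3: "\<bar>F * G' - G * F'\<bar> < e / (2 * Z)"
    by (rule abs_diff_mult_less[OF *(1) *(5) *(2) *(4)]) (use pos X in auto)
  have eq: "real_of_int (b * c' - c * b') = G * c' - c * G'"
    "real_of_int (c * a' - a * c') - real_of_int (b * c' - c * b') * x = c * F' - F * c'"
    "real_of_int (a * b' - b * a') - real_of_int (b * c' - c * b') * f x -
        g x * (real_of_int (c * a' - a * c') - real_of_int (b * c' - c * b') * x)
      = F * G' - G * F'"
    unfolding F_def G_def F'_def G'_def by (simp_all add: algebra_simps)
  show ?thesis
    unfolding vsmall_def vw icross_def prod.case eq(3) unfolding eq(2) unfolding eq(1)
    using 1 2 3 pos X by (auto simp: field_simps)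
qed

lemma vsmall_rmult:
  assumes "rmult r v w" "1 \<le> \<bar>r\<bar>" "vsmall f g X Y Z w e x"
    and pos: "0 < Y" "0 < Z"
  shows "vsmall f g X Y Z v e x"
proof -
  obtain q p s q' p' s' where vw: "v = (q,p,s)" "w = (q',p',s')" by (metis prod.collapse)
  have w: "real_of_int q' = r * q" "real_of_int p' = r * p" "real_of_int s' = r * s"
    using assms(1) by (auto simp: rmult_def vw)
  have le: "\<bar>t\<bar> \<le> \<bar>r * t\<bar>" for t
    using mult_right_mono[OF assms(2), of "\<bar>t\<bar>"] by (simp add: abs_mult)
  have eq: "p' - q' * x = r * (p - q * x)"
    "s' - q' * f x - g x * (p' - q' * x) = r * (s - q * f x - g x * (p - q * x))"
    unfolding w by (simp_all add: algebra_simps)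
  have *: "\<bar>r * q\<bar> < e * X" "Y * \<bar>r * (p - q * x)\<bar> < e"
      "Z * \<bar>r * (s - q * f x - g x * (p - q * x))\<bar> < e"
    using assms(3) unfolding vw vsmall_def prod.case eq(2) unfolding eq(1) unfolding w by auto
  show ?thesis
    unfolding vw vsmall_def prod.case
    using le_less_trans[OF le *(1)] le_less_trans[OF mult_left_mono[OF le] *(2)]
      le_less_trans[OF mult_left_mono[OF le] *(3)] pos by auto
qed

lemma psmall_rmult:
  assumes "rmult r v w" "1 \<le> \<bar>r\<bar>" "psmall f g X Y Z w e x"
    and pos: "0 < X"
  shows "psmall f g X Y Z v e x"
proof -
  obtain a b c a' b' c' where vw: "v = (a,b,c)" "w = (a',b',c')" by (metis prod.collapse)
  have w: "real_of_int a' = r * a" "real_of_int b' = r * b" "real_of_int c' = r * c"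
    using assms(1) by (auto simp: rmult_def vw)
  have le: "\<bar>t\<bar> \<le> \<bar>r * t\<bar>" for t
    using mult_right_mono[OF assms(2), of "\<bar>t\<bar>"] by (simp add: abs_mult)
  have eq: "a' + b' * x + c' * f x = r * (a + b * x + c * f x)" "b' + c' * g x = r * (b + c * g x)"
    unfolding w by (simp_all add: algebra_simps)
  have *: "X * \<bar>r * (a + b * x + c * f x)\<bar> < e" "\<bar>r * (b + c * g x)\<bar> < e * Y" "\<bar>r * c\<bar> < e * Z"
    using assms(3) unfolding vw psmall_def prod.case eq unfolding w by auto
  show ?thesis
    unfolding vw psmall_def prod.case
    using le_less_trans[OF mult_left_mono[OF le] *(1)] le_less_trans[OF le *(2)]
      le_less_trans[OF le *(3)] pos by auto
qed

text \<open>One step of the descent. At each point the short vector \<open>v\<close> is chosen of minimal size among the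
  integer vectors that are short there; this replaces primitivity in deducing from \<open>w \<parallel> v\<close> that \<open>v\<close> is short wherever \<open>w\<close> is.\<close>

lemma measure_small_step:
  fixes P P' :: "int \<times> int \<times> int \<Rightarrow> real \<Rightarrow> real \<Rightarrow> bool"
  assumes ab: "a \<le> b" "0 \<le> \<eta>"
    and scale: "\<And>r v w e x. rmult r v w \<Longrightarrow> 1 \<le> \<bar>r\<bar> \<Longrightarrow> P w e x \<Longrightarrow> P v e x"
    and cross: "\<And>v w e x. P v (1/4) x \<Longrightarrow> P w e x \<Longrightarrow> P' (icross v w) (e/2) x"
    and loc: "\<And>v x. v \<noteq> 0 \<Longrightarrow> x \<in> {c..d} \<Longrightarrow> P v e x \<Longrightarrow> \<exists>l r. l < x \<and> x < r \<and> {l<..<r} \<subseteq> {a..b} \<and>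
        (\<forall>y\<in>{l<..<r}. P v (1/4) y) \<and>
        (\<forall>S\<in>sets lebesgue. S \<subseteq> {y\<in>{l<..<r}. P v e y} \<longrightarrow> measure lebesgue S \<le> \<eta> * (r - l))"
    and V: "{x\<in>{c..d}. \<exists>v. v \<noteq> 0 \<and> P v e x} \<in> lmeasurable"
    and V': "{x\<in>{c..d}. \<exists>v. v \<noteq> 0 \<and> P' v (e/2) x} \<in> lmeasurable"
  shows "measure lebesgue {x\<in>{c..d}. \<exists>v. v \<noteq> 0 \<and> P v e x}
    \<le> 2 * \<eta> * (b - a) + measure lebesgue {x\<in>{c..d}. \<exists>v. v \<noteq> 0 \<and> P' v (e/2) x}"
    (is "measure _ ?V \<le> _ + measure _ ?V'")
proof -
  \<comment> \<open>Points where the other lattice has a short vector are paid for by the last term;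
    on the rest, short vectors are unique up to proportionality.\<close>
  let ?S = "?V - ?V'"
  have Sm: "?S \<in> sets lebesgue" using V V' by (auto dest: fmeasurableD)
  have "measure lebesgue ?S \<le> 2 * \<eta> * (b - a)"
  proof (rule measure_le_of_local_interval_bound[OF Sm ab])
    fix x assume x: "x \<in> ?S"
    let ?size = "\<lambda>v::int \<times> int \<times> int. nat (\<bar>fst v\<bar> + \<bar>fst (snd v)\<bar> + \<bar>snd (snd v)\<bar>)"
    from x obtain v0 where "v0 \<noteq> 0 \<and> P v0 e x" by blast
    then obtain v where v: "v \<noteq> 0" "P v e x"
      and min: "\<And>w. w \<noteq> 0 \<Longrightarrow> P w e x \<Longrightarrow> ?size v \<le> ?size w"
      using ex_has_least_nat[of "\<lambda>v. v \<noteq> 0 \<and> P v e x" v0 ?size] by blast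
    have xcd: "x \<in> {c..d}" using x by blast
    obtain l r where lr: "l < x" "x < r" "{l<..<r} \<subseteq> {a..b}"
      and quarter: "\<And>y. y\<in>{l<..<r} \<Longrightarrow> P v (1/4) y"
      and meas: "\<And>S. S\<in>sets lebesgue \<Longrightarrow> S \<subseteq> {y\<in>{l<..<r}. P v e y} \<Longrightarrow> measure lebesgue S \<le> \<eta> * (r - l)"
      using loc[OF v(1) xcd v(2)] by metis
    have Pv: "P v e y" if y: "y \<in> ?S" "y \<in> {l<..<r}" for y
    proof -
      obtain w where w: "w \<noteq> 0" "P w e y" using y(1) by blast
      \<comment> \<open>A nonzero cross product would be a vector of the other lattice shorter than
        \<open>e/2\<close> at \<open>y\<close>, which membership in \<open>?S\<close>
        excludes.\<close>
      have "icross v w = 0"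
        using cross[OF quarter[OF y(2)] w(2)] y(1) by blast
      then obtain \<rho> where \<rho>: "rmult \<rho> v w" using rmult_of_icross_eq_0 v(1) by blast
      show ?thesis
      proof (cases "1 \<le> \<bar>\<rho>\<bar>")
        case True
        then show ?thesis using scale[OF \<rho>] w(2) by blast
      next
        \<comment> \<open>If \<open>w\<close> is less than \<open>v\<close> in modulus, it is also
          short at \<open>x\<close> and of smaller size than \<open>v\<close>, against the choice of
          \<open>v\<close>.\<close>
        case False
        have "\<rho> \<noteq> 0" using \<rho> w(1) by (auto simp: rmult_def zero_prod_def prod_eq_iff)
        then have "rmult (1 / \<rho>) w v" using \<rho> by (auto simp: rmult_def)
        moreover have "1 \<le> \<bar>1 / \<rho>\<bar>" using False \<open>\<rho> \<noteq> 0\<close> by (auto simp: field_simps)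
        ultimately have "P w e x" using scale v(2) by blast
        then have le: "?size v \<le> ?size w" using min w(1) by blast
        have "real (?size w) = \<bar>\<rho>\<bar> * real (?size v)"
          using \<rho> by (simp add: rmult_def abs_mult algebra_simps)
        moreover have "0 < real (?size v)"
          using v(1) by (auto simp: zero_prod_def prod_eq_iff)
        ultimately have "real (?size w) < real (?size v)" using False by (simp only:) simp
        then have "?size w < ?size v" by (simp only: of_nat_less_iff)
        then show ?thesis using le by linarith
      qed
    qed
    have "?S \<inter> {l<..<r} \<subseteq> {y\<in>{l<..<r}. P v e y}"
    proof
      fix y assume "y \<in> ?S \<inter> {l<..<r}"
      then have "y \<in> ?S" "y \<in> {l<..<r}" by blast+
      then show "y \<in> {y\<in>{l<..<r}. P v e y}" using Pv by blast
    qed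
    moreover have "?S \<inter> {l<..<r} \<in> sets lebesgue" using Sm by (rule sets.Int) simp
    ultimately have "measure lebesgue (?S \<inter> {l<..<r}) \<le> \<eta> * (r - l)"
      by (rule meas[rotated])
    then show "\<exists>l r. l < x \<and> x < r \<and> {l<..<r} \<subseteq> {a..b} \<and>
                measure lebesgue (?S \<inter> {l<..<r}) \<le> \<eta> * (r - l)"
      using lr by blast
  qed
  moreover have "measure lebesgue ?V \<le> measure lebesgue (?S \<union> ?V')"
    using V V' by (intro measure_mono_fmeasurable fmeasurable.Un fmeasurable_Diff)
      (auto dest: fmeasurableD)
  moreover have "measure lebesgue (?S \<union> ?V') \<le> measure lebesgue ?S + measure lebesgue ?V'"
    using Sm V' by (intro measure_Un_le) (auto dest: fmeasurableD)
  ultimately show ?thesis by linarith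
qed

section \<open>Short vectors along a curve with nonvanishing second derivative\<close>

text \<open>For a twice continuously differentiable \<open>f\<close> with derivative
  \<open>g\<close>, the two-sided bound says that the second derivative lies between
  \<open>2 / M\<close> and \<open>2 * M\<close>. In this form it passes to subintervals with the
  same \<open>M\<close>, so that later constants are uniform over them.\<close>

definition quad_pair :: "real \<Rightarrow> (real \<Rightarrow> real) \<Rightarrow> (real \<Rightarrow> real) \<Rightarrow> real \<Rightarrow> real \<Rightarrow> bool" where
  "quad_pair M f g a b \<longleftrightarrow> 1 \<le> M \<and> (\<forall>x\<in>{a..b}. \<bar>g x\<bar> \<le> M \<and>
     (\<forall>y\<in>{a..b}. (y - x)\<^sup>2 / M \<le> f y - f x - g x * (y - x) \<and>
                  f y - f x - g x * (y - x) \<le> M * (y - x)\<^sup>2))"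

lemma quad_pairD:
  assumes "quad_pair M f g a b" "x \<in> {a..b}" "y \<in> {a..b}"
  shows "(y - x)\<^sup>2 / M \<le> f y - f x - g x * (y - x)" "f y - f x - g x * (y - x) \<le> M * (y - x)\<^sup>2"
    "\<bar>g x\<bar> \<le> M" "1 \<le> M"
  using assms unfolding quad_pair_def by blast+

lemma quad_pair_subset:
  "quad_pair M f g a b \<Longrightarrow> {c..d} \<subseteq> {a..b} \<Longrightarrow> quad_pair M f g c d"
  unfolding quad_pair_def by blast

text \<open>Adding the Taylor bound from \<open>x\<close> to \<open>y\<close> to the one from
  \<open>y\<close> to \<open>x\<close> eliminates \<open>f\<close> and leaves
  \<open>(g y - g x) * (y - x)\<close> between 0 and \<open>2 * M * (y - x)^2\<close>.\<close>

lemma quad_pair_g_lipschitz: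
  assumes "quad_pair M f g a b" "x \<in> {a..b}" "y \<in> {a..b}"
  shows "\<bar>g y - g x\<bar> \<le> 2 * M * \<bar>y - x\<bar>"
proof -
  note q = quad_pairD[OF assms] quad_pairD[OF assms(1,3,2)]
  have M: "0 < M" using q by linarith
  have pos: "0 \<le> (y - x)\<^sup>2 / M" using M by simp
  have h: "(g y - g x) * (y - x) = (f y - f x - g x * (y - x)) + (f x - f y - g y * (x - y))"
    by (simp add: algebra_simps)
  have "(x - y)\<^sup>2 = (y - x)\<^sup>2" by (rule power2_commute)
  note q' = q(5,6)[unfolded this]
  have "0 \<le> (g y - g x) * (y - x)" "(g y - g x) * (y - x) \<le> 2 * M * (y - x)\<^sup>2"
    unfolding h using q(1,2) q' pos by linarith+
  then have "\<bar>g y - g x\<bar> * \<bar>y - x\<bar> \<le> (2 * M * \<bar>y - x\<bar>) * \<bar>y - x\<bar>"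
    by (simp add: abs_mult[symmetric] power2_eq_square mult.assoc)
  then show ?thesis
    by (cases "y = x") (simp_all add: mult_le_cancel_right)
qed

lemma quad_pair_f_lipschitz:
  assumes "quad_pair M f g a b" "x \<in> {a..b}" "y \<in> {a..b}"
  shows "\<bar>f y - f x\<bar> \<le> M * \<bar>y - x\<bar> + M * (y - x)\<^sup>2"
proof -
  note q = quad_pairD[OF assms]
  have "0 \<le> (y - x)\<^sup>2 / M" using q(4) by simp
  moreover have "\<bar>g x * (y - x)\<bar> \<le> M * \<bar>y - x\<bar>"
    using q(3) by (simp add: abs_mult mult_right_mono)
  ultimately show ?thesis using q(1,2) by linarith
qed

lemma quad_pair_continuous:
  assumes "quad_pair M f g a b"
  shows "continuous_on {a..b} f" "continuous_on {a..b} g"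
proof -
  have "1 \<le> M" using assms unfolding quad_pair_def by blast
  have "(2 * M)-lipschitz_on {a..b} g"
    using quad_pair_g_lipschitz[OF assms] \<open>1 \<le> M\<close>
    by (intro lipschitz_onI) (auto simp: dist_real_def abs_minus_commute)
  then show "continuous_on {a..b} g" by (rule lipschitz_on_continuous_on)
  have "(M + M * \<bar>b - a\<bar>)-lipschitz_on {a..b} f"
  proof (intro lipschitz_onI)
    fix x y assume xy: "x \<in> {a..b}" "y \<in> {a..b}"
    have "M * (x - y)\<^sup>2 = M * \<bar>x - y\<bar> * \<bar>x - y\<bar>" by (simp add: power2_eq_square)
    also have "\<dots> \<le> M * \<bar>b - a\<bar> * \<bar>x - y\<bar>"
      using xy \<open>1 \<le> M\<close> by (intro mult_right_mono mult_left_mono) auto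
    finally show "dist (f x) (f y) \<le> (M + M * \<bar>b - a\<bar>) * dist x y"
      using quad_pair_f_lipschitz[OF assms xy(2,1)] by (simp add: dist_real_def algebra_simps)
  qed (use \<open>1 \<le> M\<close> in auto)
  then show "continuous_on {a..b} f" by (rule lipschitz_on_continuous_on)
qed

text \<open>Because \<open>M Z \<le> Y\<^sup>2\<close>, the form \<open>L\<^sub>2\<close> is essentially constant where \<open>Y \<bar>L\<^sub>1\<bar> < 1/4\<close>, so that only the linear form \<open>L\<^sub>1\<close> matters.\<close>

lemma vsmall_local:
  assumes quad: "quad_pair M f g a b" and YZ: "1 \<le> Y" "1 \<le> Z" "M * Z \<le> Y\<^sup>2"
    and cd: "a + 1 / Y \<le> c" "d + 1 / Y \<le> b" and e: "0 < e" "e \<le> 1/8"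
    and v: "v \<noteq> 0" and x: "x \<in> {c..d}" and sm: "vsmall f g X Y Z v e x"
  shows "\<exists>l r. l < x \<and> x < r \<and> {l<..<r} \<subseteq> {a..b} \<and>
        (\<forall>y\<in>{l<..<r}. vsmall f g X Y Z v (1/4) y) \<and>
        (\<forall>S\<in>sets lebesgue. S \<subseteq> {y\<in>{l<..<r}. vsmall f g X Y Z v e y} \<longrightarrow>
            measure lebesgue S \<le> 32 * M\<^sup>2 * sqrt e * (r - l))"
proof -
  obtain q p s where vq: "v = (q,p,s)" by (metis prod.collapse)
  have 1: "\<bar>real_of_int q\<bar> < e * X" "Y * \<bar>p - q * x\<bar> < e" "Z * \<bar>s - q * f x - g x * (p - q * x)\<bar> < e"
    using sm by (auto simp: vsmall_def vq)
  have M1: "1 \<le> M" using quad unfolding quad_pair_def by blast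
  \<comment> \<open>With \<open>q = 0\<close> the forms reduce to the integer \<open>p\<close>, and
    then to the integer \<open>s\<close>, both of modulus below 1.\<close>
  have q0: "q \<noteq> 0"
  proof
    assume q: "q = 0"
    have "\<bar>real_of_int p\<bar> \<le> Y * \<bar>real_of_int p\<bar>" using YZ by (simp add: mult_le_cancel_right1)
    then have "p = 0" using 1(2) q e by simp
    moreover have "\<bar>real_of_int s\<bar> \<le> Z * \<bar>real_of_int s\<bar>" using YZ by (simp add: mult_le_cancel_right1)
    ultimately have "s = 0" using 1(3) q e by simp
    then show False using v vq q \<open>p = 0\<close> by (simp add: zero_prod_def)
  qed
  define n where "n = \<bar>real_of_int q\<bar>"
  have n1: "1 \<le> n" using q0 unfolding n_def by linarith
  \<comment> \<open>\<open>t\<close> is the zero of \<open>p - q * y\<close>, and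
    \<open>{l<..<r}\<close> will be exactly the set where
    \<open>Y * \<bar>p - q * y\<bar> < 1/4\<close>.\<close>
  define t where "t = p / q"
  define l r where "l = t - 1 / (4 * Y * n)" and "r = t + 1 / (4 * Y * n)"
  have pq: "p - q * y = q * (t - y)" for y :: real using q0 by (simp add: t_def field_simps)
  have absq: "\<bar>p - q * y\<bar> = n * \<bar>t - y\<bar>" for y :: real unfolding pq by (simp add: abs_mult n_def)
  have mem: "y \<in> {l<..<r} \<longleftrightarrow> Y * (n * \<bar>t - y\<bar>) < 1/4" for y
  proof -
    have "y \<in> {l<..<r} \<longleftrightarrow> \<bar>t - y\<bar> < 1 / (4 * Y * n)" by (auto simp: l_def r_def)
    also have "\<dots> \<longleftrightarrow> Y * (n * \<bar>t - y\<bar>) < 1/4" using YZ n1 by (simp add: field_simps)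
    finally show ?thesis .
  qed
  have xin: "x \<in> {l<..<r}" unfolding mem using 1(2) e unfolding absq by linarith
  have "r - l \<le> 1 / Y"
  proof -
    have "1 / (4 * Y * n) \<le> 1 / (2 * Y)"
      using YZ n1 by (intro divide_left_mono) auto
    then show ?thesis unfolding l_def r_def by (simp add: field_simps)
  qed
  then have sub: "{l<..<r} \<subseteq> {a..b}" using xin x cd by auto
  have tin: "t \<in> {l<..<r}" unfolding mem by simp
  \<comment> \<open>The second form is a constant plus \<open>q * D y\<close>, so its variation is
    that of the Taylor remainder \<open>D\<close>.\<close>
  define D where "D y = f t - f y - g y * (t - y)" for y
  have L: "s - q * f y - g y * (p - q * y) = (s - q * f t) + q * D y" for y :: real
    unfolding pq D_def by (simp add: algebra_simps)
  \<comment> \<open>One spare factor \<open>n\<close>, at least 1, turns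
    \<open>n * (t - y)^2\<close> into \<open>(n * (t - y))^2\<close>, which the interval controls;
    \<open>M * Z \<le> Y\<^sup>2\<close> absorbs the remaining factors.\<close>
  have D: "0 \<le> D y" "Z * (n * D y) \<le> 1/16" if "y \<in> {l<..<r}" for y
  proof -
    have "y \<in> {a..b}" "t \<in> {a..b}" using sub tin that by blast+
    note qd = quad_pairD(1,2)[OF quad this, folded D_def]
    have "0 \<le> (t - y)\<^sup>2 / M" using M1 by simp
    then show "0 \<le> D y" using qd by linarith
    have "Z * (n * D y) \<le> Z * (n * (M * (t - y)\<^sup>2))"
      using qd YZ n1 by (intro mult_left_mono) auto
    also have "\<dots> = (M * Z) * (n * (t - y)\<^sup>2)" by simp
    also have "\<dots> \<le> Y\<^sup>2 * (n * (t - y)\<^sup>2)" using YZ n1 by (intro mult_right_mono) auto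
    also have "\<dots> \<le> Y\<^sup>2 * (n * (n * (t - y)\<^sup>2))"
      using n1 by (intro mult_left_mono) (auto simp: mult_le_cancel_right1)
    also have "\<dots> = (Y * (n * \<bar>t - y\<bar>))\<^sup>2" by (simp add: power2_eq_square)
    also have "\<dots> \<le> (1/4)\<^sup>2"
      using that[unfolded mem] YZ n1 by (intro power_mono) auto
    finally show "Z * (n * D y) \<le> 1/16" by (simp add: power2_eq_square)
  qed
  have quarter: "vsmall f g X Y Z v (1/4) y" if y: "y \<in> {l<..<r}" for y
  proof -
    have "0 < e * X" using 1(1) by linarith
    then have "0 < X" using e by (simp add: zero_less_mult_iff)
    then have "e * X \<le> 1/4 * X" using e by (intro mult_right_mono) auto
    then have a: "\<bar>real_of_int q\<bar> < 1/4 * X" using 1(1) by linarith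
    \<comment> \<open>As \<open>D\<close> is nonnegative, the variation costs one bound of 1/16 and
      not two; together with \<open>e\<close>, at most 1/8, this stays below 1/4.\<close>
    have "\<bar>D y - D x\<bar> \<le> max (D y) (D x)" using D(1)[OF y] D(1)[OF xin] by linarith
    then have "Z * (n * \<bar>D y - D x\<bar>) \<le> Z * (n * max (D y) (D x))"
      using YZ n1 by (intro mult_left_mono) auto
    also have "\<dots> \<le> 1/16" using D(2)[OF y] D(2)[OF xin] by (auto simp: max_def)
    finally have ub: "Z * (n * \<bar>D y - D x\<bar>) \<le> 1/16" .
    have "\<bar>(s - q * f t) + q * D y\<bar> \<le> \<bar>(s - q * f t) + q * D x\<bar> + \<bar>q * (D y - D x)\<bar>"
      by (simp add: algebra_simps)
    then have "Z * \<bar>(s - q * f t) + q * D y\<bar> \<le> Z * (\<bar>(s - q * f t) + q * D x\<bar> + \<bar>q * (D y - D x)\<bar>)"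
      using YZ by (intro mult_left_mono) auto
    also have "\<dots> = Z * \<bar>(s - q * f t) + q * D x\<bar> + Z * (n * \<bar>D y - D x\<bar>)"
      by (simp only: abs_mult n_def distrib_left)
    also have "\<dots> < 1/4" using ub 1(3) e unfolding L by linarith
    finally have "Z * \<bar>(s - q * f t) + q * D y\<bar> < 1/4" .
    moreover have "Y * \<bar>p - q * y\<bar> < 1/4" unfolding absq using y mem by blast
    ultimately show ?thesis unfolding vsmall_def vq prod.case L using a by blast
  qed
  have "measure lebesgue S \<le> 32 * M\<^sup>2 * sqrt e * (r - l)"
    if S: "S \<in> sets lebesgue" "S \<subseteq> {y\<in>{l<..<r}. vsmall f g X Y Z v e y}" for S
  proof -
    have "measure lebesgue S \<le> 2 * e / (Y * n)"
    proof (rule measure_le_of_dist_le[OF S(1)])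
      fix y z assume "y \<in> S" "z \<in> S" "y \<le> z"
      then have "Y * (n * \<bar>t - y\<bar>) < e" "Y * (n * \<bar>t - z\<bar>) < e"
        using S(2) unfolding vsmall_def vq prod.case absq by blast+
      then have "\<bar>t - y\<bar> < e / (Y * n)" "\<bar>t - z\<bar> < e / (Y * n)"
        using YZ n1 by (simp_all add: field_simps)
      then have "z - y \<le> e / (Y * n) + e / (Y * n)" by linarith
      then show "z - y \<le> 2 * e / (Y * n)" by simp
    qed (use e YZ n1 in auto)
    also have "\<dots> = 4 * e * (r - l)" using YZ n1 by (simp add: l_def r_def field_simps)
    \<comment> \<open>A linear bound in \<open>e\<close> is weakened to the one that dual vectors
      allow, so that both descent steps share a constant.\<close>
    also have "\<dots> \<le> 32 * M\<^sup>2 * sqrt e * (r - l)"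
    proof (rule mult_right_mono)
      have "e \<le> sqrt e" using e by (intro real_le_rsqrt) (simp add: power2_eq_square mult_le_cancel_left1)
      moreover have "1 \<le> M\<^sup>2" using M1 by simp
      ultimately have "1 * e \<le> M\<^sup>2 * sqrt e" using e by (intro mult_mono) auto
      then have "4 * e \<le> 32 * (M\<^sup>2 * sqrt e)" using e by linarith
      then show "4 * e \<le> 32 * M\<^sup>2 * sqrt e" by (simp only: mult.assoc)
    qed (use xin in auto)
    finally show ?thesis .
  qed
  then show ?thesis using xin sub quarter by (intro exI[of _ l] exI[of _ r]) auto
qed

section \<open>Short vectors of the dual lattice\<close>

lemma psmall_uminus: "psmall f g X Y Z (- a, - b, - c) e x = psmall f g X Y Z (a, b, c) e x"
proof -
  have "real_of_int (- a) + real_of_int (- b) * x + real_of_int (- c) * f x = - (a + b * x + c * f x)"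
    "real_of_int (- b) + real_of_int (- c) * g x = - (b + c * g x)" by simp_all
  then show ?thesis unfolding psmall_def prod.case by (simp only: abs_minus_cancel of_int_minus)
qed

text \<open>The case distinction in the proof compares the slope of \<open>F\<close> at \<open>x\<close> with its curvature: either \<open>F\<close> is close to its minimum and behaves
  like a parabola, or it is nearly linear around \<open>x\<close>.\<close>

lemma psmall_local_nonneg:
  assumes quad: "quad_pair M f g a b" and YZ: "1 \<le> Y" "1 \<le> Z" and X: "X = Y * Z"
    and cd: "a + 1 / sqrt X \<le> c" "d + 1 / sqrt X \<le> b" and e: "0 < e" "e \<le> 1/8"
    and v: "v = (u0, u1, u2)" "v \<noteq> 0" "0 \<le> u2" and x: "x \<in> {c..d}" and sm: "psmall f g X Y Z v e x"
  shows "\<exists>l r. l < x \<and> x < r \<and> {l<..<r} \<subseteq> {a..b} \<and>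
        (\<forall>y\<in>{l<..<r}. psmall f g X Y Z v (1/4) y) \<and>
        (\<forall>S\<in>sets lebesgue. S \<subseteq> {y\<in>{l<..<r}. psmall f g X Y Z v e y} \<longrightarrow>
            measure lebesgue S \<le> 32 * M\<^sup>2 * sqrt e * (r - l))"
proof -
  have M1: "1 \<le> M" using quad unfolding quad_pair_def by blast
  have X1: "1 \<le> X" using mult_mono[OF YZ] YZ X by simp
  \<comment> \<open>Since \<open>w\<close> is nonnegative, \<open>F\<close> inherits the convexity
    of \<open>f\<close> with curvature comparable to \<open>w\<close>; \<open>G\<close> is its
    slope.\<close>
  define w where "w = real_of_int u2"
  have w0: "0 \<le> w" using v by (simp add: w_def)
  define F where "F y = u0 + u1 * y + w * f y" for y :: real
  define G where "G y = u1 + w * g y" for y :: real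
  have ps: "psmall f g X Y Z v h y \<longleftrightarrow> X * \<bar>F y\<bar> < h \<and> \<bar>G y\<bar> < h * Y \<and> w < h * Z" for h y
    using w0 unfolding psmall_def v F_def G_def w_def by simp
  have sm': "X * \<bar>F x\<bar> < e" "\<bar>G x\<bar> < e * Y" "w < e * Z" using sm unfolding ps by auto
  have Ftaylor: "w * ((z - y)\<^sup>2 / M) \<le> F z - F y - G y * (z - y)" "F z - F y - G y * (z - y) \<le> w * (M * (z - y)\<^sup>2)"
    if "y \<in> {a..b}" "z \<in> {a..b}" for y z
  proof -
    have eq: "F z - F y - G y * (z - y) = w * (f z - f y - g y * (z - y))"
      by (simp add: F_def G_def algebra_simps)
    show "w * ((z - y)\<^sup>2 / M) \<le> F z - F y - G y * (z - y)"
      unfolding eq by (rule mult_left_mono[OF quad_pairD(1)[OF quad that] w0])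
    show "F z - F y - G y * (z - y) \<le> w * (M * (z - y)\<^sup>2)"
      unfolding eq by (rule mult_left_mono[OF quad_pairD(2)[OF quad that] w0])
  qed
  have Flow: "G y * (z - y) \<le> F z - F y" if "y \<in> {a..b}" "z \<in> {a..b}" for y z
  proof -
    have "0 \<le> w * ((z - y)\<^sup>2 / M)" using w0 M1 by simp
    then show ?thesis using Ftaylor[OF that] by linarith
  qed
  have Glip: "\<bar>G z - G y\<bar> \<le> 2 * M * w * \<bar>z - y\<bar>" if "y \<in> {a..b}" "z \<in> {a..b}" for y z
  proof -
    have "G z - G y = w * (g z - g y)" by (simp add: G_def algebra_simps)
    then have "\<bar>G z - G y\<bar> = w * \<bar>g z - g y\<bar>" using w0 by (simp add: abs_mult)
    then show ?thesis
      using mult_left_mono[OF quad_pair_g_lipschitz[OF quad that] w0] by (simp add: mult_ac)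
  qed
  have Gcont: "continuous_on {a..b} G"
    unfolding G_def by (intro continuous_intros quad_pair_continuous[OF quad])
  have interval: "{x - t<..<x + t} \<subseteq> {a..b}" if "t \<le> 1 / sqrt X" for t
    using that cd x by auto
  have k: "e = sqrt e * sqrt e" "0 < sqrt e" using e by simp_all
  have Fd: "\<bar>F z - F y\<bar> < 2 * e / X" if "psmall f g X Y Z v e y" "psmall f g X Y Z v e z" for y z
  proof -
    have "\<bar>F y\<bar> < e / X" "\<bar>F z\<bar> < e / X" using that X1 unfolding ps by (simp_all add: field_simps)
    then show ?thesis by simp
  qed
  have Fb: "X * \<bar>F y\<bar> < 1/4" if "y \<in> {a..b}" "x \<in> {a..b}" "X * \<bar>G x\<bar> * \<bar>y - x\<bar> \<le> 1/16" "X * (w * (M * (y - x)\<^sup>2)) \<le> 1/256" for y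
  proof -
    have "0 \<le> w * ((y - x)\<^sup>2 / M)" using w0 M1 by simp
    then have "\<bar>F y\<bar> \<le> \<bar>F x\<bar> + \<bar>G x * (y - x)\<bar> + w * (M * (y - x)\<^sup>2)"
      using Ftaylor[OF that(2,1)] by linarith
    then have "X * \<bar>F y\<bar> \<le> X * (\<bar>F x\<bar> + \<bar>G x * (y - x)\<bar> + w * (M * (y - x)\<^sup>2))"
      using X1 by (intro mult_left_mono) auto
    also have "\<dots> = X * \<bar>F x\<bar> + X * \<bar>G x\<bar> * \<bar>y - x\<bar> + X * (w * (M * (y - x)\<^sup>2))"
      by (simp only: abs_mult distrib_left mult.assoc)
    finally show ?thesis using sm'(1) e that by linarith
  qed
  have wZ: "w < 1/4 * Z"
  proof -
    have "e * Z \<le> 1/4 * Z" using e YZ by (intro mult_right_mono) auto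
    then show ?thesis using sm'(3) by linarith
  qed
  have eY: "e * Y \<le> 1/8 * Y" using e YZ by (intro mult_right_mono) auto
  show ?thesis
  proof (cases "X * (G x)\<^sup>2 \<le> w \<and> 0 < w")
    case True
    have w1: "1 \<le> w" using True by (simp add: w_def)
    define R where "R = sqrt (X * w)"
    have R2: "R\<^sup>2 = X * w" using X1 w0 by (simp add: R_def)
    have R0: "0 < R" using X1 w1 by (simp add: R_def)
    have RX: "sqrt X \<le> R" unfolding R_def using X1 w1 by (simp add: mult_le_cancel_left1)
    \<comment> \<open>Parabolic case: with curvature about \<open>w\<close> and slope at most
      \<open>R / X\<close> at \<open>x\<close>, the change of \<open>X * F\<close> over a length
      \<open>1 / R\<close> is bounded; the factor \<open>16 * M\<close> brings it below 1/4.\<close>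
    define t where "t = 1 / (16 * M * R)"
    have t0: "0 < t" using R0 M1 by (simp add: t_def)
    have tR: "R * t = 1 / (16 * M)" using R0 by (simp add: t_def)
    have "t \<le> 1 / R" unfolding t_def using R0 M1 by (intro divide_left_mono) auto
    also have "\<dots> \<le> 1 / sqrt X" using RX X1 R0 by (intro divide_left_mono) auto
    finally have sub: "{x - t<..<x + t} \<subseteq> {a..b}" by (rule interval)
    have "x \<in> {x - t<..<x + t}" using t0 by simp
    then have xab: "x \<in> {a..b}" using sub by blast
    have XG: "X * \<bar>G x\<bar> \<le> R"
    proof (rule power2_le_imp_le)
      have "(X * \<bar>G x\<bar>)\<^sup>2 = X * (X * (G x)\<^sup>2)" by (simp add: power2_eq_square)
      also have "\<dots> \<le> X * w" using True X1 by (intro mult_left_mono) auto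
      finally show "(X * \<bar>G x\<bar>)\<^sup>2 \<le> R\<^sup>2" by (simp add: R2)
    qed (use R0 in auto)
    \<comment> \<open>This keeps the slope small too: over the interval \<open>G\<close> changes by
      at most \<open>w / (8 * R)\<close>.\<close>
    have wRY: "w \<le> R * Y"
    proof (rule power2_le_imp_le)
      have "w * w \<le> w * Z" using wZ w0 YZ by (intro mult_left_mono) auto
      also have "\<dots> \<le> w * (Z * (Y * (Y * Y)))"
      proof -
        have "1 \<le> Y * (Y * Y)" using YZ by (simp add: mult_ge1_I)
        then have "Z * 1 \<le> Z * (Y * (Y * Y))" using YZ by (intro mult_left_mono) auto
        then show ?thesis using w0 by (intro mult_left_mono) auto
      qed
      also have "\<dots> = (R * Y)\<^sup>2" unfolding power_mult_distrib R2 X by (simp add: power2_eq_square)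
      finally show "w\<^sup>2 \<le> (R * Y)\<^sup>2" by (simp add: power2_eq_square)
    qed (use R0 YZ in auto)
    have quarter: "psmall f g X Y Z v (1/4) y" if y: "y \<in> {x - t<..<x + t}" for y
    proof -
      have yab: "y \<in> {a..b}" using y sub by blast
      have yx: "\<bar>y - x\<bar> \<le> t" using y by auto
      have "X * \<bar>G x\<bar> * \<bar>y - x\<bar> \<le> R * t" using XG yx R0 by (intro mult_mono) auto
      also have "\<dots> \<le> 1/16" unfolding tR using M1 by (simp add: field_simps)
      finally have 1: "X * \<bar>G x\<bar> * \<bar>y - x\<bar> \<le> 1/16" .
      have "(y - x)\<^sup>2 \<le> t\<^sup>2" using power_mono[OF yx, of 2] by simp
      then have "X * (w * (M * (y - x)\<^sup>2)) \<le> X * (w * (M * t\<^sup>2))"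
        using X1 w0 M1 by (intro mult_left_mono) auto
      also have "\<dots> = M * (R * t)\<^sup>2" unfolding power_mult_distrib R2 by simp
      also have "\<dots> \<le> 1/256" unfolding tR using M1 by (simp add: power2_eq_square field_simps)
      finally have 2: "X * (w * (M * (y - x)\<^sup>2)) \<le> 1/256" .
      have "\<bar>G y - G x\<bar> \<le> 2 * M * w * t"
        by (rule order_trans[OF Glip[OF xab yab] mult_left_mono[OF yx]]) (use M1 w0 in simp)
      also have "\<dots> = w / (8 * R)" using R0 M1 by (simp add: t_def field_simps)
      also have "\<dots> \<le> Y / 8" using wRY R0 by (simp add: field_simps)
      finally have "\<bar>G y\<bar> < 1/4 * Y" using sm'(2) eY by linarith
      then show ?thesis unfolding ps using wZ Fb[OF yab xab 1 2] by blast
    qed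
    have "measure lebesgue S \<le> 32 * M\<^sup>2 * sqrt e * (x + t - (x - t))"
      if S: "S \<in> sets lebesgue" "S \<subseteq> {y\<in>{x - t<..<x + t}. psmall f g X Y Z v e y}" for S
    proof -
      define \<delta> where "\<delta> = 2 * M * sqrt e / R"
      have d0: "0 \<le> \<delta>" using R0 M1 e by (simp add: \<delta>_def)
      \<comment> \<open>When the linear term is nonnegative, the curvature term alone is at most
        \<open>F z - F y\<close>, hence below \<open>2 * e / X\<close>. This square-root bound on
        the distance is the source of \<open>sqrt e\<close>.\<close>
      have key: "\<bar>z - y\<bar> \<le> \<delta>" if "y \<in> S" "z \<in> S" "0 \<le> G y * (z - y)" for y z
      proof -
        have yz: "y \<in> {a..b}" "z \<in> {a..b}" "psmall f g X Y Z v e y" "psmall f g X Y Z v e z"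
          using that S(2) sub by blast+
        have "w * ((z - y)\<^sup>2 / M) \<le> 2 * e / X"
          using Ftaylor(1)[OF yz(1,2)] Fd[OF yz(3,4)] that(3) by linarith
        then have "(z - y)\<^sup>2 * R\<^sup>2 \<le> 2 * M * e" unfolding R2 using X1 M1 w1 by (simp add: field_simps)
        also have "\<dots> \<le> 4 * M\<^sup>2 * e" using M1 e by (simp add: power2_eq_square)
        also have "\<dots> = \<delta>\<^sup>2 * R\<^sup>2"
          using R0 e by (simp add: \<delta>_def power_mult_distrib power_divide)
        finally have "\<bar>z - y\<bar>\<^sup>2 \<le> \<delta>\<^sup>2" using R0 by simp
        then show ?thesis using d0 by (rule power2_le_imp_le)
      qed
      \<comment> \<open>Where \<open>G\<close> has a fixed sign, one order of any two points makes
        the linear term nonnegative, so each part has diameter at most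
        \<open>\<delta>\<close>.\<close>
      define S1 S2 where "S1 = S \<inter> {y\<in>{a..b}. 0 \<le> G y}" and "S2 = S \<inter> {y\<in>{a..b}. G y \<le> 0}"
      have "closed {y\<in>{a..b}. 0 \<le> G y}" "closed {y\<in>{a..b}. G y \<le> 0}"
        by (intro continuous_on_closed_Collect_le Gcont continuous_intros closed_atLeastAtMost)+
      then have meas: "S1 \<in> sets lebesgue" "S2 \<in> sets lebesgue"
        unfolding S1_def S2_def using S(1) by (auto intro!: sets.Int)
      have "measure lebesgue S1 \<le> \<delta>"
      proof (rule measure_le_of_dist_le[OF meas(1) d0])
        fix y z assume "y \<in> S1" "z \<in> S1" "y \<le> z"
        then show "z - y \<le> \<delta>" using key[of y z] unfolding S1_def by auto
      qed
      moreover have "measure lebesgue S2 \<le> \<delta>"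
      proof (rule measure_le_of_dist_le[OF meas(2) d0])
        fix y z assume "y \<in> S2" "z \<in> S2" "y \<le> z"
        then show "z - y \<le> \<delta>" using key[of z y] unfolding S2_def
          by (auto simp: mult_nonpos_nonpos)
      qed
      moreover have "S = S1 \<union> S2" using S(2) sub unfolding S1_def S2_def by force
      then have "measure lebesgue S \<le> measure lebesgue S1 + measure lebesgue S2"
        using meas by (metis measure_Un_le)
      ultimately have "measure lebesgue S \<le> 2 * \<delta>" by linarith
      also have "\<dots> = 32 * M\<^sup>2 * sqrt e * (x + t - (x - t))"
        using R0 M1 by (simp add: \<delta>_def t_def field_simps power2_eq_square)
      finally show ?thesis .
    qed
    then show ?thesis using t0 sub quarter by (intro exI[of _ "x - t"] exI[of _ "x + t"]) auto
  next
    case False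
    \<comment> \<open>For \<open>w = 0\<close> the slope is the integer \<open>u1\<close>; were it
      0, \<open>F\<close> would be a nonzero integer constant, which is too large. For
      \<open>w \<ge> 1\<close> the negated case condition applies. The last bound keeps the interval
      below within \<open>1 / sqrt X\<close> of \<open>x\<close>.\<close>
    have G0: "G x \<noteq> 0 \<and> w \<le> X * (G x)\<^sup>2 \<and> 1 \<le> sqrt X * \<bar>G x\<bar>"
    proof (cases "w = 0")
      case True
      then have u2: "u2 = 0" by (simp add: w_def)
      have "u1 \<noteq> 0"
      proof
        assume "u1 = 0"
        then have "\<bar>real_of_int u0\<bar> \<le> X * \<bar>F x\<bar>" using True X1 by (simp add: F_def mult_le_cancel_right1)
        then have "u0 = 0" using sm'(1) e by simp
        then show False using v u2 \<open>u1 = 0\<close> by (simp add: zero_prod_def)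
      qed
      then have "1 \<le> \<bar>real_of_int u1\<bar>" by linarith
      then have "1 \<le> \<bar>G x\<bar>" by (simp add: G_def True)
      moreover have "1 \<le> sqrt X" using X1 by simp
      ultimately show ?thesis using True X1 by (auto simp: mult_ge1_I)
    next
      case w: False
      then have "1 \<le> w" using v by (simp add: w_def)
      then have *: "w < X * (G x)\<^sup>2" using False by linarith
      then have "1 \<le> X * (G x)\<^sup>2" using \<open>1 \<le> w\<close> by linarith
      then have "1 \<le> (sqrt X * \<bar>G x\<bar>)\<^sup>2" using X1 by (simp add: power_mult_distrib)
      then have "1 \<le> sqrt X * \<bar>G x\<bar>" using X1 by (intro power2_le_imp_le[of 1]) auto
      then show ?thesis using * \<open>1 \<le> w\<close> by auto
    qed
    define H where "H = \<bar>G x\<bar>"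
    have H0: "0 < H" using G0 by (simp add: H_def)
    have wH: "w \<le> X * H\<^sup>2" using G0 by (simp add: H_def)
    \<comment> \<open>Linear case: the length over which the slope \<open>H\<close> changes
      \<open>X * F\<close> by at most 1/16. The curvature then alters the slope by at most
      \<open>H / 8\<close>.\<close>
    define t where "t = 1 / (16 * M * X * H)"
    have t0: "0 < t" using H0 M1 X1 by (simp add: t_def)
    have tX: "X * H * t = 1 / (16 * M)" using H0 X1 M1 by (simp add: t_def)
    have "t \<le> 1 / (X * H)" unfolding t_def using H0 M1 X1 by (intro divide_left_mono) auto
    also have "\<dots> \<le> 1 / sqrt X"
    proof (rule divide_left_mono)
      have "sqrt X * 1 \<le> sqrt X * (sqrt X * H)" using G0 X1 unfolding H_def by (intro mult_left_mono) auto
      then show "sqrt X \<le> X * H" using X1 by (simp add: mult.assoc[symmetric])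
    qed (use X1 H0 in auto)
    finally have sub: "{x - t<..<x + t} \<subseteq> {a..b}" by (rule interval)
    have "x \<in> {x - t<..<x + t}" using t0 by simp
    then have xab: "x \<in> {a..b}" using sub by blast
    have Gd: "\<bar>G y - G x\<bar> \<le> H / 8" if y: "y \<in> {x - t<..<x + t}" for y
    proof -
      have yab: "y \<in> {a..b}" using y sub by blast
      have yx: "\<bar>y - x\<bar> \<le> t" using y by auto
      have "\<bar>G y - G x\<bar> \<le> 2 * M * w * t"
        by (rule order_trans[OF Glip[OF xab yab] mult_left_mono[OF yx]]) (use M1 w0 in simp)
      also have "\<dots> \<le> 2 * M * (X * H\<^sup>2) * t" using wH M1 t0 by (intro mult_right_mono mult_left_mono) auto
      also have "\<dots> = 2 * M * H * (X * H * t)" by (simp add: power2_eq_square)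
      also have "\<dots> = H / 8" unfolding tX using M1 by simp
      finally show ?thesis .
    qed
    have quarter: "psmall f g X Y Z v (1/4) y" if y: "y \<in> {x - t<..<x + t}" for y
    proof -
      have yab: "y \<in> {a..b}" using y sub by blast
      have yx: "\<bar>y - x\<bar> \<le> t" using y by auto
      have "X * \<bar>G x\<bar> * \<bar>y - x\<bar> \<le> X * H * t" unfolding H_def using yx X1 by (intro mult_left_mono) auto
      also have "\<dots> \<le> 1/16" unfolding tX using M1 by (simp add: field_simps)
      finally have 1: "X * \<bar>G x\<bar> * \<bar>y - x\<bar> \<le> 1/16" .
      have "(y - x)\<^sup>2 \<le> t\<^sup>2" using power_mono[OF yx, of 2] by simp
      then have "X * (w * (M * (y - x)\<^sup>2)) \<le> X * ((X * H\<^sup>2) * (M * t\<^sup>2))"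
        using X1 w0 M1 wH by (intro mult_left_mono mult_mono) auto
      also have "\<dots> = M * (X * H * t)\<^sup>2" by (simp add: power2_eq_square)
      also have "\<dots> \<le> 1/256" unfolding tX using M1 by (simp add: power2_eq_square field_simps)
      finally have 2: "X * (w * (M * (y - x)\<^sup>2)) \<le> 1/256" .
      have "\<bar>G y\<bar> < 1/4 * Y" using Gd[OF y] sm'(2) eY H0 unfolding H_def by linarith
      then show ?thesis unfolding ps using wZ Fb[OF yab xab 1 2] by blast
    qed
    have "measure lebesgue S \<le> 32 * M\<^sup>2 * sqrt e * (x + t - (x - t))"
      if S: "S \<in> sets lebesgue" "S \<subseteq> {y\<in>{x - t<..<x + t}. psmall f g X Y Z v e y}" for S
    proof -
      have "measure lebesgue S \<le> 4 * e / (X * H)"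
      proof (rule measure_le_of_dist_le[OF S(1)])
        fix y z assume yzS: "y \<in> S" "z \<in> S" "y \<le> z"
        then have yz: "y \<in> {a..b}" "z \<in> {a..b}" "psmall f g X Y Z v e y" "psmall f g X Y Z v e z"
          "y \<in> {x - t<..<x + t}" "z \<in> {x - t<..<x + t}"
          using S(2) sub by blast+
        \<comment> \<open>A convex function lies above its tangents; the tangent is taken at the
          left point if \<open>F\<close> increases and at the right point if it decreases.\<close>
        have "(H / 2) * (z - y) \<le> \<bar>F z - F y\<bar>"
        proof (cases "0 < G x")
          case True
          then have "H / 2 \<le> G y" using Gd[OF yz(5)] unfolding H_def by linarith
          then have "(H / 2) * (z - y) \<le> G y * (z - y)" using yzS by (intro mult_right_mono) auto
          then show ?thesis using Flow[OF yz(1,2)] by linarith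
        next
          case False
          then have "H / 2 \<le> - G z" using Gd[OF yz(6)] H0 unfolding H_def by linarith
          then have "(H / 2) * (z - y) \<le> - G z * (z - y)" using yzS by (intro mult_right_mono) auto
          also have "\<dots> = G z * (y - z)" by (simp add: algebra_simps)
          finally show ?thesis using Flow[OF yz(2,1)] by linarith
        qed
        then have "(H / 2) * (z - y) \<le> 2 * e / X" using Fd[OF yz(3,4)] by linarith
        then show "z - y \<le> 4 * e / (X * H)" using X1 H0 by (simp add: field_simps)
      qed (use e X1 H0 in auto)
      also have "\<dots> \<le> 4 * M * sqrt e / (X * H)"
      proof (rule divide_right_mono)
        have "e \<le> sqrt e" using e by (intro real_le_rsqrt) (simp add: power2_eq_square mult_le_cancel_left1)
        then have "1 * e \<le> M * sqrt e" using e M1 by (intro mult_mono) auto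
        then show "4 * e \<le> 4 * M * sqrt e" by simp
      qed (use X1 H0 in auto)
      also have "\<dots> = 32 * M\<^sup>2 * sqrt e * (x + t - (x - t))"
        using H0 M1 X1 by (simp add: t_def field_simps power2_eq_square)
      finally show ?thesis .
    qed
    then show ?thesis using t0 sub quarter by (intro exI[of _ "x - t"] exI[of _ "x + t"]) auto
  qed
qed

lemma psmall_local:
  assumes quad: "quad_pair M f g a b" and YZ: "1 \<le> Y" "1 \<le> Z" and X: "X = Y * Z"
    and cd: "a + 1 / sqrt X \<le> c" "d + 1 / sqrt X \<le> b" and e: "0 < e" "e \<le> 1/8"
    and v: "v \<noteq> 0" and x: "x \<in> {c..d}" and sm: "psmall f g X Y Z v e x"
  shows "\<exists>l r. l < x \<and> x < r \<and> {l<..<r} \<subseteq> {a..b} \<and>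
        (\<forall>y\<in>{l<..<r}. psmall f g X Y Z v (1/4) y) \<and>
        (\<forall>S\<in>sets lebesgue. S \<subseteq> {y\<in>{l<..<r}. psmall f g X Y Z v e y} \<longrightarrow>
            measure lebesgue S \<le> 32 * M\<^sup>2 * sqrt e * (r - l))"
proof -
  obtain u0 u1 u2 where vu: "v = (u0, u1, u2)" by (metis prod.collapse)
  show ?thesis
  proof (cases "0 \<le> u2")
    case True
    show ?thesis by (rule psmall_local_nonneg[OF quad YZ X cd e vu v True x sm])
  next
    case False
    have "(- u0, - u1, - u2) \<noteq> 0" using v vu by (simp add: zero_prod_def)
    from psmall_local_nonneg[OF quad YZ X cd e refl this _ x]
    show ?thesis using False sm unfolding psmall_uminus vu by simp
  qed
qed

section \<open>Rational points near the curve\<close>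

lemma lmeasurable_Collect_continuous_less:
  fixes h1 h2 :: "'i::countable \<Rightarrow> real \<Rightarrow> real"
  assumes "\<And>i. continuous_on {c..d} (h1 i)" "\<And>i. continuous_on {c..d} (h2 i)"
  shows "{x\<in>{c..d}. \<exists>i. A i \<and> h1 i x < e1 i \<and> h2 i x < e2 i} \<in> lmeasurable" (is "?V \<in> _")
proof -
  have closed: "closed {x\<in>{c..d}. e1 i \<le> h1 i x}" "closed {x\<in>{c..d}. e2 i \<le> h2 i x}" for i
    by (intro continuous_on_closed_Collect_le assms continuous_intros closed_atLeastAtMost)+
  have sets: "{x\<in>{c..d}. h1 i x < e1 i \<and> h2 i x < e2 i} \<in> sets lebesgue" for i
  proof -
    have "{x\<in>{c..d}. h1 i x < e1 i \<and> h2 i x < e2 i} = {c..d} - ({x\<in>{c..d}. e1 i \<le> h1 i x} \<union> {x\<in>{c..d}. e2 i \<le> h2 i x})"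
      by (auto simp: not_le)
    then show ?thesis using closed[of i] by auto
  qed
  have "?V = (\<Union>i\<in>{i. A i}. {x\<in>{c..d}. h1 i x < e1 i \<and> h2 i x < e2 i})"
    by blast
  also have "\<dots> \<in> sets lebesgue"
    using sets by (intro sets.countable_UN') auto
  finally show ?thesis
    by (rule bounded_set_imp_lmeasurable[OF bounded_subset[OF bounded_closed_interval[of c d]], rotated]) auto
qed

text \<open>Halving \<open>e\<close> while alternating between the lattice and its dual, the costs
  form a convergent geometric series, and for \<open>e \<le> 1 / X\<close> no short vectors are
  left. The margin \<open>\<sigma>\<close> gives room to the local intervals, which may leave
  \<open>{c..d}\<close> by \<open>1 / Y\<close> or \<open>1 / sqrt X\<close>.\<close>

lemma measure_vsmall_le:
  assumes quad: "quad_pair M f g a b" and YZ: "1 \<le> Y" "1 \<le> Z" "M * Z \<le> Y\<^sup>2" and X: "X = Y * Z"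
    and \<sigma>: "1 / Y \<le> \<sigma>" "1 / sqrt X \<le> \<sigma>" "a + \<sigma> \<le> c" "c \<le> d" "d + \<sigma> \<le> b"
    and e: "0 < e" "e \<le> 1/8"
  shows "{x\<in>{c..d}. \<exists>v. v \<noteq> 0 \<and> vsmall f g X Y Z v e x} \<in> lmeasurable"
    "measure lebesgue {x\<in>{c..d}. \<exists>v. v \<noteq> 0 \<and> vsmall f g X Y Z v e x} \<le> 256 * M\<^sup>2 * sqrt e * (b - a)"
proof -
  let ?V = "\<lambda>e. {x\<in>{c..d}. \<exists>v. v \<noteq> 0 \<and> vsmall f g X Y Z v e x}"
  let ?P = "\<lambda>e. {x\<in>{c..d}. \<exists>v. v \<noteq> 0 \<and> psmall f g X Y Z v e x}"
  have pos: "0 < Y" "0 < Z" "0 < X" using YZ X by simp_all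
  have "1 / Y > 0" using YZ by simp
  then have "0 < \<sigma>" using \<sigma> by linarith
  then have sub: "{c..d} \<subseteq> {a..b}" and ab: "a \<le> b" using \<sigma> by auto
  note cont = continuous_on_subset[OF quad_pair_continuous(1)[OF quad] sub]
    continuous_on_subset[OF quad_pair_continuous(2)[OF quad] sub]
  have V: "?V e \<in> lmeasurable" for e
  proof -
    have "?V e = {x\<in>{c..d}. \<exists>v::int \<times> int \<times> int. (v \<noteq> 0 \<and> \<bar>real_of_int (fst v)\<bar> < e * X) \<and>
       Y * \<bar>fst (snd v) - fst v * x\<bar> < e \<and>
       Z * \<bar>snd (snd v) - fst v * f x - g x * (fst (snd v) - fst v * x)\<bar> < e}"
      by (simp add: vsmall_def case_prod_beta conj_assoc)
    also have "\<dots> \<in> lmeasurable"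
      by (rule lmeasurable_Collect_continuous_less; intro continuous_intros cont)
    finally show ?thesis .
  qed
  have P: "?P e \<in> lmeasurable" for e
  proof -
    have "?P e = {x\<in>{c..d}. \<exists>v::int \<times> int \<times> int. (v \<noteq> 0 \<and> \<bar>real_of_int (snd (snd v))\<bar> < e * Z) \<and>
       X * \<bar>fst v + fst (snd v) * x + snd (snd v) * f x\<bar> < e \<and>
       \<bar>fst (snd v) + snd (snd v) * g x\<bar> < e * Y}"
      by (auto simp: psmall_def case_prod_beta)
    also have "\<dots> \<in> lmeasurable"
      by (rule lmeasurable_Collect_continuous_less; intro continuous_intros cont)
    finally show ?thesis .
  qed
  have Vstep: "measure lebesgue (?V e) \<le> 2 * (32 * M\<^sup>2 * sqrt e) * (b - a) + measure lebesgue (?P (e / 2))"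
    if e: "0 < e" "e \<le> 1/8" for e
  proof (rule measure_small_step[where P = "vsmall f g X Y Z" and P' = "psmall f g X Y Z" and e = e and c = c and d = d,
        OF ab _ _ _ _ V P])
    fix v x assume "v \<noteq> 0" "x \<in> {c..d}" "vsmall f g X Y Z v e x"
    then show "\<exists>l r. l < x \<and> x < r \<and> {l<..<r} \<subseteq> {a..b} \<and>
        (\<forall>y\<in>{l<..<r}. vsmall f g X Y Z v (1/4) y) \<and>
        (\<forall>S\<in>sets lebesgue. S \<subseteq> {y\<in>{l<..<r}. vsmall f g X Y Z v e y} \<longrightarrow>
            measure lebesgue S \<le> 32 * M\<^sup>2 * sqrt e * (r - l))"
      using \<sigma> by (intro vsmall_local[OF quad YZ _ _ e]) auto
  next
    show "0 \<le> 32 * M\<^sup>2 * sqrt e" using e by simp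
  next
    show "vsmall f g X Y Z v e x" if "rmult r v w" "1 \<le> \<bar>r\<bar>" "vsmall f g X Y Z w e x" for r v w e x
      by (rule vsmall_rmult[OF that pos(1,2)])
  next
    show "psmall f g X Y Z (icross v w) (e / 2) x"
      if "vsmall f g X Y Z v (1/4) x" "vsmall f g X Y Z w e x" for v w e x
      by (rule psmall_icross[OF pos(1,2) X that])
  qed
  have Pstep: "measure lebesgue (?P e) \<le> 2 * (32 * M\<^sup>2 * sqrt e) * (b - a) + measure lebesgue (?V (e / 2))"
    if e: "0 < e" "e \<le> 1/8" for e
  proof (rule measure_small_step[where P = "psmall f g X Y Z" and P' = "vsmall f g X Y Z" and e = e and c = c and d = d,
        OF ab _ _ _ _ P V])
    fix v x assume "v \<noteq> 0" "x \<in> {c..d}" "psmall f g X Y Z v e x"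
    then show "\<exists>l r. l < x \<and> x < r \<and> {l<..<r} \<subseteq> {a..b} \<and>
        (\<forall>y\<in>{l<..<r}. psmall f g X Y Z v (1/4) y) \<and>
        (\<forall>S\<in>sets lebesgue. S \<subseteq> {y\<in>{l<..<r}. psmall f g X Y Z v e y} \<longrightarrow>
            measure lebesgue S \<le> 32 * M\<^sup>2 * sqrt e * (r - l))"
      using \<sigma> by (intro psmall_local[OF quad YZ(1,2) X _ _ e]) auto
  next
    show "0 \<le> 32 * M\<^sup>2 * sqrt e" using e by simp
  next
    show "psmall f g X Y Z v e x" if "rmult r v w" "1 \<le> \<bar>r\<bar>" "psmall f g X Y Z w e x" for r v w e x
      by (rule psmall_rmult[OF that pos(3)])
  next
    show "vsmall f g X Y Z (icross v w) (e / 2) x"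
      if "psmall f g X Y Z v (1/4) x" "psmall f g X Y Z w e x" for v w e x
      by (rule vsmall_icross[OF pos(1,2) X that])
  qed
  have le1: "\<bar>i\<bar> < e \<Longrightarrow> e \<le> 1 \<Longrightarrow> i = 0" for i :: int and e :: real by linarith
  have X1: "1 \<le> X" using mult_mono[OF YZ(1,2)] YZ X by simp
  have YX: "Y \<le> X" "Z \<le> X" using YZ X by (simp_all add: mult_le_cancel_left1 mult_le_cancel_right1)
  \<comment> \<open>End of the descent: the coordinates become, one after the other, integers of
    modulus below 1.\<close>
  have Vempty: "?V e = {}" if "0 < e" "e \<le> 1 / X" for e
  proof -
    have False if v: "v \<noteq> 0" "vsmall f g X Y Z v e x" for v x
    proof -
      obtain q p s where vq: "v = (q,p,s)" by (metis prod.collapse)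
      have "e * X \<le> 1" using \<open>e \<le> 1 / X\<close> X1 by (simp add: field_simps)
      then have eX: "e * X \<le> 1" "e \<le> 1" using mult_left_mono[OF X1, of e] \<open>0 < e\<close> by linarith+
      have 1: "\<bar>real_of_int q\<bar> < e * X" "Y * \<bar>p - q * x\<bar> < e" "Z * \<bar>s - q * f x - g x * (p - q * x)\<bar> < e"
        using v(2) by (auto simp: vsmall_def vq)
      have q: "q = 0" by (rule le1[OF _ eX(1)]) (use 1 in simp)
      have "\<bar>real_of_int p\<bar> \<le> Y * \<bar>real_of_int p\<bar>" using YZ by (simp add: mult_le_cancel_right1)
      then have p: "p = 0" using 1(2) q eX by simp
      have "\<bar>real_of_int s\<bar> \<le> Z * \<bar>real_of_int s\<bar>" using YZ by (simp add: mult_le_cancel_right1)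
      then have "s = 0" using 1(3) q p eX by simp
      then show False using v vq q p by (simp add: zero_prod_def)
    qed
    then show ?thesis by blast
  qed
  have Pempty: "?P e = {}" if "0 < e" "e \<le> 1 / X" for e
  proof -
    have False if v: "v \<noteq> 0" "psmall f g X Y Z v e x" for v x
    proof -
      obtain u0 u1 u2 where vu: "v = (u0,u1,u2)" by (metis prod.collapse)
      have "e * X \<le> 1" using \<open>e \<le> 1 / X\<close> X1 by (simp add: field_simps)
      then have eX: "e * Y \<le> 1" "e * Z \<le> 1" "e \<le> 1"
        using mult_left_mono[OF YX(1), of e] mult_left_mono[OF YX(2), of e] mult_left_mono[OF X1, of e] \<open>0 < e\<close>
        by linarith+
      have 1: "X * \<bar>u0 + u1 * x + u2 * f x\<bar> < e" "\<bar>u1 + u2 * g x\<bar> < e * Y" "\<bar>real_of_int u2\<bar> < e * Z"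
        using v(2) by (auto simp: psmall_def vu)
      have u2: "u2 = 0" by (rule le1[OF _ eX(2)]) (use 1 in simp)
      have u1: "u1 = 0" by (rule le1[OF _ eX(1)]) (use 1 u2 in simp)
      have "\<bar>real_of_int u0\<bar> \<le> X * \<bar>real_of_int u0\<bar>" using X1 by (simp add: mult_le_cancel_right1)
      then have "u0 = 0" using 1(1) u1 u2 eX by simp
      then show False using v vu u1 u2 by (simp add: zero_prod_def)
    qed
    then show ?thesis by blast
  qed
  \<comment> \<open>The constant reproduces itself, as \<open>sqrt (1/2) \<le> 3/4\<close> and
    \<open>64 + 256 * 3/4 = 256\<close>.\<close>
  have half: "2 * (32 * M\<^sup>2 * sqrt e) * (b - a) + 256 * M\<^sup>2 * sqrt (e / 2) * (b - a) \<le> 256 * M\<^sup>2 * sqrt e * (b - a)"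
    if "0 < e" for e :: real
  proof -
    have "sqrt (e / 2) \<le> 3 / 4 * sqrt e"
      using that by (intro real_le_lsqrt) (auto simp: power_mult_distrib power2_eq_square)
    then have "M\<^sup>2 * (b - a) * sqrt (e / 2) \<le> M\<^sup>2 * (b - a) * (3 / 4 * sqrt e)"
      using ab by (intro mult_left_mono) auto
    then show ?thesis by (simp add: algebra_simps)
  qed
  have "0 < e \<Longrightarrow> e \<le> 1/8 \<Longrightarrow> e \<le> 2 ^ n / X \<Longrightarrow>
      measure lebesgue (?V e) \<le> 256 * M\<^sup>2 * sqrt e * (b - a) \<and>
      measure lebesgue (?P e) \<le> 256 * M\<^sup>2 * sqrt e * (b - a)" for n e
  proof (induction n arbitrary: e)
    case 0
    then have "0 \<le> 256 * M\<^sup>2 * sqrt e * (b - a)" using ab by simp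
    then show ?case using Vempty[of e] Pempty[of e] 0 by (simp del: Collect_empty_eq)
  next
    case (Suc n)
    have "0 < e / 2" "e / 2 \<le> 1/8" "e / 2 \<le> 2 ^ n / X"
      using Suc.prems by (simp_all add: mult.commute)
    from Suc.IH[OF this] show ?case using Vstep[of e] Pstep[of e] half[of e] Suc.prems by linarith
  qed
  moreover obtain n where "e * X < 2 ^ n" using real_arch_pow[of 2 "e * X"] by auto
  then have "e \<le> 2 ^ n / X" using pos by (simp add: field_simps)
  ultimately show "measure lebesgue (?V e) \<le> 256 * M\<^sup>2 * sqrt e * (b - a)" using e by blast
  show "?V e \<in> lmeasurable" by (rule V)
qed

section \<open>Simultaneous approximation with a lower bound for the denominator\<close>

text \<open>Pigeonhole: \<open>m * n + 1\<close> indices fall into \<open>m * n\<close> boxes, and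
  the difference of two indices in one box is the denominator.\<close>

lemma dirichlet_two_forms:
  fixes x \<alpha> \<gamma> :: real and m n :: nat
  assumes "0 < m" "0 < n"
  obtains q p s :: int where "0 < q" "q \<le> int (m * n)" "\<bar>p - q * x\<bar> < 1 / m"
    "\<bar>s - q * \<alpha> - \<gamma> * (p - q * x)\<bar> < 1 / n"
proof -
  define p where "p j = \<lfloor>real j * x\<rfloor>" for j
  define A where "A j = real j * x - p j" for j
  \<comment> \<open>\<open>A j\<close> already contains the floor that determines \<open>p\<close>,
    so a difference of two values of \<open>y\<close> is the second form up to an integer.\<close>
  define y where "y j = - real j * \<alpha> + \<gamma> * A j" for j
  define B where "B j = y j - \<lfloor>y j\<rfloor>" for j
  have A: "0 \<le> A j" "A j < 1" and B: "0 \<le> B j" "B j < 1" for j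
    unfolding A_def B_def p_def by linarith+
  let ?box = "\<lambda>j. (\<lfloor>m * A j\<rfloor>, \<lfloor>n * B j\<rfloor>)"
  have bnd: "\<lfloor>real k * t\<rfloor> \<in> {0..<int k}" if "0 < k" "0 \<le> t" "t < 1" for k :: nat and t :: real
  proof -
    have "real k * t < real k * 1" using that by (intro mult_strict_left_mono) auto
    then have "\<lfloor>real k * t\<rfloor> < int k" by (simp add: floor_less_iff)
    then show ?thesis using that by simp
  qed
  have "?box ` {0..m * n} \<subseteq> {0..<int m} \<times> {0..<int n}"
    using bnd assms A B by (auto simp del: atLeastLessThan_iff)
  then have "card (?box ` {0..m * n}) \<le> card ({0..<int m} \<times> {0..<int n})"
    by (intro card_mono) auto
  also have "\<dots> < card {0..m * n}" by simp
  finally have "\<not> inj_on ?box {0..m * n}" by (rule pigeonhole)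
  then obtain i k where ik: "i \<le> m * n" "k \<le> m * n" "i \<noteq> k" "?box i = ?box k"
    unfolding inj_on_def by auto
  define j where "j = min i k"
  define l where "l = max i k"
  have jl: "j < l" "l \<le> m * n" "?box j = ?box l" using ik by (auto simp: j_def l_def min_def max_def)
  have close: "\<bar>t - u\<bar> < 1 / k" if "\<lfloor>real k * t\<rfloor> = \<lfloor>real k * u\<rfloor>" "0 < k" for t u :: real and k :: nat
  proof -
    have "\<bar>real k * t - real k * u\<bar> < 1" using that(1) by linarith
    then have "real k * \<bar>t - u\<bar> < 1" by (simp add: abs_mult flip: right_diff_distrib)
    then show ?thesis using that(2) by (simp add: field_simps)
  qed
  have "\<bar>A j - A l\<bar> < 1 / m" "\<bar>B l - B j\<bar> < 1 / n"
    using jl(3) assms by (auto intro!: close)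
  moreover have "(p l - p j) - (int l - int j) * x = A j - A l" by (simp add: A_def algebra_simps)
  moreover have "(\<lfloor>y j\<rfloor> - \<lfloor>y l\<rfloor>) - (int l - int j) * \<alpha> - \<gamma> * ((p l - p j) - (int l - int j) * x) = B l - B j"
    by (simp add: A_def B_def y_def algebra_simps)
  moreover have "int l \<le> int m * int n" using jl(2) by (metis of_nat_le_iff of_nat_mult)
  ultimately show ?thesis
    using jl(1) by (intro that[of "int l - int j" "p l - p j" "\<lfloor>y j\<rfloor> - \<lfloor>y l\<rfloor>"]) auto
qed

text \<open>With \<open>Y = \<kappa> * m\<close>, \<open>Z = \<kappa> * n\<close> and
  \<open>e = \<kappa>\<close>, a Dirichlet solution with \<open>q < \<kappa>^3 * m * n\<close> is a
  short lattice vector. The value of \<open>\<kappa>\<close> solves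
  \<open>256 * M\<^sup>2 * sqrt \<kappa> = 1/4\<close>.\<close>

lemma most_points_near_rational_points:
  fixes f g :: "real \<Rightarrow> real" and M a b :: real
  assumes quad: "quad_pair M f g a b" and ab: "a < b"
  defines "\<kappa> \<equiv> 1 / (1024 * M\<^sup>2)\<^sup>2"
  obtains m0 :: real where "\<And>m n :: nat. m0 \<le> m \<Longrightarrow> m0 \<le> n \<Longrightarrow> M * n \<le> \<kappa> * (real m)\<^sup>2 \<Longrightarrow>
    \<exists>B\<in>lmeasurable. measure lebesgue B \<le> (b - a) / 4 \<and>
      (\<forall>x\<in>{(3*a+b)/4..(a+3*b)/4} - B. \<exists>(q::int) (p::int) s::int. 0 < q \<and> \<kappa>^3 * (real m * real n) \<le> q \<and> q \<le> real m * real n \<and>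
         \<bar>p - q * x\<bar> < 1 / m \<and> \<bar>s - q * f x - g x * (p - q * x)\<bar> < 1 / n)"
proof -
  have M1: "1 \<le> M" using quad unfolding quad_pair_def by blast
  define \<sigma> where "\<sigma> = (b - a) / 4"
  have s0: "0 < \<sigma>" using ab by (simp add: \<sigma>_def)
  have M2: "1 \<le> M\<^sup>2" using M1 by simp
  have sl: "sqrt \<kappa> = 1 / (1024 * M\<^sup>2)" unfolding \<kappa>_def real_sqrt_divide real_sqrt_abs by simp
  have l0: "0 < \<kappa>" using M1 unfolding \<kappa>_def by simp
  have "sqrt \<kappa> \<le> 1 / 1024" unfolding sl using M2 by (intro divide_left_mono) auto
  then have "(sqrt \<kappa>)\<^sup>2 \<le> (1 / 1024)\<^sup>2" using l0 by (intro power_mono) auto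
  then have l8: "\<kappa> \<le> 1/8" using l0 by (simp add: power2_eq_square)
  \<comment> \<open>Makes \<open>Y\<close> and \<open>Z\<close> at least 1 and lets
    \<open>1 / Y\<close> and \<open>1 / sqrt X\<close> fit into the margin \<open>\<sigma>\<close>
    outside the middle half.\<close>
  define m0 where "m0 = Max {1, 1 / \<sigma>, 1 / \<sigma>\<^sup>2} / \<kappa>"
  have m0: "1 \<le> \<kappa> * m0" "1 / \<sigma> \<le> \<kappa> * m0" "1 / \<sigma>\<^sup>2 \<le> \<kappa> * m0"
    using l0 unfolding m0_def by auto
  show ?thesis
  proof (rule that)
    fix m n :: nat assume mn: "m0 \<le> m" "m0 \<le> n" "M * n \<le> \<kappa> * (real m)\<^sup>2"
    define Y Z X where "Y = \<kappa> * m" and "Z = \<kappa> * n" and "X = Y * Z"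
    have "\<kappa> * m0 \<le> Y" "\<kappa> * m0 \<le> Z" unfolding Y_def Z_def using mn l0 by simp_all
    then have Y: "1 \<le> Y" "1 \<le> Z" "1 / \<sigma> \<le> Y" "1 / \<sigma>\<^sup>2 \<le> Y" using m0 by linarith+
    have "\<kappa> * (M * n) \<le> \<kappa> * (\<kappa> * (real m)\<^sup>2)" using mn l0 by (intro mult_left_mono) auto
    then have MZ: "M * Z \<le> Y\<^sup>2" by (simp add: Y_def Z_def power2_eq_square mult_ac)
    have s1: "1 / Y \<le> \<sigma>" using Y s0 by (simp add: field_simps)
    have "Y * 1 \<le> X" unfolding X_def using Y by (intro mult_left_mono) auto
    then have "(1 / \<sigma>)\<^sup>2 \<le> X" using Y by (simp add: power_divide)
    then have "1 / \<sigma> \<le> sqrt X" by (rule real_le_rsqrt)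
    moreover have "0 < sqrt X" using \<open>Y * 1 \<le> X\<close> Y by simp
    ultimately have s2: "1 / sqrt X \<le> \<sigma>" using s0 by (simp add: field_simps)
    have mpos: "0 < m" "0 < n" using Y l0 unfolding Y_def Z_def by (auto intro!: Nat.gr0I)
    let ?c = "(3*a+b)/4" and ?d = "(a+3*b)/4"
    let ?B = "{x\<in>{?c..?d}. \<exists>v. v \<noteq> 0 \<and> vsmall f g X Y Z v \<kappa> x}"
    have cd: "a + \<sigma> \<le> ?c" "?c \<le> ?d" "?d + \<sigma> \<le> b" using ab by (simp_all add: \<sigma>_def field_simps)
    have B: "?B \<in> lmeasurable" "measure lebesgue ?B \<le> 256 * M\<^sup>2 * sqrt \<kappa> * (b - a)"
      by (rule measure_vsmall_le[OF quad Y(1,2) MZ X_def s1 s2 cd l0 l8])+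
    have "256 * M\<^sup>2 * sqrt \<kappa> * (b - a) = (b - a) / 4" unfolding sl using M1 by (simp add: field_simps)
    from B(2)[unfolded this] have Bm: "measure lebesgue ?B \<le> (b - a) / 4" .
    have "\<exists>(q::int) (p::int) s::int. 0 < q \<and> \<kappa>^3 * (real m * real n) \<le> q \<and> q \<le> real m * real n \<and>
         \<bar>p - q * x\<bar> < 1 / m \<and> \<bar>s - q * f x - g x * (p - q * x)\<bar> < 1 / n"
      if x: "x \<in> {?c..?d} - ?B" for x :: real
    proof -
      obtain q p s :: int where qps: "0 < q" "q \<le> int (m * n)" "\<bar>p - q * x\<bar> < 1 / m"
        "\<bar>s - q * f x - g x * (p - q * x)\<bar> < 1 / n"
        by (rule dirichlet_two_forms[where x = x and \<alpha> = "f x" and \<gamma> = "g x", OF mpos])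
      have "real_of_int q \<le> real_of_int (int (m * n))" using qps(2) by (simp only: of_int_le_iff)
      then have qmn: "real_of_int q \<le> real m * real n" by simp
      have "\<kappa>^3 * (real m * real n) \<le> q"
      proof (rule ccontr)
        assume "\<not> ?thesis"
        then have "real_of_int q < \<kappa> * X" by (simp add: X_def Y_def Z_def power3_eq_cube mult_ac)
        moreover have "Y * \<bar>p - q * x\<bar> < \<kappa>" "Z * \<bar>s - q * f x - g x * (p - q * x)\<bar> < \<kappa>"
          using mpos l0 Y(1,2) mult_strict_left_mono[OF qps(3), of Y] mult_strict_left_mono[OF qps(4), of Z]
          by (simp_all add: Y_def Z_def)
        ultimately have "vsmall f g X Y Z (q,p,s) \<kappa> x"
          using qps(1) unfolding vsmall_def prod.case by simp
        moreover have "(q,p,s) \<noteq> 0" using qps(1) by (simp add: zero_prod_def)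
        ultimately have "x \<in> ?B" using x by blast
        then show False using x by blast
      qed
      then show ?thesis using qps(1,3,4) qmn by (intro exI[of _ q] exI[of _ p] exI[of _ s] conjI)
    qed
    then show "\<exists>B\<in>lmeasurable. measure lebesgue B \<le> (b - a) / 4 \<and>
      (\<forall>x\<in>{?c..?d} - B. \<exists>(q::int) (p::int) s::int. 0 < q \<and> \<kappa>^3 * (real m * real n) \<le> q \<and> q \<le> real m * real n \<and>
         \<bar>p - q * x\<bar> < 1 / m \<and> \<bar>s - q * f x - g x * (p - q * x)\<bar> < 1 / n)"
      by (intro bexI[OF _ B(1)] conjI ballI Bm)
  qed
qed

section \<open>Separated points and the measure of their neighbourhoods\<close>

definition nbhds :: "real set \<Rightarrow> real \<Rightarrow> real set" where
  "nbhds D w = (\<Union>s\<in>D. {s - w<..<s + w})"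

definition separated :: "real \<Rightarrow> real set \<Rightarrow> bool" where
  "separated r D \<longleftrightarrow> (\<forall>s\<in>D. \<forall>t\<in>D. s \<noteq> t \<longrightarrow> 2 * r \<le> \<bar>s - t\<bar>)"

lemma nbhds_lmeasurable: "finite D \<Longrightarrow> nbhds D w \<in> lmeasurable"
  unfolding nbhds_def by (rule fmeasurable.finite_UN) auto

lemma measure_nbhds:
  assumes "finite D" "separated r D" "w \<le> r" "0 \<le> w"
  shows "measure lebesgue (nbhds D w) = real (card D) * (2 * w)"
proof -
  have "disjoint_family_on (\<lambda>s. {s - w<..<s + w}) D"
    unfolding disjoint_family_on_def
  proof (intro ballI impI)
    fix s t assume "s \<in> D" "t \<in> D" "s \<noteq> t"
    then have "2 * r \<le> \<bar>s - t\<bar>" using assms(2) by (simp add: separated_def)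
    then show "{s - w<..<s + w} \<inter> {t - w<..<t + w} = {}" using assms(3) by force
  qed
  moreover have "emeasure lebesgue {s - w<..<s + w} \<noteq> \<infinity>" for s
    unfolding infinity_ennreal_def by (rule fmeasurableD2) simp
  ultimately have "measure lebesgue (nbhds D w) = (\<Sum>s\<in>D. measure lebesgue {s - w<..<s + w})"
    unfolding nbhds_def using assms(1) by (intro measure_finite_Union) auto
  also have "\<dots> = real (card D) * (2 * w)" using assms(4) by simp
  finally show ?thesis .
qed

lemma card_separated_le:
  assumes "finite D" "separated r D" "0 < r" "D \<subseteq> {u - h<..<u + h}" "0 \<le> h"
  shows "real (card D) \<le> h / r + 1"
proof -
  have "nbhds D r \<subseteq> {u - (h + r)..u + (h + r)}"
    using assms(4) by (force simp: nbhds_def)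
  then have "measure lebesgue (nbhds D r) \<le> measure lebesgue {u - (h + r)..u + (h + r)}"
    using nbhds_lmeasurable[OF assms(1)] by (intro measure_mono_fmeasurable) (auto simp: fmeasurableD)
  then have "real (card D) * (2 * r) \<le> 2 * (h + r)"
    using measure_nbhds[OF assms(1,2), of r] assms(3,5) by simp
  then show ?thesis using assms(3) by (simp add: field_simps)
qed

text \<open>Only centres within \<open>h + w\<close> of \<open>u\<close> matter, and by disjointness
  of their \<open>r\<close>-neighbourhoods there are at most \<open>h / r + 2\<close> of
  them.\<close>

lemma measure_nbhds_Int_interval_le:
  assumes "finite D" "separated r D" "0 < w" "w \<le> r" "0 \<le> h"
  shows "measure lebesgue (nbhds D w \<inter> {u - h<..<u + h}) \<le> 2 * w * (h / r + 2)"
proof -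
  define D' where "D' = D \<inter> {u - (h + w)<..<u + (h + w)}"
  have fin: "finite D'" and sep: "separated r D'" using assms by (auto simp: D'_def separated_def)
  have sub: "nbhds D w \<inter> {u - h<..<u + h} \<subseteq> nbhds D' w"
    by (force simp: nbhds_def D'_def)
  have "measure lebesgue (nbhds D w \<inter> {u - h<..<u + h}) \<le> measure lebesgue (nbhds D' w)"
    using nbhds_lmeasurable[OF assms(1)] nbhds_lmeasurable[OF fin]
    by (intro measure_mono_fmeasurable[OF sub] sets.Int) (auto simp: fmeasurableD)
  also have "\<dots> = real (card D') * (2 * w)" using assms by (intro measure_nbhds[OF fin sep]) auto
  also have "\<dots> \<le> ((h + w) / r + 1) * (2 * w)"
    using assms by (intro mult_right_mono card_separated_le[OF fin sep]) (auto simp: D'_def)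
  also have "\<dots> \<le> (h / r + 2) * (2 * w)"
  proof (rule mult_right_mono)
    have "w / r \<le> 1" using assms by simp
    then show "(h + w) / r + 1 \<le> h / r + 2" by (simp add: add_divide_distrib)
  qed (use assms in simp)
  finally show ?thesis by (simp only: mult_ac)
qed

text \<open>Each interval of radius \<open>w\<close> meets at most \<open>w / r' + 2\<close> of the
  others. The first term gives the product of the measures because \<open>D'\<close> has at least
  \<open>L / (24 * r')\<close> points; the 2 gives the error term.\<close>

lemma measure_nbhds_Int_le:
  assumes D: "finite D" "separated r D" "0 < w" "w \<le> r" "0 < r" "L \<le> real (card D) * (24 * r)" "0 < L"
    and D': "finite D'" "separated r' D'" "0 < w'" "w' \<le> r'" "0 < r'" "L \<le> real (card D') * (24 * r')"
  defines "\<mu> \<equiv> measure lebesgue (nbhds D w)" and "\<mu>' \<equiv> measure lebesgue (nbhds D' w')"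
  shows "measure lebesgue (nbhds D w \<inter> nbhds D' w') \<le> 12 / L * \<mu> * \<mu>' + 2 * \<mu> * (w' / w)"
proof -
  have eq: "nbhds D w \<inter> nbhds D' w' = (\<Union>s\<in>D. nbhds D' w' \<inter> {s - w<..<s + w})"
    unfolding nbhds_def by blast
  have "nbhds D' w' \<inter> {s - w<..<s + w} \<in> sets lebesgue" for s
    by (intro sets.Int fmeasurableD[OF nbhds_lmeasurable[OF D'(1)]]) simp
  then have "measure lebesgue (nbhds D w \<inter> nbhds D' w')
      \<le> (\<Sum>s\<in>D. measure lebesgue (nbhds D' w' \<inter> {s - w<..<s + w}))"
    unfolding eq by (intro measure_UNION_le[OF D(1)])
  also have "\<dots> \<le> (\<Sum>s\<in>D. 2 * w' * (w / r' + 2))"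
    using D D' by (intro sum_mono measure_nbhds_Int_interval_le) auto
  also have "\<dots> = real (card D) * (2 * w) * (w' / r') + 2 * (real (card D) * (2 * w)) * (w' / w)"
    using D(3) by (simp add: algebra_simps)
  also have "\<dots> = \<mu> * (w' / r') + 2 * \<mu> * (w' / w)"
    unfolding \<mu>_def using measure_nbhds[OF D(1,2,4)] D(3) by simp
  also have "\<mu> * (w' / r') \<le> \<mu> * (12 / L * \<mu>')"
  proof (rule mult_left_mono)
    have "w' * L \<le> w' * (real (card D') * (24 * r'))" using D' by (intro mult_left_mono) auto
    then have "w' / r' \<le> 12 / L * (real (card D') * (2 * w'))" using D D' by (simp add: field_simps)
    then show "w' / r' \<le> 12 / L * \<mu>'"
      unfolding \<mu>'_def using measure_nbhds[OF D'(1,2,4)] D'(3) by simp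
  qed (simp add: \<mu>_def)
  finally show ?thesis by (simp add: mult_ac)
qed

text \<open>A point outside the exceptional set lies within \<open>1 / (m * q)\<close> of some
  \<open>p / q\<close>, hence within \<open>r = 1 / (\<kappa>^3 * m * Q)\<close>. A maximal
  separated set \<open>D\<close> of such fractions has one within \<open>2 * r\<close> of each, so
  radius \<open>3 * r\<close> around \<open>D\<close> covers most of the middle half and
  \<open>D\<close> must be large.\<close>

lemma exists_separated_near_curve:
  fixes f g :: "real \<Rightarrow> real" and M a b :: real
  assumes quad: "quad_pair M f g a b" and ab: "a < b"
  defines "\<kappa> \<equiv> 1 / (1024 * M\<^sup>2)\<^sup>2"
  obtains m0 :: real where "\<And>m n :: nat. m0 \<le> m \<Longrightarrow> m \<le> n \<Longrightarrow> M * n \<le> \<kappa> * (real m)\<^sup>2 \<Longrightarrow>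
    0 < m \<and> (\<exists>D. finite D \<and> separated (1 / (\<kappa>^3 * m * (real m * real n))) D \<and>
      b - a \<le> real (card D) * (24 * (1 / (\<kappa>^3 * m * (real m * real n)))) \<and>
      (\<forall>x\<in>nbhds D (1 / (n * (real m * real n))). x \<in> {a..b} \<and>
         (\<exists>(q::int) (p::int) t::int. 0 < q \<and> \<kappa>^3 * (real m * real n) \<le> q \<and> q \<le> real m * real n \<and>
            \<bar>q * x - p\<bar> \<le> 1 / n \<and> \<bar>q * f x - t\<bar> \<le> 4 * M / n)))"
proof -
  have M1: "1 \<le> M" using quad unfolding quad_pair_def by blast
  have k0: "0 < \<kappa>" using M1 by (simp add: \<kappa>_def)
  have k1: "\<kappa> \<le> 1"
  proof -
    have "1 \<le> 1024 * M\<^sup>2" using M1 one_le_power[of M 2] by linarith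
    then have "1 \<le> (1024 * M\<^sup>2)\<^sup>2" by (rule one_le_power)
    moreover have "1 / A \<le> 1" if "1 \<le> A" for A :: real using that by simp
    ultimately show ?thesis unfolding \<kappa>_def by blast
  qed
  obtain m1 :: real where m1: "\<And>m n :: nat. m1 \<le> m \<Longrightarrow> m1 \<le> n \<Longrightarrow> M * n \<le> \<kappa> * (real m)\<^sup>2 \<Longrightarrow>
    \<exists>B\<in>lmeasurable. measure lebesgue B \<le> (b - a) / 4 \<and>
      (\<forall>x\<in>{(3*a+b)/4..(a+3*b)/4} - B. \<exists>(q::int) (p::int) s::int. 0 < q \<and> \<kappa>^3 * (real m * real n) \<le> q \<and> q \<le> real m * real n \<and>
         \<bar>p - q * x\<bar> < 1 / m \<and> \<bar>s - q * f x - g x * (p - q * x)\<bar> < 1 / n)"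
    by (rule most_points_near_rational_points[OF quad ab, folded \<kappa>_def]) (rule that)
  define L where "L = b - a"
  have L0: "0 < L" using ab by (simp add: L_def)
  define m0 where "m0 = max (max m1 1) (8 / (L * \<kappa>^3))"
  show ?thesis
  proof (rule that)
    fix m n :: nat assume mn: "m0 \<le> m" "m \<le> n" "M * n \<le> \<kappa> * (real m)\<^sup>2"
    define Q where "Q = real m * real n"
    define r where "r = 1 / (\<kappa>^3 * m * Q)"
    define w where "w = 1 / (n * Q)"
    have m: "1 \<le> real m" "m1 \<le> m" "m1 \<le> n" "8 / (L * \<kappa>^3) \<le> m" "real m \<le> n"
      using mn by (auto simp: m0_def)
    have Q1: "1 \<le> Q" unfolding Q_def using m mult_mono[of 1 "real m" 1 "real n"] by simp
    have k3: "0 < \<kappa>^3" "\<kappa>^3 \<le> 1" using k0 k1 by (simp_all add: power_le_one)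
    have r0: "0 < r" "0 < w" using k3 m Q1 by (simp_all add: r_def w_def)
    have rL: "r \<le> L / 8"
    proof -
      have "8 \<le> m * (L * \<kappa>^3)" using m(4) L0 k3 by (simp add: pos_divide_le_eq)
      moreover have "m * (L * \<kappa>^3) * 1 \<le> m * (L * \<kappa>^3) * Q" using Q1 L0 k3 by (intro mult_left_mono) auto
      ultimately show ?thesis using k3 m Q1 by (simp add: r_def pos_divide_le_eq mult_ac)
    qed
    have wr: "w \<le> r"
    proof -
      have "\<kappa>^3 * m \<le> 1 * real n" using k3 m by (intro mult_mono) auto
      then have "\<kappa>^3 * m * Q \<le> n * Q" using Q1 by (intro mult_right_mono) auto
      then show ?thesis unfolding r_def w_def using k3 m Q1 by (intro divide_left_mono) auto
    qed
    let ?c = "(3*a+b)/4" and ?d = "(a+3*b)/4"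
    \<comment> \<open>Widening the middle half by \<open>r\<close> retains the fractions found from
      points near its ends.\<close>
    define R where "R = {s \<in> {?c - r..?d + r}. \<exists>(q::int) (p::int) t::int. 0 < q \<and> \<kappa>^3 * Q \<le> q \<and> q \<le> Q \<and>
        s = p / q \<and> \<bar>q * f s - t\<bar> \<le> 2 / n}"
    have "8 * r \<le> b - a" using rL unfolding L_def by simp
    then have "a + w \<le> ?c - r" "?d + r \<le> b - w" using wr r0 by (simp_all add: field_simps)
    note Rab = this
    have "finite R"
    proof -
      define N where "N = \<lceil>Q * (\<bar>a\<bar> + \<bar>b\<bar>)\<rceil>"
      have "R \<subseteq> (\<lambda>(p,q). real_of_int p / real_of_int q) ` ({-N..N} \<times> {1..\<lfloor>Q\<rfloor>})"
      proof
        fix s assume "s \<in> R"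
        then obtain q p :: int where qp: "0 < q" "q \<le> Q" "s = p / q" and s: "s \<in> {?c - r..?d + r}"
          unfolding R_def by blast
        have "?c - r \<le> s" "s \<le> ?d + r" using s by auto
        then have "a \<le> s" "s \<le> b" using Rab r0 by linarith+
        then have sle: "\<bar>s\<bar> \<le> \<bar>a\<bar> + \<bar>b\<bar>" by linarith
        have "\<bar>real_of_int p\<bar> = q * \<bar>s\<bar>" using qp by (simp add: abs_mult)
        also have "\<dots> \<le> Q * (\<bar>a\<bar> + \<bar>b\<bar>)"
          using qp(1,2) sle Q1 by (intro mult_mono) simp_all
        also have "\<dots> \<le> of_int N" unfolding N_def by (rule le_of_int_ceiling)
        finally have "\<bar>p\<bar> \<le> N" by (simp only: of_int_abs[symmetric] of_int_le_iff)
        then have "p \<in> {-N..N}" unfolding atLeastAtMost_iff by linarith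
        moreover have "q \<in> {1..\<lfloor>Q\<rfloor>}" using qp(1,2) by (simp add: le_floor_iff)
        ultimately show "s \<in> (\<lambda>(p,q). real_of_int p / real_of_int q) ` ({-N..N} \<times> {1..\<lfloor>Q\<rfloor>})"
          unfolding qp(3) by (intro rev_image_eqI[of "(p, q)"]) auto
      qed
      then show ?thesis by (rule finite_subset) simp
    qed
    then have fin: "finite {D \<in> Pow R. separated r D}" by simp
    have emp: "{} \<in> {D \<in> Pow R. separated r D}" by (simp add: separated_def)
    obtain D where D0: "D \<in> {D \<in> Pow R. separated r D}"
      and Dmax0: "\<forall>D'\<in>{D \<in> Pow R. separated r D}. D \<subseteq> D' \<longrightarrow> D = D'"
      using finite_has_maximal2[OF fin emp] by blast
    have D: "D \<subseteq> R" "separated r D" using D0 by blast+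
    have Dmax: "D = D'" if "D' \<subseteq> R" "separated r D'" "D \<subseteq> D'" for D'
      using Dmax0 that by blast
    have finD: "finite D" using D(1) \<open>finite R\<close> finite_subset by blast
    have near: "\<exists>s'\<in>D. \<bar>s - s'\<bar> < 2 * r" if "s \<in> R" for s
    proof (rule ccontr)
      assume no: "\<not> ?thesis"
      then have "s \<notin> D" using r0 by force
      have far: "2 * r \<le> \<bar>s - t\<bar>" "2 * r \<le> \<bar>t - s\<bar>" if "t \<in> D" for t
        using no that by (auto simp: abs_minus_commute not_less)
      have "separated r (insert s D)"
        unfolding separated_def
      proof (intro ballI impI)
        fix t u assume "t \<in> insert s D" "u \<in> insert s D" "t \<noteq> u"
        then consider "t = s" "u \<in> D" | "u = s" "t \<in> D" | "t \<in> D" "u \<in> D" by blast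
        then show "2 * r \<le> \<bar>t - u\<bar>"
        proof cases
          case 3
          then show ?thesis using D(2) \<open>t \<noteq> u\<close> unfolding separated_def by blast
        qed (simp_all add: far)
      qed
      then have "D = insert s D" using Dmax[of "insert s D"] D(1) that by blast
      then show False using \<open>s \<notin> D\<close> by blast
    qed
    obtain B where "B \<in> lmeasurable" and B2: "measure lebesgue B \<le> (b - a) / 4 \<and>
      (\<forall>x\<in>{?c..?d} - B. \<exists>(q::int) (p::int) s::int. 0 < q \<and> \<kappa>^3 * (real m * real n) \<le> q \<and> q \<le> real m * real n \<and>
         \<bar>p - q * x\<bar> < 1 / m \<and> \<bar>s - q * f x - g x * (p - q * x)\<bar> < 1 / n)"
      using m1[OF m(2,3) mn(3)] by (rule bexE)
    then have B: "B \<in> lmeasurable" "measure lebesgue B \<le> (b - a) / 4" by blast+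
    note good = bspec[OF conjunct2[OF B2], folded Q_def]
    have goodR: "\<exists>s\<in>R. \<bar>x - s\<bar> < r" if x: "x \<in> {?c..?d} - B" for x
    proof -
      obtain q p t :: int where qpt: "0 < q" "\<kappa>^3 * Q \<le> q" "q \<le> Q" "\<bar>p - q * x\<bar> < 1 / m"
        "\<bar>t - q * f x - g x * (p - q * x)\<bar> < 1 / n"
        using good[OF x] by blast
      have q1: "1 \<le> real_of_int q" using qpt(1) by simp
      define s where "s = real_of_int p / q"
      have p: "real_of_int p = q * s" using q1 by (simp add: s_def)
      have eq: "p - q * x = q * (s - x)" by (simp add: p algebra_simps)
      then have ab: "q * \<bar>s - x\<bar> < 1 / m" using qpt(4) q1 by (simp add: abs_mult)
      have "\<kappa>^3 * Q * \<bar>s - x\<bar> \<le> q * \<bar>s - x\<bar>" using qpt by (intro mult_right_mono) auto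
      also have "\<dots> < 1 / m" by (rule ab)
      finally have sx: "\<bar>s - x\<bar> < r"
        using k3 Q1 m by (simp add: r_def field_simps)
      have cx: "?c \<le> x" "x \<le> ?d" using x by auto
      have sin: "s \<in> {?c - r..?d + r}" unfolding atLeastAtMost_iff using cx sx by linarith
      then have sab: "s \<in> {a..b}" and xab: "x \<in> {a..b}"
        unfolding atLeastAtMost_iff using Rab r0 cx by linarith+
      have tay: "0 \<le> f s - f x - g x * (s - x)" "f s - f x - g x * (s - x) \<le> M * (s - x)\<^sup>2"
      proof -
        have "0 \<le> (s - x)\<^sup>2 / M" using M1 by simp
        then show "0 \<le> f s - f x - g x * (s - x)" "f s - f x - g x * (s - x) \<le> M * (s - x)\<^sup>2"
          using quad_pairD[OF quad xab sab] by linarith+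
      qed
      \<comment> \<open>Again a spare factor \<open>q\<close> helps: the remainder becomes
        \<open>M * (q * \<bar>s - x\<bar>)^2\<close>, below \<open>M / m^2\<close> and hence at most
        \<open>1 / n\<close>.\<close>
      have "q * (f s - f x - g x * (s - x)) \<le> q * (M * (s - x)\<^sup>2)" using tay q1 by (intro mult_left_mono) auto
      also have "\<dots> \<le> q * (q * (M * (s - x)\<^sup>2))"
      proof (rule mult_left_mono)
        have "0 \<le> M * (s - x)\<^sup>2" using M1 by simp
        from mult_right_mono[OF q1 this] show "M * (s - x)\<^sup>2 \<le> q * (M * (s - x)\<^sup>2)" by simp
      qed (use q1 in simp)
      also have "\<dots> = M * (q * \<bar>s - x\<bar>)\<^sup>2" by (simp add: power_mult_distrib power2_eq_square)
      also have "\<dots> \<le> M * (1 / m)\<^sup>2" using ab q1 M1 by (intro mult_left_mono power_mono) auto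
      also have "\<dots> \<le> 1 / n"
      proof -
        have "\<kappa> * (real m)\<^sup>2 \<le> 1 * (real m)\<^sup>2" using k1 by (intro mult_right_mono) auto
        then have "M * n \<le> (real m)\<^sup>2" using mn(3) by linarith
        then have "M * n / ((real m)\<^sup>2 * n) \<le> (real m)\<^sup>2 / ((real m)\<^sup>2 * n)" by (intro divide_right_mono) auto
        then show ?thesis using m by (simp add: power_divide)
      qed
      finally have up: "q * (f s - f x - g x * (s - x)) \<le> 1 / n" .
      have lo: "0 \<le> q * (f s - f x - g x * (s - x))" using tay q1 by simp
      have "q * f s - t = q * (f s - f x - g x * (s - x)) - (t - q * f x - g x * (p - q * x))"
        unfolding eq by (simp add: algebra_simps)
      then have "\<bar>q * f s - t\<bar> \<le> 1 / n + 1 / n" using up lo qpt(5) by linarith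
      then have "\<bar>q * f s - t\<bar> \<le> 2 / n" by simp
      then have "s \<in> R" unfolding R_def using sin qpt(1,2,3) s_def by blast
      then show ?thesis using sx by (auto simp: abs_minus_commute)
    qed
    have sub: "{?c..?d} \<subseteq> B \<union> nbhds D (3 * r)"
    proof
      fix x assume x: "x \<in> {?c..?d}"
      show "x \<in> B \<union> nbhds D (3 * r)"
      proof (cases "x \<in> B")
        case False
        then obtain s where s: "s \<in> R" "\<bar>x - s\<bar> < r" using goodR x by blast
        then obtain s' where s': "s' \<in> D" "\<bar>s - s'\<bar> < 2 * r" using near by blast
        then have "x \<in> {s' - 3 * r<..<s' + 3 * r}" using s by auto
        then show ?thesis using s'(1) unfolding nbhds_def by blast
      qed simp
    qed
    \<comment> \<open>The middle half has measure \<open>L / 2\<close>, of which \<open>B\<close>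
      covers at most \<open>L / 4\<close>; the rest yields the factor 24.\<close>
    have "measure lebesgue {?c..?d} \<le> measure lebesgue (B \<union> nbhds D (3 * r))"
      using B nbhds_lmeasurable[OF finD] by (intro measure_mono_fmeasurable[OF sub] fmeasurable.Un) auto
    also have "\<dots> \<le> measure lebesgue B + measure lebesgue (nbhds D (3 * r))"
      using B nbhds_lmeasurable[OF finD, of "3 * r"] by (intro measure_Un_le fmeasurableD)
    also have "measure lebesgue (nbhds D (3 * r)) \<le> (\<Sum>s\<in>D. measure lebesgue {s - 3 * r<..<s + 3 * r})"
      unfolding nbhds_def using finD by (intro measure_UNION_le) auto
    also have "\<dots> = real (card D) * (6 * r)" using r0 by simp
    finally have "L / 2 \<le> L / 4 + real (card D) * (6 * r)"
      using B(2) ab by (simp add: L_def field_simps)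
    then have cardD: "L \<le> real (card D) * (24 * r)" by simp
    \<comment> \<open>Moving from \<open>s\<close> by at most \<open>w\<close> changes
      \<open>q * x\<close> by at most \<open>Q * w = 1 / n\<close> and \<open>q * f x\<close> by at
      most \<open>2 * M / n\<close>; the fraction itself contributed \<open>2 / n\<close>.\<close>
    have approx: "x \<in> {a..b} \<and>
         (\<exists>(q::int) (p::int) t::int. 0 < q \<and> \<kappa>^3 * Q \<le> q \<and> q \<le> Q \<and>
            \<bar>q * x - p\<bar> \<le> 1 / n \<and> \<bar>q * f x - t\<bar> \<le> 4 * M / n)" if x: "x \<in> nbhds D w" for x :: real
    proof -
      obtain s where s: "s \<in> D" "x \<in> {s - w<..<s + w}" using x unfolding nbhds_def by blast
      then have "s \<in> R" using D(1) by blast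
      then obtain q p t :: int where qpt: "0 < q" "\<kappa>^3 * Q \<le> q" "q \<le> Q" "s = p / q" "\<bar>q * f s - t\<bar> \<le> 2 / n"
        and sin: "s \<in> {?c - r..?d + r}" unfolding R_def by blast
      have xs: "\<bar>x - s\<bar> \<le> w" using s(2) by auto
      have "?c - r \<le> s" "s \<le> ?d + r" "s - w < x" "x < s + w" using sin s(2) by auto
      then have xab: "x \<in> {a..b}" "s \<in> {a..b}" using Rab r0 unfolding atLeastAtMost_iff by linarith+
      have qw: "q * \<bar>x - s\<bar> \<le> 1 / n"
      proof -
        have "q * \<bar>x - s\<bar> \<le> Q * w" using qpt xs r0 by (intro mult_mono) auto
        also have "\<dots> = 1 / n" using Q1 by (simp add: w_def)
        finally show ?thesis .
      qed
      have "q * x - p = q * (x - s)" using qpt(1,4) by (simp add: algebra_simps)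
      then have 1: "\<bar>q * x - p\<bar> \<le> 1 / n" using qw qpt(1) by (simp add: abs_mult)
      have "1 * 1 \<le> real n * Q" using m Q1 by (intro mult_mono) auto
      then have w1: "w \<le> 1" by (simp add: w_def)
      have "\<bar>f x - f s\<bar> \<le> M * \<bar>x - s\<bar> + M * (x - s)\<^sup>2"
        by (rule quad_pair_f_lipschitz[OF quad xab(2,1)])
      also have "M * (x - s)\<^sup>2 \<le> M * \<bar>x - s\<bar>"
      proof (rule mult_left_mono)
        have "\<bar>x - s\<bar> * \<bar>x - s\<bar> \<le> \<bar>x - s\<bar> * 1" using xs w1 by (intro mult_left_mono) auto
        then show "(x - s)\<^sup>2 \<le> \<bar>x - s\<bar>" by (simp add: power2_eq_square)
      qed (use M1 in auto)
      finally have "\<bar>f x - f s\<bar> \<le> 2 * M * \<bar>x - s\<bar>" by simp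
      then have "q * \<bar>f x - f s\<bar> \<le> q * (2 * M * \<bar>x - s\<bar>)" using qpt(1) by (intro mult_left_mono) auto
      also have "\<dots> = 2 * M * (q * \<bar>x - s\<bar>)" by simp
      also have "\<dots> \<le> 2 * M * (1 / n)" using qw M1 by (intro mult_left_mono) auto
      finally have "\<bar>q * (f x - f s)\<bar> \<le> 2 * M * (1 / n)" using qpt(1) by (simp add: abs_mult)
      moreover have "q * f x - t = q * (f x - f s) + (q * f s - t)" by (simp add: algebra_simps)
      ultimately have "\<bar>q * f x - t\<bar> \<le> 2 * M * (1 / n) + 2 / n" using qpt(5) by linarith
      also have "\<dots> \<le> 4 * M / n" using m M1 by (simp add: field_simps)
      finally have 2: "\<bar>q * f x - t\<bar> \<le> 4 * M / n" .
      show ?thesis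
        by (intro conjI exI[of _ q] exI[of _ p] exI[of _ t] xab(1) qpt(1,2,3) 1 2)
    qed
    have "finite D \<and> separated r D \<and> L \<le> real (card D) * (24 * r) \<and>
      (\<forall>x\<in>nbhds D w. x \<in> {a..b} \<and>
         (\<exists>(q::int) (p::int) t::int. 0 < q \<and> \<kappa>^3 * Q \<le> q \<and> q \<le> Q \<and>
            \<bar>q * x - p\<bar> \<le> 1 / n \<and> \<bar>q * f x - t\<bar> \<le> 4 * M / n))"
      by (intro conjI ballI finD D(2) cardD conjunct1[OF approx] conjunct2[OF approx])
    note * = this[unfolded Q_def r_def w_def L_def]
    have "0 < m" using m(1) by simp
    with * show "0 < m \<and> (\<exists>D. finite D \<and> separated (1 / (\<kappa>^3 * m * (real m * real n))) D \<and>
      b - a \<le> real (card D) * (24 * (1 / (\<kappa>^3 * m * (real m * real n)))) \<and>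
      (\<forall>x\<in>nbhds D (1 / (n * (real m * real n))). x \<in> {a..b} \<and>
         (\<exists>(q::int) (p::int) t::int. 0 < q \<and> \<kappa>^3 * (real m * real n) \<le> q \<and> q \<le> real m * real n \<and>
            \<bar>q * x - p\<bar> \<le> 1 / n \<and> \<bar>q * f x - t\<bar> \<le> 4 * M / n)))"
      by (intro conjI[OF _ exI[of _ D]])
  qed
qed

section \<open>Limit superior of quasi-independent sets\<close>

text \<open>The square of the sum of the indicators minus \<open>t\<close> times the indicator of
  the union has nonnegative integral for every \<open>t\<close>; the choice
  \<open>t = ?S / u\<close> minimises it.\<close>

lemma chung_erdos_inequality:
  fixes E :: "'i \<Rightarrow> real set"
  assumes fin: "finite K" and E: "\<And>k. k \<in> K \<Longrightarrow> E k \<in> lmeasurable"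
  shows "(\<Sum>k\<in>K. measure lebesgue (E k))\<^sup>2
    \<le> measure lebesgue (\<Union>k\<in>K. E k) * (\<Sum>k\<in>K. \<Sum>l\<in>K. measure lebesgue (E k \<inter> E l))"
proof -
  let ?U = "\<Union>k\<in>K. E k"
  let ?S = "\<Sum>k\<in>K. measure lebesgue (E k)"
  let ?T = "\<Sum>k\<in>K. \<Sum>l\<in>K. measure lebesgue (E k \<inter> E l)"
  have U: "?U \<in> lmeasurable" using fin E by (rule fmeasurable.finite_UN)
  have EE: "E k \<inter> E l \<in> lmeasurable" if "k \<in> K" "l \<in> K" for k l
    using E that by (intro fmeasurable_Int_fmeasurable fmeasurableD)
  have int: "has_bochner_integral lebesgue (indicat_real A) (measure lebesgue A)" if "A \<in> lmeasurable" for A :: "real set"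
    using fmeasurableD[OF that] fmeasurableD2[OF that]
    by (intro has_bochner_integral_real_indicator) (auto simp: top.not_eq_extremum)
  have quad: "0 \<le> ?T - 2 * t * ?S + t\<^sup>2 * measure lebesgue ?U" for t :: real
  proof -
    let ?h = "\<lambda>x. (\<Sum>k\<in>K. \<Sum>l\<in>K. indicat_real (E k \<inter> E l) x) - 2 * t * (\<Sum>k\<in>K. indicat_real (E k) x)
        + t\<^sup>2 * indicat_real ?U x"
    have "0 \<le> ?h x" for x
    proof -
      have 1: "(\<Sum>k\<in>K. \<Sum>l\<in>K. indicat_real (E k \<inter> E l) x) = (\<Sum>k\<in>K. indicat_real (E k) x)\<^sup>2"
        by (simp add: power2_eq_square sum_product indicator_inter_arith)
      have 2: "(\<Sum>k\<in>K. indicat_real (E k) x) = (\<Sum>k\<in>K. indicat_real (E k) x) * indicat_real ?U x"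
        unfolding sum_distrib_right by (intro sum.cong refl) (auto simp: indicator_def)
      have 3: "indicat_real ?U x = indicat_real ?U x * indicat_real ?U x"
        by (cases "x \<in> ?U") (simp_all del: UN_iff)
      have sq: "s\<^sup>2 - 2 * t * s + t\<^sup>2 * u = (s - t * u)\<^sup>2" if "s = s * u" "u = u * u" for s u :: real
      proof -
        have "(s - t * u)\<^sup>2 = s\<^sup>2 - 2 * t * (s * u) + t\<^sup>2 * (u * u)"
          by (simp add: power2_eq_square algebra_simps)
        then show ?thesis by (simp only: that[symmetric])
      qed
      have "?h x = ((\<Sum>k\<in>K. indicat_real (E k) x) - t * indicat_real ?U x)\<^sup>2"
        unfolding 1 by (rule sq[OF 2 3])
      then show ?thesis by simp
    qed
    then have "0 \<le> (LINT x|lebesgue. ?h x)" by simp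
    moreover have "has_bochner_integral lebesgue ?h (?T - 2 * t * ?S + t\<^sup>2 * measure lebesgue ?U)"
      by (intro has_bochner_integral_add has_bochner_integral_diff has_bochner_integral_mult_right
          has_bochner_integral_sum int E EE U)
    then have "(LINT x|lebesgue. ?h x) = ?T - 2 * t * ?S + t\<^sup>2 * measure lebesgue ?U"
      by (rule has_bochner_integral_integral_eq)
    ultimately show ?thesis by linarith
  qed
  show ?thesis
  proof (cases "measure lebesgue ?U = 0")
    case True
    have "measure lebesgue (E k) \<le> measure lebesgue ?U" if "k \<in> K" for k
      using that E U by (intro measure_mono_fmeasurable fmeasurableD) auto
    then have "measure lebesgue (E k) = 0" if "k \<in> K" for k
      using True that by (metis measure_nonneg order_antisym)
    then show ?thesis using True by simp
  next
    case False
    define u where "u = measure lebesgue ?U"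
    have u: "0 < u" using False by (simp add: u_def zero_less_measure_iff)
    have "0 \<le> u * (?T - 2 * (?S / u) * ?S + (?S / u)\<^sup>2 * u)"
      using quad[of "?S / u"] u unfolding u_def by (intro mult_nonneg_nonneg) auto
    also have "\<dots> = u * ?T - ?S\<^sup>2" using u by (simp add: field_simps power2_eq_square)
    finally show ?thesis unfolding u_def by simp
  qed
qed

text \<open>By divergence, finitely many sets beyond any \<open>N\<close> have total measure
  \<open>S\<close> above \<open>16 / C\<close>. The geometric errors, at most \<open>16 * S\<close>,
  are then absorbed into \<open>C * S\<^sup>2\<close>, and the Chung-Erdos inequality bounds every
  tail union from below; these decrease to the limit superior.\<close>

lemma measure_limsup_ge_of_quasi_independent:
  fixes E :: "nat \<Rightarrow> real set"
  assumes E: "\<And>k. E k \<in> lmeasurable" "\<And>k. E k \<subseteq> {a..b}" and C: "0 < C"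
    and qi: "\<And>k l. k \<le> l \<Longrightarrow> measure lebesgue (E k \<inter> E l)
      \<le> C * measure lebesgue (E k) * measure lebesgue (E l) + 4 * (1/2) ^ (l - k) * measure lebesgue (E k)"
    and div: "\<not> summable (\<lambda>k. measure lebesgue (E k))"
  shows "(\<Inter>N. \<Union>k\<in>{N..}. E k) \<in> lmeasurable" "1 / (2 * C) \<le> measure lebesgue (\<Inter>N. \<Union>k\<in>{N..}. E k)"
proof -
  define \<mu> where "\<mu> k = measure lebesgue (E k)" for k
  have m0: "0 \<le> \<mu> k" for k by (simp add: \<mu>_def)
  have U: "(\<Union>k\<in>{N..}. E k) \<in> lmeasurable" for N
    using E by (intro bounded_set_imp_lmeasurable bounded_subset[OF bounded_closed_interval[of a b]])
      (auto intro!: sets.countable_UN' fmeasurableD)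
  have geo: "(\<Sum>l\<in>{k..<N}. (1/2::real) ^ (l - k)) \<le> 2" for k N :: nat
  proof -
    have "(\<Sum>l\<in>{k..<N}. (1/2::real) ^ (l - k)) = (\<Sum>j<N - k. (1/2) ^ j)"
      by (rule sum.reindex_bij_witness[of _ "\<lambda>j. j + k" "\<lambda>l. l - k"]) auto
    also have "\<dots> \<le> 2" by (simp add: sum_gp_strict)
    finally show ?thesis .
  qed
  have large: "1 / (2 * C) \<le> measure lebesgue (\<Union>k\<in>{N..}. E k)" for N
  proof -
    have "\<not> summable (\<lambda>k. \<mu> (k + N))" using div by (subst summable_iff_shift) (simp add: \<mu>_def[abs_def])
    then obtain n where n: "16 / C < (\<Sum>k<n. \<mu> (k + N))"
      using summableI_nonneg_bounded[of "\<lambda>k. \<mu> (k + N)" "16 / C"] m0 by (meson not_less)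
    let ?K = "{N..<N + n}"
    define S where "S = (\<Sum>k\<in>?K. \<mu> k)"
    have "(\<Sum>k<n. \<mu> (k + N)) = S"
      unfolding S_def by (rule sum.reindex_bij_witness[of _ "\<lambda>k. k - N" "\<lambda>k. k + N"]) auto
    then have S: "16 / C < S" using n by simp
    then have S0: "0 < S" using C by (meson divide_pos_pos less_trans zero_less_numeral)
    \<comment> \<open>The hypothesis covers \<open>k \<le> l\<close> only;
      \<open>h k l + h l k\<close> serves both orders, and each summand contributes at most
      \<open>8 * S\<close>.\<close>
    define h where "h k l = (if k \<le> l then 4 * (1/2) ^ (l - k) * \<mu> k else 0)" for k l :: nat
    have h0: "0 \<le> h k l" for k l using m0 by (simp add: h_def)
    have sum_h: "(\<Sum>k\<in>?K. \<Sum>l\<in>?K. h k l) \<le> 8 * S"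
    proof -
      have "(\<Sum>l\<in>?K. h k l) \<le> 8 * \<mu> k" if "k \<in> ?K" for k
      proof -
        have "(\<Sum>l\<in>?K. h k l) = (\<Sum>l\<in>{k..<N + n}. h k l)"
          using that by (intro sum.mono_neutral_right) (auto simp: h_def)
        also have "\<dots> = 4 * \<mu> k * (\<Sum>l\<in>{k..<N + n}. (1/2) ^ (l - k))"
          by (simp add: h_def sum_distrib_left mult_ac)
        also have "\<dots> \<le> 4 * \<mu> k * 2" using geo m0 by (intro mult_left_mono) auto
        finally show ?thesis by simp
      qed
      then have "(\<Sum>k\<in>?K. \<Sum>l\<in>?K. h k l) \<le> (\<Sum>k\<in>?K. 8 * \<mu> k)" by (rule sum_mono)
      then show ?thesis by (simp add: S_def sum_distrib_left)
    qed
    have pt: "measure lebesgue (E k \<inter> E l) \<le> C * \<mu> k * \<mu> l + (h k l + h l k)" for k l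
    proof (cases "k \<le> l")
      case True
      then have "h k l = 4 * (1/2) ^ (l - k) * \<mu> k" by (simp add: h_def)
      then show ?thesis using qi[OF True] h0[of l k] unfolding \<mu>_def by linarith
    next
      case False
      then have "l \<le> k" by simp
      then have "h l k = 4 * (1/2) ^ (k - l) * \<mu> l" by (simp add: h_def)
      moreover have "C * \<mu> k * \<mu> l = C * \<mu> l * \<mu> k" by simp
      ultimately show ?thesis
        using qi[OF \<open>l \<le> k\<close>, folded \<mu>_def] h0[of k l] by (subst Int_commute) linarith
    qed
    have "(\<Sum>k\<in>?K. \<Sum>l\<in>?K. measure lebesgue (E k \<inter> E l)) \<le> (\<Sum>k\<in>?K. \<Sum>l\<in>?K. C * \<mu> k * \<mu> l + (h k l + h l k))"
      by (intro sum_mono pt)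
    also have "\<dots> = C * (\<Sum>k\<in>?K. \<Sum>l\<in>?K. \<mu> k * \<mu> l) + ((\<Sum>k\<in>?K. \<Sum>l\<in>?K. h k l) + (\<Sum>k\<in>?K. \<Sum>l\<in>?K. h l k))"
      by (simp add: sum.distrib sum_distrib_left mult.assoc)
    also have "(\<Sum>k\<in>?K. \<Sum>l\<in>?K. h l k) = (\<Sum>k\<in>?K. \<Sum>l\<in>?K. h k l)" by (rule sum.swap)
    also have "(\<Sum>k\<in>?K. \<Sum>l\<in>?K. \<mu> k * \<mu> l) = S\<^sup>2" by (simp add: S_def power2_eq_square sum_product)
    finally have "(\<Sum>k\<in>?K. \<Sum>l\<in>?K. measure lebesgue (E k \<inter> E l)) \<le> C * S\<^sup>2 + 16 * S"
      using sum_h by linarith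
    also have "16 * S \<le> C * S\<^sup>2"
    proof -
      have "16 \<le> C * S" using S C by (simp add: field_simps)
      then have "16 * S \<le> C * S * S" using S0 by (intro mult_right_mono) auto
      then show ?thesis by (simp add: power2_eq_square)
    qed
    finally have T: "(\<Sum>k\<in>?K. \<Sum>l\<in>?K. measure lebesgue (E k \<inter> E l)) \<le> 2 * C * S\<^sup>2" by simp
    have "S\<^sup>2 \<le> measure lebesgue (\<Union>k\<in>?K. E k) * (\<Sum>k\<in>?K. \<Sum>l\<in>?K. measure lebesgue (E k \<inter> E l))"
      unfolding S_def \<mu>_def by (rule chung_erdos_inequality) (use E in auto)
    also have "\<dots> \<le> measure lebesgue (\<Union>k\<in>?K. E k) * (2 * C * S\<^sup>2)"
      using T by (intro mult_left_mono) auto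
    finally have "1 / (2 * C) \<le> measure lebesgue (\<Union>k\<in>?K. E k)"
      using S0 C by (simp add: field_simps)
    also have "\<dots> \<le> measure lebesgue (\<Union>k\<in>{N..}. E k)"
    proof (rule measure_mono_fmeasurable[OF _ _ U])
      show "(\<Union>k\<in>?K. E k) \<in> sets lebesgue" using E(1) by (intro fmeasurableD fmeasurable.finite_UN) auto
    qed auto
    finally show ?thesis .
  qed
  have "(\<lambda>N. measure lebesgue (\<Union>k\<in>{N..}. E k)) \<longlonglongrightarrow> measure lebesgue (\<Inter>N. \<Union>k\<in>{N..}. E k)"
  proof (rule Lim_measure_decseq)
    show "range (\<lambda>N. \<Union>k\<in>{N..}. E k) \<subseteq> sets lebesgue" using U by (auto dest: fmeasurableD)
    show "decseq (\<lambda>N. \<Union>k\<in>{N..}. E k)" by (intro decseq_SucI UN_mono) auto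
    show "emeasure lebesgue (\<Union>k\<in>{N..}. E k) \<noteq> \<infinity>" for N
      unfolding infinity_ennreal_def by (rule fmeasurableD2[OF U])
  qed
  then show "1 / (2 * C) \<le> measure lebesgue (\<Inter>N. \<Union>k\<in>{N..}. E k)"
    by (rule LIMSEQ_le_const) (use large in blast)
  show "(\<Inter>N. \<Union>k\<in>{N..}. E k) \<in> lmeasurable"
    by (rule fmeasurable_INT[of UNIV 0]) (use U U[of 0] in auto)
qed

section \<open>Full measure from a uniform lower density\<close>

text \<open>Vitali: disjoint balls inside an open set \<open>T\<close> slightly larger than the
  complement \<open>?S\<close> cover almost all of \<open>?S\<close>. Each contains a proportion
  \<open>\<kappa>\<close> of \<open>A\<close>, which lies in the small set \<open>T - ?S\<close>, so
  the balls have small total measure.\<close>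

lemma null_sets_Diff_of_uniform_density:
  fixes A :: "real set"
  assumes A: "A \<in> sets lebesgue" and \<kappa>: "0 < \<kappa>"
    and dens: "\<And>c d. a \<le> c \<Longrightarrow> c < d \<Longrightarrow> d \<le> b \<Longrightarrow> \<kappa> * (d - c) \<le> measure lebesgue (A \<inter> {c..d})"
  shows "{a<..<b} - A \<in> null_sets lebesgue"
proof -
  let ?S = "{a<..<b} - A"
  have Slm: "?S \<in> lmeasurable"
    by (rule bounded_set_imp_lmeasurable[OF bounded_subset[OF bounded_closed_interval[of a b]]]) (use A in auto)
  have "measure lebesgue ?S \<le> 0"
  proof (rule field_le_epsilon)
    fix e :: real assume "0 < e"
    then have "0 < e * \<kappa>" using \<kappa> by simp
    then obtain T where T: "open T" "?S \<subseteq> T" "T - ?S \<in> lmeasurable" "emeasure lebesgue (T - ?S) < ennreal (e * \<kappa>)"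
      using sets_lebesgue_outer_open[OF fmeasurableD[OF Slm]] by blast
    have mT: "measure lebesgue (T - ?S) < e * \<kappa>"
      using T \<open>0 < e * \<kappa>\<close> by (simp add: emeasure_eq_measure2 ennreal_less_iff)
    define K where "K = {(x, r). 0 < r \<and> cball x r \<subseteq> T \<inter> {a<..<b}}"
    have K: "0 < snd i" "cball (fst i) (snd i) \<subseteq> T" "cball (fst i) (snd i) \<subseteq> {a<..<b}" if "i \<in> K" for i
      using that unfolding K_def by auto
    obtain C where C: "countable C" "C \<subseteq> K"
      "pairwise (\<lambda>i j. disjnt (cball (fst i) (snd i)) (cball (fst j) (snd j))) C"
      "negligible (?S - (\<Union>i \<in> C. cball (fst i) (snd i)))"
    proof (rule Vitali_covering_theorem_cballs[of K snd ?S fst])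
      show "0 < snd i" if "i \<in> K" for i using K(1)[OF that] .
      fix x d :: real assume x: "x \<in> ?S" and d: "0 < d"
      have "open (T \<inter> {a<..<b})" "x \<in> T \<inter> {a<..<b}" using T x by auto
      then obtain r where r: "0 < r" "cball x r \<subseteq> T \<inter> {a<..<b}" using open_contains_cball by blast
      have "cball x (min r (d/2)) \<subseteq> cball x r" by auto
      then have "(x, min r (d/2)) \<in> K" using r d unfolding K_def by auto
      then show "\<exists>i. i \<in> K \<and> x \<in> cball (fst i) (snd i) \<and> snd i < d"
        using r d by (intro exI[of _ "(x, min r (d/2))"]) auto
    qed
    let ?B = "\<lambda>i::real \<times> real. cball (fst i) (snd i)"
    have Blm: "?B i \<in> lmeasurable" for i by simp
    have fin: "measure lebesgue (\<Union>i\<in>F. ?B i) \<le> e" if F: "F \<subseteq> C" "finite F" for F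
    proof -
      have FK: "F \<subseteq> K" using F C by blast
      have dens': "\<kappa> * measure lebesgue (?B i) \<le> measure lebesgue (A \<inter> ?B i)" if "i \<in> F" for i
      proof -
        have i: "0 < snd i" "?B i \<subseteq> {a<..<b}" using K that FK by blast+
        have B: "?B i = {fst i - snd i..fst i + snd i}" by (simp add: cball_eq_atLeastAtMost)
        have "fst i - snd i \<in> ?B i" "fst i + snd i \<in> ?B i" using i(1) unfolding B by auto
        then have "fst i - snd i \<in> {a<..<b}" "fst i + snd i \<in> {a<..<b}" using i(2) by blast+
        then show ?thesis
          using dens[of "fst i - snd i" "fst i + snd i"] i(1) unfolding B by simp
      qed
      have ABlm: "A \<inter> ?B i \<in> lmeasurable" for i
        using fmeasurable_Int_fmeasurable[OF Blm A] by (simp add: Int_commute)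
      have disj: "disjoint_family_on (\<lambda>i. A \<inter> ?B i) F"
        using C(3) F(1) unfolding disjoint_family_on_def pairwise_def disjnt_def by blast
      have "\<kappa> * measure lebesgue (\<Union>i\<in>F. ?B i) \<le> \<kappa> * (\<Sum>i\<in>F. measure lebesgue (?B i))"
        using \<kappa> F(2) by (intro mult_left_mono measure_UNION_le) auto
      also have "\<dots> \<le> (\<Sum>i\<in>F. measure lebesgue (A \<inter> ?B i))"
        unfolding sum_distrib_left by (rule sum_mono[OF dens'])
      also have "\<dots> = measure lebesgue (\<Union>i\<in>F. A \<inter> ?B i)"
      proof (rule measure_finite_Union[symmetric, OF F(2) _ disj])
        show "(\<lambda>i. A \<inter> ?B i) ` F \<subseteq> sets lebesgue" using fmeasurableD[OF ABlm] by blast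
        show "emeasure lebesgue (A \<inter> ?B i) \<noteq> \<infinity>" for i
          unfolding infinity_ennreal_def by (rule fmeasurableD2[OF ABlm])
      qed
      also have "\<dots> \<le> measure lebesgue (T - ?S)"
      proof (rule measure_mono_fmeasurable[OF _ _ T(3)])
        show "(\<Union>i\<in>F. A \<inter> ?B i) \<subseteq> T - ?S" using K FK by blast
        show "(\<Union>i\<in>F. A \<inter> ?B i) \<in> sets lebesgue" using F(2) fmeasurableD[OF ABlm] by blast
      qed
      finally have "\<kappa> * measure lebesgue (\<Union>i\<in>F. ?B i) \<le> \<kappa> * e" using mT by (simp add: mult.commute)
      then show ?thesis using \<kappa> by (rule mult_left_le_imp_le)
    qed
    have UB: "(\<Union>i\<in>C. ?B i) \<in> lmeasurable" "measure lebesgue (\<Union>i\<in>C. ?B i) \<le> e"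
      by (rule fmeasurable_UN_bound[OF C(1) Blm fin] measure_UN_bound[OF C(1) Blm fin]; assumption)+
    have "measure lebesgue ?S \<le> measure lebesgue ((\<Union>i\<in>C. ?B i) \<union> (?S - (\<Union>i\<in>C. ?B i)))"
      by (rule measure_mono_fmeasurable[OF _ fmeasurableD[OF Slm]
            fmeasurable.Un[OF UB(1) fmeasurable_Diff[OF Slm fmeasurableD[OF UB(1)]]]]) blast
    also have "\<dots> = measure lebesgue (\<Union>i\<in>C. ?B i)"
      using C(4) UB(1) by (intro measure_Un_null_set fmeasurableD) (simp_all add: negligible_iff_null_sets)
    finally show "measure lebesgue ?S \<le> 0 + e" using UB(2) by simp
  qed
  then have "measure lebesgue ?S = 0" by (simp add: order_antisym)
  then show ?thesis using Slm by (simp add: null_sets_def fmeasurableD emeasure_eq_measure2)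
qed

section \<open>Approximable points\<close>

lemma dist_int_less_iff: "dist_int y < t \<longleftrightarrow> (\<exists>p::int. \<bar>y - p\<bar> < t)"
  unfolding dist_int_eq_round using round_diff_minimal[of y] by (meson order_le_less_trans)

lemma simultaneously_approximable_iff:
  "simultaneously_approximable \<psi> (x, y) \<longleftrightarrow>
    (\<forall>N. \<exists>q\<ge>N. 0 < q \<and> (\<exists>i::int \<times> int. \<bar>real q * x - fst i\<bar> < \<psi> (real q) \<and> \<bar>real q * y - snd i\<bar> < \<psi> (real q)))"
  unfolding simultaneously_approximable_def infinite_nat_iff_unbounded_le
  by (simp add: dist_int_less_iff)

lemma approximable_lmeasurable:
  assumes "continuous_on {c..d} f"
  shows "{x\<in>{c..d}. simultaneously_approximable \<psi> (x, f x)} \<in> lmeasurable" (is "?A \<in> _")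
proof -
  define W where "W q = {x\<in>{c..d}. \<exists>i::int \<times> int. 0 < q \<and> \<bar>real q * x - fst i\<bar> < \<psi> (real q) \<and>
      \<bar>real q * f x - snd i\<bar> < \<psi> (real q)}" for q :: nat
  have W: "W q \<in> lmeasurable" for q
    unfolding W_def by (rule lmeasurable_Collect_continuous_less; intro continuous_intros assms)
  have "?A = {c..d} \<inter> (\<Inter>N. \<Union>q\<in>{N..}. W q)"
    unfolding simultaneously_approximable_iff W_def by (simp add: set_eq_iff Bex_def) blast
  also have "\<dots> \<in> sets lebesgue"
    by (intro sets.Int sets.countable_INT' sets.countable_UN') (use fmeasurableD[OF W] in auto)
  finally show ?thesis
    by (rule bounded_set_imp_lmeasurable[OF bounded_subset[OF bounded_closed_interval[of c d]], rotated]) auto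
qed

lemma not_summable_min_one:
  fixes v :: "nat \<Rightarrow> real"
  assumes "\<not> summable v" "\<And>k. 0 \<le> v k"
  shows "\<not> summable (\<lambda>k. min (v k) 1)"
proof
  assume s: "summable (\<lambda>k. min (v k) 1)"
  then have "(\<lambda>k. min (v k) 1) \<longlonglongrightarrow> 0" by (rule summable_LIMSEQ_zero)
  then have "\<forall>\<^sub>F k in sequentially. min (v k) 1 < 1" by (rule order_tendstoD) simp
  then have "\<forall>\<^sub>F k in sequentially. min (v k) 1 = v k" by eventually_elim auto
  then show False using s assms(1) summable_cong[of "\<lambda>k. min (v k) 1" v] by blast
qed

text \<open>The discarded terms are finitely many initial ones and terms below
  \<open>1 / (k + 1)\<^sup>2\<close>, which sum to a finite value.\<close>

lemma not_summable_indicator: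
  fixes u :: "nat \<Rightarrow> real"
  assumes "\<not> summable u" "\<And>k. 0 \<le> u k"
  shows "\<not> summable (\<lambda>k. if k0 \<le> k \<and> 1 / (real k + 1)\<^sup>2 \<le> u k then u k else 0)" (is "\<not> summable ?h")
proof
  assume h: "summable ?h"
  have "summable (\<lambda>k. inverse ((real (Suc k))\<^sup>2))"
    using inverse_power_summable[OF order_refl, where 'a = real] by (subst summable_Suc_iff)
  then have "summable (\<lambda>k. 1 / (real k + 1)\<^sup>2)" by (simp add: inverse_eq_divide add.commute)
  then have s: "summable (\<lambda>k. ?h k + 1 / (real k + 1)\<^sup>2)" using h by (intro summable_add)
  have "\<forall>\<^sub>F k in sequentially. norm (u k) \<le> ?h k + 1 / (real k + 1)\<^sup>2"
    using eventually_ge_at_top[of k0] by eventually_elim (use assms(2) in auto)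
  then have "summable u" using s by (rule summable_comparison_test_ev)
  then show False using assms(1) by blast
qed

lemma two_power_over_poly_at_top:
  "filterlim (\<lambda>k::nat. 2^k / (real k + 1)^6 :: real) at_top sequentially"
  by real_asymp

text \<open>The points at scale \<open>2^k\<close> come from \<open>n\<close> about
  \<open>5 * M / \<delta> k\<close> and \<open>m\<close> about \<open>2^k / n\<close>. The
  proportion 1/24 results from \<open>C = 12 / L\<close>; it depends neither on the interval nor on
  \<open>M\<close>, as the density argument requires.\<close>

lemma measure_approximable_ge:
  fixes f g :: "real \<Rightarrow> real" and \<psi> :: "real \<Rightarrow> real"
  assumes quad: "quad_pair M f g a b" and ab: "a < b"
    and \<psi>: "approximating_function \<psi>" and div: "\<not> summable (\<lambda>h::nat. (\<psi> (real (Suc h)))\<^sup>2)"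
  shows "(b - a) / 24 \<le> measure lebesgue {x\<in>{a..b}. simultaneously_approximable \<psi> (x, f x)}"
proof -
  have M1: "1 \<le> M" using quad unfolding quad_pair_def by blast
  have \<psi>0: "0 < \<psi> x" if "0 < x" for x using \<psi> that unfolding approximating_function_def by blast
  have \<psi>mono: "\<psi> y \<le> \<psi> x" if "0 < x" "x \<le> y" for x y
    using \<psi> that unfolding approximating_function_def by (auto intro: monotone_onD[of "{0<..}" "(\<le>)" "(\<ge>)" \<psi>])
  txt \<open>Truncating \<open>\<psi>(2\<^sup>k)\<close> at \<open>2\<^sup>-\<^sup>k\<^sup>/\<^sup>2\<close> makes the neighbourhoods at one scale disjoint (\<open>m k \<le> n k\<close>).\<close>
  define \<delta> where "\<delta> k = min (\<psi> (2^k)) (1 / sqrt (2^k))" for k :: nat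
  have d0: "0 < \<delta> k" for k using \<psi>0[of "2^k"] by (simp add: \<delta>_def)
  have d1: "\<delta> k \<le> 1" for k
  proof -
    have "1 / sqrt (2^k) \<le> 1" by simp
    then show ?thesis unfolding \<delta>_def by linarith
  qed
  have danti: "\<delta> l \<le> \<delta> k" if "k \<le> l" for k l
  proof -
    have "(2::real)^k \<le> 2^l" using that by simp
    from \<psi>mono[OF _ this] have "\<psi> (2^l) \<le> \<psi> (2^k)" by simp
    moreover have "1 / sqrt (2^l) \<le> 1 / sqrt (2^k)" using that by (intro divide_left_mono) auto
    ultimately show ?thesis unfolding \<delta>_def by linarith
  qed
  define u where "u k = 2^k * (\<delta> k)\<^sup>2" for k :: nat
  have u0: "0 \<le> u k" for k by (simp add: u_def)
  have u_eq: "u k = min (2^k * (\<psi> (2^k))\<^sup>2) 1" for k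
  proof -
    have sq: "2^k * (1 / sqrt (2^k))\<^sup>2 = (1::real)" by (simp add: power_divide)
    have p: "0 < \<psi> (2^k)" using \<psi>0 by simp
    show ?thesis
    proof (cases "\<psi> (2^k) \<le> 1 / sqrt (2^k)")
      case True
      then have "(\<psi> (2^k))\<^sup>2 \<le> (1 / sqrt (2^k))\<^sup>2" using p by (intro power_mono) auto
      then have "2^k * (\<psi> (2^k))\<^sup>2 \<le> 2^k * (1 / sqrt (2^k))\<^sup>2" by (intro mult_left_mono) auto
      then show ?thesis using True unfolding u_def \<delta>_def sq by simp
    next
      case False
      then have "(1 / sqrt (2^k))\<^sup>2 \<le> (\<psi> (2^k))\<^sup>2" by (intro power_mono) auto
      then have "2^k * (1 / sqrt (2^k))\<^sup>2 \<le> 2^k * (\<psi> (2^k))\<^sup>2" by (intro mult_left_mono) auto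
      then show ?thesis using False sq unfolding u_def \<delta>_def by (simp add: min_def)
    qed
  qed
  have u1: "u k \<le> 1" for k by (simp add: u_eq)
  \<comment> \<open>Cauchy condensation transfers the divergence of the series to dyadic scales, and
    truncating the terms at 1 preserves it.\<close>
  have "\<not> summable u"
  proof -
    define v where "v h = (\<psi> (real h))\<^sup>2" for h :: nat
    have "\<not> summable v" using div by (subst summable_Suc_iff[symmetric]) (simp add: v_def)
    moreover have "v (Suc h) \<le> v h" if "0 < h" for h
      unfolding v_def using that \<psi>0[of "real (Suc h)"] by (intro power_mono \<psi>mono) auto
    then have "summable v \<longleftrightarrow> summable (\<lambda>k. 2^k * v (2^k))"
      by (intro condensation_test) (auto simp: v_def)
    ultimately have "\<not> summable (\<lambda>k. 2^k * (\<psi> (2^k))\<^sup>2)" by (simp add: v_def)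
    then show ?thesis using not_summable_min_one[of "\<lambda>k. 2^k * (\<psi> (2^k))\<^sup>2"] by (simp add: u_eq[abs_def])
  qed
  define \<kappa> where "\<kappa> = 1 / (1024 * M\<^sup>2)\<^sup>2"
  have k0: "0 < \<kappa>" using M1 by (simp add: \<kappa>_def)
  define L where "L = b - a"
  have L0: "0 < L" using ab by (simp add: L_def)
  obtain m0 :: real where m0: "\<And>m n :: nat. m0 \<le> m \<Longrightarrow> m \<le> n \<Longrightarrow> M * n \<le> \<kappa> * (real m)\<^sup>2 \<Longrightarrow>
    0 < m \<and> (\<exists>D. finite D \<and> separated (1 / (\<kappa>^3 * m * (real m * real n))) D \<and>
      b - a \<le> real (card D) * (24 * (1 / (\<kappa>^3 * m * (real m * real n)))) \<and>
      (\<forall>x\<in>nbhds D (1 / (n * (real m * real n))). x \<in> {a..b} \<and>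
         (\<exists>(q::int) (p::int) t::int. 0 < q \<and> \<kappa>^3 * (real m * real n) \<le> q \<and> q \<le> real m * real n \<and>
            \<bar>q * x - p\<bar> \<le> 1 / n \<and> \<bar>q * f x - t\<bar> \<le> 4 * M / n)))"
    by (rule exists_separated_near_curve[OF quad ab, folded \<kappa>_def]) (rule that)
  \<comment> \<open>The first summand secures \<open>m0 \<le> m k\<close>, the second
    \<open>M * n k \<le> \<kappa> * (m k)^2\<close>. Here \<open>864 = 6 * 12^2\<close> comes from
    \<open>n k \<le> 6 * M / \<delta> k\<close> and
    \<open>m k \<ge> 2^k * \<delta> k / (12 * M)\<close>.\<close>
  define B where "B = 12 * M * (\<bar>m0\<bar> + 1) + 864 * M^4 / \<kappa>"
  have B: "12 * M * (\<bar>m0\<bar> + 1) \<le> B" "864 * M^4 / \<kappa> \<le> B" "0 \<le> B" using M1 k0 by (simp_all add: B_def)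
  have "\<forall>\<^sub>F k::nat in sequentially. B\<^sup>2 \<le> 2^k / (real k + 1)^6"
    using two_power_over_poly_at_top by (simp only: filterlim_at_top)
  then obtain K0 where K0: "\<And>k. K0 \<le> k \<Longrightarrow> B\<^sup>2 \<le> 2^k / (real k + 1)^6"
    unfolding eventually_sequentially by blast
  define G where "G = {k. K0 \<le> k \<and> 1 / (real k + 1)\<^sup>2 \<le> u k}"
  \<comment> \<open>With 5 in place of 4, \<open>4 * M / n k\<close> is strictly below
    \<open>\<delta> k\<close>.\<close>
  define n where "n k = nat \<lceil>5 * M / \<delta> k\<rceil>" for k
  define m where "m k = 2^k div n k" for k
  define Q where "Q k = real (m k) * real (n k)" for k
  define r where "r k = 1 / (\<kappa>^3 * m k * Q k)" for k
  define w where "w k = 1 / (n k * Q k)" for k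
  have n_ge: "5 * M / \<delta> k \<le> n k" for k unfolding n_def by linarith
  have n_le: "n k \<le> 6 * M / \<delta> k" for k
  proof -
    have "0 < 5 * M / \<delta> k" using M1 d0 by simp
    then have "n k \<le> 5 * M / \<delta> k + 1" unfolding n_def by linarith
    also have "1 \<le> M / \<delta> k" using M1 d1[of k] d0[of k] by (simp add: le_divide_eq)
    finally show ?thesis by simp
  qed
  have n0: "0 < n k" for k
  proof -
    have "0 < 5 * M / \<delta> k" using M1 d0 by simp
    then have "0 < real (n k)" using n_ge[of k] by linarith
    then show ?thesis by simp
  qed
  have Q_le: "Q k \<le> 2^k" for k
  proof -
    have "m k * n k \<le> 2^k" unfolding m_def by (rule div_times_less_eq_dividend)
    then have "real (m k * n k) \<le> real (2^k)" by (simp only: of_nat_le_iff)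
    then show ?thesis by (simp add: Q_def)
  qed
  have Q_gt: "2^k < Q k + n k" for k
  proof -
    have "2^k < n k + m k * n k" unfolding m_def using n0 by (rule dividend_less_div_times)
    then have "real (2^k) < real (n k + m k * n k)" by (simp only: of_nat_less_iff)
    then show ?thesis by (simp add: Q_def)
  qed
  \<comment> \<open>Squaring gives \<open>2^k * (u k)^3\<close>, and
    \<open>u k \<ge> 1 / (k + 1)\<^sup>2\<close> on \<open>G\<close>; this explains the sixth power
    in the choice of \<open>K0\<close>.\<close>
  have params: "12 * M * (\<bar>m0\<bar> + 1) \<le> 2^k * \<delta> k" "864 * M^4 / \<kappa> \<le> 2^k * \<delta> k * u k" if "k \<in> G" for k
  proof -
    have k: "1 / (real k + 1)\<^sup>2 \<le> u k" "B\<^sup>2 \<le> 2^k / (real k + 1)^6" using that K0 by (auto simp: G_def)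
    have P2: "(2^k * \<delta> k)\<^sup>2 = 2^k * u k" by (simp add: u_def power2_eq_square)
    have "(1 / (real k + 1)\<^sup>2)^3 \<le> (u k)^3" using k by (intro power_mono) auto
    then have "2^k * (1 / (real k + 1)\<^sup>2)^3 \<le> 2^k * (u k)^3" by (intro mult_left_mono) auto
    then have "B\<^sup>2 \<le> 2^k * (u k)^3" using k(2) by (simp add: power_divide flip: power_mult)
    moreover have "(2^k * \<delta> k * u k)\<^sup>2 = 2^k * (u k)^3"
      unfolding power_mult_distrib P2[unfolded power_mult_distrib] by (simp add: power3_eq_cube power2_eq_square)
    ultimately have "B \<le> 2^k * \<delta> k * u k"
      using u0[of k] d0[of k] by (intro power2_le_imp_le[of B]) auto
    moreover have "2^k * \<delta> k * u k \<le> 2^k * \<delta> k" using mult_left_mono[OF u1[of k], of "2^k * \<delta> k"] d0[of k] by simp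
    ultimately show "12 * M * (\<bar>m0\<bar> + 1) \<le> 2^k * \<delta> k" "864 * M^4 / \<kappa> \<le> 2^k * \<delta> k * u k" using B by linarith+
  qed
  \<comment> \<open>Rounding down loses less than 1, which is at most half of
    \<open>2^k * \<delta> k / (6 * M)\<close>.\<close>
  have m_ge: "2^k * \<delta> k / (12 * M) \<le> m k" if "k \<in> G" for k
  proof -
    have P: "12 * M \<le> 2^k * \<delta> k"
    proof -
      have "12 * M * 1 \<le> 12 * M * (\<bar>m0\<bar> + 1)" using M1 by (intro mult_left_mono) auto
      then show ?thesis using params(1)[OF that] by linarith
    qed
    have "2^k < (m k + 1) * real (n k)" using Q_gt[of k] by (simp add: Q_def algebra_simps)
    also have "\<dots> \<le> (m k + 1) * (6 * M / \<delta> k)" using n_le by (intro mult_left_mono) auto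
    finally have "2^k * \<delta> k / (6 * M) < m k + 1" using d0[of k] M1 by (simp add: field_simps)
    moreover have "1 \<le> 2^k * \<delta> k / (12 * M)" using P M1 by (simp add: le_divide_eq)
    moreover have "2^k * \<delta> k / (6 * M) = 2 * (2^k * \<delta> k / (12 * M))" by simp
    ultimately show ?thesis by linarith
  qed
  have good: "m0 \<le> m k" "m k \<le> n k" "M * n k \<le> \<kappa> * (real (m k))\<^sup>2" if "k \<in> G" for k
  proof -
    have "(12 * M * (\<bar>m0\<bar> + 1)) / (12 * M) \<le> 2^k * \<delta> k / (12 * M)"
      using params(1)[OF that] M1 by (intro divide_right_mono) auto
    moreover have "(12 * M * (\<bar>m0\<bar> + 1)) / (12 * M) = \<bar>m0\<bar> + 1" using M1 by simp
    ultimately show "m0 \<le> m k" using m_ge[OF that] by linarith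
    have "real (m k) * real (n k) \<le> 2^k" using Q_le by (simp add: Q_def)
    also have "2^k \<le> (real (n k))\<^sup>2"
    proof -
      have "2^k * (\<delta> k)\<^sup>2 \<le> 1" using u1 by (simp add: u_def)
      also have "1 \<le> (5 * M)\<^sup>2" using M1 by (intro one_le_power) auto
      finally have "2^k \<le> (5 * M / \<delta> k)\<^sup>2" using d0[of k] by (simp add: power_divide le_divide_eq)
      also have "\<dots> \<le> (real (n k))\<^sup>2" using n_ge M1 d0[of k] by (intro power_mono) auto
      finally show ?thesis .
    qed
    finally show "m k \<le> n k" using n0[of k] by (simp add: power2_eq_square)
    have "M * n k \<le> M * (6 * M / \<delta> k)" using n_le M1 by (intro mult_left_mono) auto
    also have "\<dots> \<le> \<kappa> * (2^k * \<delta> k / (12 * M))\<^sup>2"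
    proof -
      have "864 * M^4 \<le> \<kappa> * (2^k * \<delta> k * u k)" using params(2)[OF that] k0 by (simp add: divide_le_eq mult.commute)
      also have "\<dots> = \<kappa> * (2^k * \<delta> k)\<^sup>2 * \<delta> k" by (simp add: u_def power2_eq_square)
      finally have "864 * M^4 / (144 * M\<^sup>2 * \<delta> k) \<le> \<kappa> * (2^k * \<delta> k)\<^sup>2 * \<delta> k / (144 * M\<^sup>2 * \<delta> k)"
        using M1 d0[of k] by (intro divide_right_mono) auto
      moreover have "864 * M^4 / (144 * M\<^sup>2 * \<delta> k) = M * (6 * M / \<delta> k)"
        using M1 d0[of k] by (simp add: field_simps power2_eq_square power4_eq_xxxx)
      moreover have "\<kappa> * (2^k * \<delta> k)\<^sup>2 * \<delta> k / (144 * M\<^sup>2 * \<delta> k) = \<kappa> * (2^k * \<delta> k / (12 * M))\<^sup>2"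
        using M1 d0[of k] by (simp add: field_simps power2_eq_square)
      ultimately show ?thesis by simp
    qed
    also have "\<dots> \<le> \<kappa> * (real (m k))\<^sup>2"
      using m_ge[OF that] k0 d0[of k] M1 by (intro mult_left_mono power_mono) auto
    finally show "M * n k \<le> \<kappa> * (real (m k))\<^sup>2" .
  qed
  define PD where "PD k D \<longleftrightarrow> finite D \<and> separated (r k) D \<and> L \<le> real (card D) * (24 * r k) \<and>
      (\<forall>x\<in>nbhds D (w k). x \<in> {a..b} \<and>
         (\<exists>(q::int) (p::int) t::int. 0 < q \<and> \<kappa>^3 * Q k \<le> q \<and> q \<le> Q k \<and>
            \<bar>q * x - p\<bar> \<le> 1 / n k \<and> \<bar>q * f x - t\<bar> \<le> 4 * M / n k))" for k D
  have "\<exists>D. PD k D" if "k \<in> G" for k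
    using m0[OF good[OF that]] unfolding PD_def r_def w_def Q_def L_def by (rule conjunct2)
  then obtain D where D: "\<And>k. k \<in> G \<Longrightarrow> PD k (D k)" by metis
  have m_pos: "0 < m k" if "k \<in> G" for k using m0[OF good[OF that]] by (rule conjunct1)
  have Q0: "0 < Q k" if "k \<in> G" for k using m_pos[OF that] n0[of k] by (simp add: Q_def)
  have r0: "0 < r k" "0 < w k" if "k \<in> G" for k
    using Q0[OF that] m_pos[OF that] n0[of k] k0 by (simp_all add: r_def w_def)
  have k1: "\<kappa>^3 \<le> 1"
  proof -
    have "1 \<le> 1024 * M\<^sup>2" using M1 one_le_power[of M 2] by linarith
    then have "1 \<le> (1024 * M\<^sup>2)\<^sup>2" by (rule one_le_power)
    moreover have "1 / A \<le> 1" if "1 \<le> A" for A :: real using that by simp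
    ultimately have "\<kappa> \<le> 1" unfolding \<kappa>_def by blast
    then show ?thesis using k0 by (intro power_le_one) auto
  qed
  have wr: "w k \<le> r k" if "k \<in> G" for k
  proof -
    have "\<kappa>^3 * m k \<le> 1 * real (n k)" using k0 k1 good(2)[OF that] by (intro mult_mono) auto
    then have "\<kappa>^3 * m k * Q k \<le> n k * Q k" using Q0[OF that] by (intro mult_right_mono) auto
    then show ?thesis unfolding r_def w_def
      using k0 m_pos[OF that] Q0[OF that] n0[of k] by (intro divide_left_mono) auto
  qed
  have Q_half: "2^k \<le> 2 * Q k" if "k \<in> G" for k
  proof -
    have "1 * real (n k) \<le> real (m k) * real (n k)" using m_pos[OF that] by (intro mult_right_mono) auto
    then have "real (n k) \<le> Q k" by (simp add: Q_def)
    then show ?thesis using Q_gt[of k] by linarith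
  qed
  define E where "E k = (if k \<in> G then nbhds (D k) (w k) else {})" for k
  define \<mu> where "\<mu> k = measure lebesgue (E k)" for k
  have Elm: "E k \<in> lmeasurable" for k
    using D unfolding E_def PD_def by (auto intro: nbhds_lmeasurable)
  have Esub: "E k \<subseteq> {a..b}" for k using D unfolding E_def PD_def by auto
  \<comment> \<open>By the cardinality bound, \<open>\<mu> k\<close> is at least
    \<open>L / 12\<close> times \<open>w k / r k = \<kappa>^3 * m k / n k\<close>, and
    \<open>m k / n k \<ge> u k / (72 * M\<^sup>2)\<close>.\<close>
  have mu: "L * \<kappa>^3 / (864 * M\<^sup>2) * u k \<le> \<mu> k" if "k \<in> G" for k
  proof -
    have PD: "finite (D k)" "separated (r k) (D k)" "L \<le> real (card (D k)) * (24 * r k)"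
      using D[OF that] unfolding PD_def by blast+
    have mu: "\<mu> k = real (card (D k)) * (2 * w k)"
      unfolding \<mu>_def E_def using that measure_nbhds[OF PD(1,2) wr[OF that]] r0[OF that] by simp
    have "L * (w k / (12 * r k)) \<le> real (card (D k)) * (24 * r k) * (w k / (12 * r k))"
      using PD(3) r0[OF that] by (intro mult_right_mono) auto
    also have "\<dots> = \<mu> k" unfolding mu using r0[OF that] by simp
    finally have 1: "L * (w k / (12 * r k)) \<le> \<mu> k" .
    have eq: "w k / r k = \<kappa>^3 * m k / n k"
      unfolding w_def r_def using Q0[OF that] n0[of k] by simp
    have "L * (w k / (12 * r k)) = L / 12 * (w k / r k)" by simp
    then have 2: "L * (w k / (12 * r k)) = L * \<kappa>^3 / 12 * (m k / n k)" unfolding eq by simp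
    have "(2^k * \<delta> k / (12 * M)) / (6 * M / \<delta> k) \<le> m k / n k"
      using m_ge[OF that] n_le[of k] n0[of k] d0[of k] M1 by (intro frac_le) auto
    moreover have "(2^k * \<delta> k / (12 * M)) / (6 * M / \<delta> k) = u k / (72 * M\<^sup>2)"
      by (simp add: u_def power2_eq_square)
    ultimately have "u k / (72 * M\<^sup>2) \<le> m k / n k" by simp
    then have "L * \<kappa>^3 / 12 * (u k / (72 * M\<^sup>2)) \<le> L * \<kappa>^3 / 12 * (m k / n k)"
      using L0 k0 by (intro mult_left_mono) auto
    then show ?thesis using 1 2 by simp
  qed
  have Ediv: "\<not> summable \<mu>"
  proof
    assume s: "summable \<mu>"
    define C where "C = L * \<kappa>^3 / (864 * M\<^sup>2)"
    have C0: "0 < C" using L0 k0 M1 by (simp add: C_def)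
    have "summable (\<lambda>k. if K0 \<le> k \<and> 1 / (real k + 1)\<^sup>2 \<le> u k then u k else 0)"
    proof (rule summable_comparison_test')
      show "summable (\<lambda>k. 1 / C * \<mu> k)" using s by (rule summable_mult)
      show "norm (if K0 \<le> k \<and> 1 / (real k + 1)\<^sup>2 \<le> u k then u k else 0) \<le> 1 / C * \<mu> k" for k
      proof (cases "k \<in> G")
        case True
        then have "C * u k \<le> \<mu> k" using mu unfolding C_def by blast
        then have "u k \<le> 1 / C * \<mu> k" using C0 by (simp add: field_simps)
        then show ?thesis using True u0[of k] by (simp add: G_def)
      next
        case False
        have "0 \<le> 1 / C * \<mu> k" using C0 by (simp add: \<mu>_def)
        then show ?thesis using False by (auto simp: G_def)
      qed
    qed
    then show False using not_summable_indicator[OF \<open>\<not> summable u\<close> u0] by blast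
  qed
  have qi: "measure lebesgue (E k \<inter> E l)
      \<le> 12 / L * measure lebesgue (E k) * measure lebesgue (E l) + 4 * (1/2) ^ (l - k) * measure lebesgue (E k)"
    if "k \<le> l" for k l
  proof (cases "k \<in> G \<and> l \<in> G")
    case True
    then have k: "k \<in> G" and l: "l \<in> G" by auto
    have PDk: "finite (D k)" "separated (r k) (D k)" "L \<le> real (card (D k)) * (24 * r k)"
      using D[OF k] unfolding PD_def by blast+
    have PDl: "finite (D l)" "separated (r l) (D l)" "L \<le> real (card (D l)) * (24 * r l)"
      using D[OF l] unfolding PD_def by blast+
    have Ek: "E k = nbhds (D k) (w k)" "E l = nbhds (D l) (w l)" using k l by (auto simp: E_def)
    have main: "measure lebesgue (E k \<inter> E l) \<le> 12 / L * \<mu> k * \<mu> l + 2 * \<mu> k * (w l / w k)"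
      using measure_nbhds_Int_le[OF PDk(1,2) r0(2)[OF k] wr[OF k] r0(1)[OF k] PDk(3) L0
          PDl(1,2) r0(2)[OF l] wr[OF l] r0(1)[OF l] PDl(3)]
      unfolding \<mu>_def Ek .
    \<comment> \<open>The geometric decay: \<open>n\<close> is nondecreasing because
      \<open>\<delta>\<close> is antitone, and \<open>Q\<close> agrees with the dyadic scale up to a
      factor 2.\<close>
    have "w l / w k = (n k * Q k) / (n l * Q l)" unfolding w_def using Q0[OF k] n0[of k] by simp
    also have "\<dots> \<le> (real (n l) * 2^k) / (real (n l) * (2^l / 2))"
    proof (rule frac_le)
      have "5 * M / \<delta> k \<le> 5 * M / \<delta> l" using danti[OF that] d0 M1 by (intro divide_left_mono) auto
      then have "n k \<le> n l" unfolding n_def by (intro nat_mono ceiling_mono)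
      then show "real (n k) * Q k \<le> real (n l) * 2^k" using Q_le Q0[OF k] by (intro mult_mono) auto
      have "2^l / 2 \<le> Q l" using Q_half[OF l] by simp
      then show "real (n l) * (2^l / 2) \<le> real (n l) * Q l" by (intro mult_left_mono) auto
    qed (use n0 in auto)
    also have "\<dots> = 2 * (2^k / 2^l)" using n0[of l] by simp
    also have "(2::real)^k / 2^l = (1/2)^(l - k)"
      using that by (simp add: power_divide power_diff)
    finally have "2 * \<mu> k * (w l / w k) \<le> 2 * \<mu> k * (2 * (1/2)^(l - k))"
      by (intro mult_left_mono) (simp_all add: \<mu>_def)
    moreover have "2 * \<mu> k * (2 * (1/2)^(l - k)) = 4 * (1/2)^(l - k) * \<mu> k" by simp
    ultimately show ?thesis using main unfolding \<mu>_def by linarith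
  next
    case False
    then have "E k \<inter> E l = {}" by (auto simp: E_def)
    then show ?thesis using L0 by simp
  qed
  have sub: "(\<Inter>N. \<Union>k\<in>{N..}. E k) \<subseteq> {x\<in>{a..b}. simultaneously_approximable \<psi> (x, f x)}"
  proof
    fix x assume x: "x \<in> (\<Inter>N. \<Union>k\<in>{N..}. E k)"
    have xk: "\<exists>k\<ge>N. x \<in> E k" for N using x by blast
    have "simultaneously_approximable \<psi> (x, f x)"
      unfolding simultaneously_approximable_iff
    proof
      fix N :: nat
      \<comment> \<open>The lower bound \<open>\<kappa>^3 * Q k \<le> q\<close> sends the
        denominators to infinity with \<open>k\<close>, so infinitely many \<open>q\<close>
        occur.\<close>
      obtain k0 where k0': "2 * real N / \<kappa>^3 < 2^k0" using real_arch_pow[of 2 "2 * real N / \<kappa>^3"] by auto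
      obtain k where k: "k0 \<le> k" "x \<in> E k" using xk by blast
      have kG: "k \<in> G" and xn: "x \<in> nbhds (D k) (w k)" using k(2) by (auto simp: E_def split: if_splits)
      obtain q p t :: int where q: "0 < q" "\<kappa>^3 * Q k \<le> q" "q \<le> Q k"
        "\<bar>q * x - p\<bar> \<le> 1 / n k" "\<bar>q * f x - t\<bar> \<le> 4 * M / n k"
        using D[OF kG] xn unfolding PD_def by blast
      have "(2::real)^k0 \<le> 2^k" using k(1) by simp
      also have "\<dots> \<le> 2 * Q k" by (rule Q_half[OF kG])
      finally have "real N / \<kappa>^3 < Q k" using k0' by simp
      then have "real N < \<kappa>^3 * Q k" using k0 by (simp add: divide_less_eq mult.commute)
      then have "real N < q" using q(2) by linarith
      then have Nq: "N \<le> nat q" by linarith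
      have qr: "real (nat q) = real_of_int q" using q(1) by simp
      have "\<delta> k \<le> \<psi> (2^k)" by (simp add: \<delta>_def)
      also have "\<dots> \<le> \<psi> (real (nat q))"
      proof -
        have "real_of_int q \<le> 2^k" using q(3) Q_le[of k] by linarith
        then show ?thesis unfolding qr by (rule \<psi>mono[rotated]) (use q(1) in simp)
      qed
      finally have dq: "\<delta> k \<le> \<psi> (real (nat q))" .
      have "4 * M / n k < \<delta> k"
      proof -
        have "5 * M \<le> n k * \<delta> k" using n_ge[of k] d0[of k] by (simp add: divide_le_eq)
        then have "4 * M < \<delta> k * n k" using M1 by (simp add: mult.commute)
        then show ?thesis using n0[of k] by (simp add: divide_less_eq)
      qed
      moreover have "1 / n k \<le> 4 * M / n k" using M1 by (intro divide_right_mono) auto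
      ultimately have "\<bar>real (nat q) * x - fst (p, t)\<bar> < \<psi> (real (nat q)) \<and> \<bar>real (nat q) * f x - snd (p, t)\<bar> < \<psi> (real (nat q))"
        unfolding qr[symmetric] using q(4,5) dq unfolding qr by simp
      then show "\<exists>q\<ge>N. 0 < q \<and> (\<exists>i::int \<times> int. \<bar>real q * x - fst i\<bar> < \<psi> (real q) \<and> \<bar>real q * f x - snd i\<bar> < \<psi> (real q))"
        using Nq q(1) by (intro exI[of _ "nat q"] conjI exI[of _ "(p, t)"]) auto
    qed
    moreover have "x \<in> {a..b}" using xk Esub by blast
    ultimately show "x \<in> {x\<in>{a..b}. simultaneously_approximable \<psi> (x, f x)}" by simp
  qed
  have C0: "0 < 12 / L" using L0 by simp
  note lim = measure_limsup_ge_of_quasi_independent[OF Elm Esub C0 qi Ediv[unfolded \<mu>_def[abs_def]]]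
  have "L / 24 \<le> measure lebesgue (\<Inter>N. \<Union>k\<in>{N..}. E k)" using lim(2) by simp
  also have "\<dots> \<le> measure lebesgue {x\<in>{a..b}. simultaneously_approximable \<psi> (x, f x)}"
    by (rule measure_mono_fmeasurable[OF sub fmeasurableD[OF lim(1)]
          approximable_lmeasurable[OF quad_pair_continuous(1)[OF quad]]])
  finally show ?thesis by (simp add: L_def)
qed

section \<open>Localisation and the exceptional null sets\<close>

text \<open>Taylor's formula with Lagrange remainder; on the compact interval \<open>h\<close> has a
  positive minimum and a finite maximum, which \<open>M\<close> collects together with the bound for
  \<open>g\<close>.\<close>

lemma has_quad_pair:
  fixes f g h :: "real \<Rightarrow> real"
  assumes ab: "a < b"
    and f: "\<And>x. x \<in> {a..b} \<Longrightarrow> (f has_real_derivative g x) (at x)"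
    and g: "\<And>x. x \<in> {a..b} \<Longrightarrow> (g has_real_derivative h x) (at x)"
    and h: "continuous_on {a..b} h" and pos: "\<And>x. x \<in> {a..b} \<Longrightarrow> 0 < h x"
  shows "\<exists>M. quad_pair M f g a b"
proof -
  have ne: "{a..b} \<noteq> {}" using ab by simp
  obtain x0 where x0: "x0 \<in> {a..b}" "\<And>x. x \<in> {a..b} \<Longrightarrow> h x0 \<le> h x"
    using continuous_attains_inf[OF compact_Icc ne h] by blast
  obtain x1 where x1: "x1 \<in> {a..b}" "\<And>x. x \<in> {a..b} \<Longrightarrow> h x \<le> h x1"
    using continuous_attains_sup[OF compact_Icc ne h] by blast
  have "continuous_on {a..b} g"
    by (intro continuous_at_imp_continuous_on ballI DERIV_isCont[OF g])
  then have "continuous_on {a..b} (\<lambda>x. \<bar>g x\<bar>)" by (intro continuous_intros)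
  then obtain x2 where x2: "x2 \<in> {a..b}" "\<And>x. x \<in> {a..b} \<Longrightarrow> \<bar>g x\<bar> \<le> \<bar>g x2\<bar>"
    using continuous_attains_sup[OF compact_Icc ne] by blast
  define M where "M = Max {1, \<bar>g x2\<bar>, h x1, 2 / h x0}"
  have M: "1 \<le> M" "\<bar>g x2\<bar> \<le> M" "h x1 \<le> M" "2 / h x0 \<le> M" unfolding M_def by auto
  have h0: "0 < h x0" using pos x0(1) .
  have M2: "1 / M \<le> h x0 / 2"
  proof -
    have "2 \<le> M * h x0" using M(4) h0 by (simp add: divide_le_eq)
    then show ?thesis using M(1) by (simp add: field_simps)
  qed
  have taylor: "(y - x)\<^sup>2 / M \<le> f y - f x - g x * (y - x) \<and> f y - f x - g x * (y - x) \<le> M * (y - x)\<^sup>2"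
    if x: "x \<in> {a..b}" and y: "y \<in> {a..b}" for x y
  proof (cases "x = y")
    case False
    define d where "d i = (if i = 0 then f else if i = 1 then g else h)" for i :: nat
    have "\<exists>t. (if y < x then y < t \<and> t < x else x < t \<and> t < y) \<and>
        f y = (\<Sum>m<2. (d m x / fact m) * (y - x) ^ m) + (d 2 t / fact 2) * (y - x) ^ 2"
    proof (rule Taylor[of 2 d f a b x y])
      show "\<forall>m t. m < 2 \<and> a \<le> t \<and> t \<le> b \<longrightarrow> DERIV (d m) t :> d (Suc m) t"
      proof (intro allI impI)
        fix m t assume m: "(m::nat) < 2 \<and> a \<le> t \<and> t \<le> b"
        then consider "m = 0" | "m = 1" by linarith
        then show "DERIV (d m) t :> d (Suc m) t"
          using f[of t] g[of t] m by cases (simp_all add: d_def)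
      qed
    qed (use x y False in \<open>auto simp: d_def\<close>)
    then obtain t where t: "if y < x then y < t \<and> t < x else x < t \<and> t < y"
      and eq: "f y = (\<Sum>m<2. (d m x / fact m) * (y - x) ^ m) + (d 2 t / fact 2) * (y - x) ^ 2" by blast
    have tab: "t \<in> {a..b}" using t x y by (auto split: if_splits)
    have eq2: "f y - f x - g x * (y - x) = h t / 2 * (y - x)\<^sup>2"
      unfolding eq by (simp add: d_def numeral_2_eq_2)
    have "(y - x)\<^sup>2 / M = 1 / M * (y - x)\<^sup>2" by simp
    also have "\<dots> \<le> h t / 2 * (y - x)\<^sup>2"
      using M2 x0(2)[OF tab] by (intro mult_right_mono) auto
    finally have lo: "(y - x)\<^sup>2 / M \<le> h t / 2 * (y - x)\<^sup>2" .
    have "h t / 2 * (y - x)\<^sup>2 \<le> M * (y - x)\<^sup>2"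
      using M(3) x1(2)[OF tab] pos[OF tab] by (intro mult_right_mono) auto
    with lo show ?thesis unfolding eq2 ..
  qed simp
  have "quad_pair M f g a b"
    unfolding quad_pair_def using M(1,2) x2(2) taylor by (meson order_trans)
  then show ?thesis by blast
qed

lemma dist_int_minus: "dist_int (- y) = dist_int y"
proof -
  have "(\<lambda>m::int. \<bar>- y - of_int m\<bar>) = (\<lambda>m. \<bar>y - of_int m\<bar>) \<circ> uminus"
    by (auto simp: fun_eq_iff)
  then have "range (\<lambda>m::int. \<bar>- y - of_int m\<bar>) = range (\<lambda>m::int. \<bar>y - of_int m\<bar>)"
    by (simp only: image_comp[symmetric] surj_uminus)
  then show ?thesis unfolding dist_int_def by simp
qed

lemma simultaneously_approximable_minus:
  "simultaneously_approximable \<psi> (x, - y) \<longleftrightarrow> simultaneously_approximable \<psi> (x, y)"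
  unfolding simultaneously_approximable_def by (simp add: dist_int_minus)

text \<open>The quadratic bounds pass to every subinterval, so the proportion 1/24 of approximable
  points is a uniform lower density.\<close>

lemma null_sets_not_approximable:
  assumes "quad_pair M f g a b"
    and "approximating_function \<psi>" "\<not> summable (\<lambda>h::nat. (\<psi> (real (Suc h)))\<^sup>2)"
  shows "{x\<in>{a<..<b}. \<not> simultaneously_approximable \<psi> (x, f x)} \<in> null_sets lebesgue"
proof -
  let ?A = "\<lambda>c d. {x\<in>{c..d}. simultaneously_approximable \<psi> (x, f x)}"
  have "?A a b \<in> sets lebesgue"
    using approximable_lmeasurable[OF quad_pair_continuous(1)[OF assms(1)]] by (rule fmeasurableD)
  then have "{a<..<b} - ?A a b \<in> null_sets lebesgue"
  proof (rule null_sets_Diff_of_uniform_density[of _ "1 / 24"])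
    fix c d :: real assume cd: "a \<le> c" "c < d" "d \<le> b"
    then have "quad_pair M f g c d" by (intro quad_pair_subset[OF assms(1)]) auto
    from measure_approximable_ge[OF this cd(2) assms(2,3)]
    have "1 / 24 * (d - c) \<le> measure lebesgue (?A c d)" by simp
    also have "?A c d = ?A a b \<inter> {c..d}" using cd by auto
    finally show "1 / 24 * (d - c) \<le> measure lebesgue (?A a b \<inter> {c..d})" .
  qed simp
  moreover have "{x\<in>{a<..<b}. \<not> simultaneously_approximable \<psi> (x, f x)} = {a<..<b} - ?A a b" by auto
  ultimately show ?thesis by simp
qed

text \<open>Rational endpoints leave only countably many intervals, so that their null sets can be
  united.\<close>

lemma exists_rat_quad_pair:
  fixes f g h :: "real \<Rightarrow> real"
  assumes S: "open S" "x \<in> S"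
    and f: "\<And>y. y \<in> S \<Longrightarrow> (f has_real_derivative g y) (at y)"
    and g: "\<And>y. y \<in> S \<Longrightarrow> (g has_real_derivative h y) (at y)"
    and h: "continuous_on S h" and hx: "0 < h x"
  shows "\<exists>p\<in>\<rat>. \<exists>q\<in>\<rat>. p < x \<and> x < q \<and> (\<exists>M. quad_pair M f g p q)"
proof -
  have "open (S \<inter> h -` {0<..})" by (rule continuous_open_preimage[OF h S(1) open_greaterThan])
  moreover have "x \<in> S \<inter> h -` {0<..}" using S(2) hx by simp
  ultimately obtain e where e: "0 < e" "ball x e \<subseteq> S \<inter> h -` {0<..}" using open_contains_ball by blast
  obtain p where p: "p \<in> \<rat>" "x - e < p" "p < x" using Rats_dense_in_real[of "x - e" x] e(1) by auto
  obtain q where q: "q \<in> \<rat>" "x < q" "q < x + e" using Rats_dense_in_real[of x "x + e"] e(1) by auto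
  have "{p..q} \<subseteq> ball x e" using p q by (auto simp: dist_real_def)
  then have sub: "y \<in> S" "0 < h y" if "y \<in> {p..q}" for y using that e(2) by auto
  have "\<exists>M. quad_pair M f g p q"
  proof (rule has_quad_pair)
    show "p < q" using p q by simp
    show "continuous_on {p..q} h" by (rule continuous_on_subset[OF h]) (use sub in blast)
  qed (use f g sub in blast)+
  then show ?thesis using p q by blast
qed

theorem theorem1:
  fixes \<psi> f :: "real \<Rightarrow> real" and I\<^sub>0 :: "real set"
  assumes "approximating_function \<psi>"
    and "\<not> summable (\<lambda>h::nat. (\<psi> (real (Suc h)))\<^sup>2)"
    and "is_interval I\<^sub>0"
    and "C_k_on 3 f I\<^sub>0"
    and "AE x\<in>I\<^sub>0 in lebesgue. (deriv_within I\<^sub>0 ^^ 2) f x \<noteq> 0"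
  shows "AE x\<in>I\<^sub>0 in lebesgue. simultaneously_approximable \<psi> (x, f x)"
proof -
  let ?f1 = "deriv_within I\<^sub>0 f"
  let ?f2 = "deriv_within I\<^sub>0 ?f1"
  let ?bad = "\<lambda>p q. {y\<in>{p<..<q}. \<not> simultaneously_approximable \<psi> (y, f y)}"
  have f2: "(deriv_within I\<^sub>0 ^^ 2) f = ?f2" by (simp add: numeral_2_eq_2)
  have diff: "(deriv_within I\<^sub>0 ^^ j) f differentiable_on I\<^sub>0" if "j < 3" for j
    using assms(4) that unfolding C_k_on_def by blast
  have d: "f differentiable_on I\<^sub>0" "?f1 differentiable_on I\<^sub>0" "?f2 differentiable_on I\<^sub>0"
    using diff[of 0] diff[of 1] diff[of 2] by (simp_all add: f2)
  \<comment> \<open>In the interior the derivatives within \<open>I\<^sub>0\<close> are ordinary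
    ones; the boundary points of the interval form a null set.\<close>
  let ?S = "interior I\<^sub>0"
  have der: "(F has_real_derivative deriv_within I\<^sub>0 F y) (at y)"
    if F: "F differentiable_on I\<^sub>0" and y: "y \<in> ?S" for F :: "real \<Rightarrow> real" and y
  proof -
    have "F differentiable (at y within I\<^sub>0)"
      using F y interior_subset unfolding differentiable_on_def by blast
    then have "(F has_vector_derivative deriv_within I\<^sub>0 F y) (at y within I\<^sub>0)"
      unfolding deriv_within_def vector_derivative_works .
    then show ?thesis
      using at_within_interior[OF y] by (simp add: has_real_derivative_iff_has_vector_derivative)
  qed
  have cont: "continuous_on ?S ?f2"
    by (rule continuous_on_subset[OF differentiable_imp_continuous_on[OF d(3)] interior_subset])
  have local: "\<exists>p\<in>\<rat>. \<exists>q\<in>\<rat>. p < x \<and> x < q \<and> ?bad p q \<in> null_sets lebesgue"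
    if x: "x \<in> ?S" and nz: "?f2 x \<noteq> 0" for x
  proof (cases "0 < ?f2 x")
    case True
    from exists_rat_quad_pair[OF open_interior x der[OF d(1)] der[OF d(2)] cont True]
    obtain p q M where pq: "p \<in> \<rat>" "q \<in> \<rat>" "p < x" "x < q" "quad_pair M f ?f1 p q" by blast
    then show ?thesis using null_sets_not_approximable[OF pq(5) assms(1,2)] by blast
  next
    case False
    \<comment> \<open>The concave case is reduced to the convex one by passing to
      \<open>- f\<close>, which has the same approximable abscissae.\<close>
    have "0 < - ?f2 x" using False nz by simp
    from exists_rat_quad_pair[OF open_interior x DERIV_minus[OF der[OF d(1)]] DERIV_minus[OF der[OF d(2)]]
        continuous_on_minus[OF cont] this]
    obtain p q M where pq: "p \<in> \<rat>" "q \<in> \<rat>" "p < x" "x < q" "quad_pair M (\<lambda>y. - f y) (\<lambda>y. - ?f1 y) p q"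
      by blast
    then show ?thesis
      using null_sets_not_approximable[OF pq(5) assms(1,2)] by (auto simp: simultaneously_approximable_minus)
  qed
  define R where "R = {(p, q). p \<in> \<rat> \<and> q \<in> \<rat> \<and> ?bad p q \<in> null_sets lebesgue}"
  have "countable (\<rat> \<times> \<rat> :: (real \<times> real) set)" by (intro countable_SIGMA countable_rat)
  then have "countable R" by (rule countable_subset[rotated]) (auto simp: R_def)
  then have N: "(\<Union>(p, q)\<in>R. ?bad p q) \<in> null_sets lebesgue"
    by (rule null_sets_UN') (auto simp: R_def)
  have fr: "frontier I\<^sub>0 \<in> null_sets lebesgue"
    using negligible_convex_frontier[of I\<^sub>0] assms(3)
    by (simp add: is_interval_convex_1 negligible_iff_null_sets)
  show ?thesis
    using assms(5) AE_not_in[OF N] AE_not_in[OF fr]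
  proof eventually_elim
    case (elim x)
    show ?case
    proof
      assume x: "x \<in> I\<^sub>0"
      then have xS: "x \<in> ?S" using elim(3) closure_subset[of I\<^sub>0] unfolding frontier_def by blast
      have "?f2 x \<noteq> 0" using elim(1) x f2 by simp
      from local[OF xS this] obtain p q where "(p, q) \<in> R" "p < x" "x < q" unfolding R_def by blast
      then show "simultaneously_approximable \<psi> (x, f x)" using elim(2) by fastforce
    qed
  qed
qed

end
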